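(* Let $K$ be a field. There exist a finite dimensional $K$-algebra $A$, with $n$ isomorphism classes of simple modules, and two $\tau$-tilting $A$-modules $X=\bigoplus_{i=1}^{n}X_i$ and $Y=\bigoplus_{i=1}^{n}Y_i$, with all $X_i$ and $Y_i$ indecomposable, for which there is no permutation $s$ of $\{1,\ldots,n\}$ having both of the following properties: (a) for all $i,j$, if $X_i\simeq Y_j$, then $s(i)=j$; (b) for every $i$ such that $X_i\not\simeq Y_j$ for all $j=1,\ldots,n$, one has $\mathrm{Ext}^1_A(X_i,Y_{s(i)})\oplus \mathrm{Ext}^1_A(Y_{s(i)},X_i)\neq 0$.
   Context: All modules are finite dimensional left modules. Let $A$ be a finite dimensional $K$-algebra with $n$ isomorphism classes of simple modules, and let $\tau$ be the Auslander-Reiten translation of $A$. A module $T$ is $\tau$-rigid if $\mathrm{Hom}_A(T,\tau(T))=0$. It is $\tau$-tilting if it is $\tau$-rigid and is the direct sum of $n$ pairwise non-isomorphic indecomposable modules. *)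

theory Defs
  imports "HOL-Algebra.Module" "HOL-Algebra.AbelCoset" "HOL-Combinatorics.Permutations"
begin

section \<open>Algebras and modules\<close>

text \<open>
  All structures are HOL-Algebra records. Modules over a non-commutative ring use the library's
  record type \<open>module\<close>, whose fields \<open>mult\<close> and \<open>one\<close> carry no information for a module. The
  library locale \<open>module\<close> requires a commutative ring of scalars; \<open>left_module\<close> is the same list
  of axioms over an arbitrary ring.
\<close>

locale left_module = R?: ring R + M?: abelian_group M
  for R :: "('a, 'c) ring_scheme" (structure) and M :: "('a, 'b, 'd) module_scheme" (structure) +
  assumes smult_closed:
      "\<lbrakk>a \<in> carrier R; x \<in> carrier M\<rbrakk> \<Longrightarrow> a \<odot>\<^bsub>M\<^esub> x \<in> carrier M"
    and smult_l_distr: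
      "\<lbrakk>a \<in> carrier R; b \<in> carrier R; x \<in> carrier M\<rbrakk> \<Longrightarrow>
        (a \<oplus>\<^bsub>R\<^esub> b) \<odot>\<^bsub>M\<^esub> x = a \<odot>\<^bsub>M\<^esub> x \<oplus>\<^bsub>M\<^esub> b \<odot>\<^bsub>M\<^esub> x"
    and smult_r_distr:
      "\<lbrakk>a \<in> carrier R; x \<in> carrier M; y \<in> carrier M\<rbrakk> \<Longrightarrow>
        a \<odot>\<^bsub>M\<^esub> (x \<oplus>\<^bsub>M\<^esub> y) = a \<odot>\<^bsub>M\<^esub> x \<oplus>\<^bsub>M\<^esub> a \<odot>\<^bsub>M\<^esub> y"
    and smult_assoc:
      "\<lbrakk>a \<in> carrier R; b \<in> carrier R; x \<in> carrier M\<rbrakk> \<Longrightarrow>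
        (a \<otimes>\<^bsub>R\<^esub> b) \<odot>\<^bsub>M\<^esub> x = a \<odot>\<^bsub>M\<^esub> (b \<odot>\<^bsub>M\<^esub> x)"
    and smult_one: "x \<in> carrier M \<Longrightarrow> \<one>\<^bsub>R\<^esub> \<odot>\<^bsub>M\<^esub> x = x"

definition finite_dim :: "('k, 'r) ring_scheme \<Rightarrow> ('k, 'v) module \<Rightarrow> bool" where
  "finite_dim K V \<longleftrightarrow>
    (\<exists>S. finite S \<and> S \<subseteq> carrier V \<and> (\<forall>W. submodule W K V \<and> S \<subseteq> W \<longrightarrow> W = carrier V))"

definition fd_algebra :: "('k, 'r) ring_scheme \<Rightarrow> ('k, 'a) module \<Rightarrow> bool" where
  "fd_algebra K A \<longleftrightarrow> field K \<and> ring A \<and> module K A \<and>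
    (\<forall>k\<in>carrier K. \<forall>x\<in>carrier A. \<forall>y\<in>carrier A.
      (k \<odot>\<^bsub>A\<^esub> x) \<otimes>\<^bsub>A\<^esub> y = k \<odot>\<^bsub>A\<^esub> (x \<otimes>\<^bsub>A\<^esub> y) \<and> x \<otimes>\<^bsub>A\<^esub> (k \<odot>\<^bsub>A\<^esub> y) = k \<odot>\<^bsub>A\<^esub> (x \<otimes>\<^bsub>A\<^esub> y)) \<and>
    finite_dim K A"

text \<open>The underlying \<open>K\<close>-vector space of an \<open>A\<close>-module.\<close>

definition restrict_scalars :: "('k, 'a) module \<Rightarrow> ('a, 'm) module \<Rightarrow> ('k, 'm) module" where
  "restrict_scalars A M =
    \<lparr>carrier = carrier M, monoid.mult = undefined, one = undefined,
     zero = \<zero>\<^bsub>M\<^esub>, add = add M, smult = (\<lambda>k x. (k \<odot>\<^bsub>A\<^esub> \<one>\<^bsub>A\<^esub>) \<odot>\<^bsub>M\<^esub> x)\<rparr>"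

definition fd_module :: "('k, 'r) ring_scheme \<Rightarrow> ('k, 'a) module \<Rightarrow> ('a, 'm) module \<Rightarrow> bool" where
  "fd_module K A M \<longleftrightarrow> left_module A M \<and> finite_dim K (restrict_scalars A M)"

definition regular_module :: "('a, 'c) ring_scheme \<Rightarrow> ('a, 'a) module" where
  "regular_module R =
    \<lparr>carrier = carrier R, monoid.mult = undefined, one = undefined,
     zero = \<zero>\<^bsub>R\<^esub>, add = add R, smult = monoid.mult R\<rparr>"

text \<open>Right modules are treated as left modules over the opposite algebra.\<close>

definition opposite :: "('k, 'a) module \<Rightarrow> ('k, 'a) module" where
  "opposite A = A\<lparr>monoid.mult := (\<lambda>x y. y \<otimes>\<^bsub>A\<^esub> x)\<rparr>"

definition zero_module :: "('a, 'm) module \<Rightarrow> bool" where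
  "zero_module M \<longleftrightarrow> carrier M = {\<zero>\<^bsub>M\<^esub>}"

text \<open>Homomorphisms are extensional functions, so that equal maps are equal functions.\<close>

definition mod_hom :: "('a, 'c) ring_scheme \<Rightarrow> ('a, 'm) module \<Rightarrow> ('a, 'n) module \<Rightarrow> ('m \<Rightarrow> 'n) set"
  where
  "mod_hom R M N = {f \<in> carrier M \<rightarrow>\<^sub>E carrier N.
    (\<forall>x\<in>carrier M. \<forall>y\<in>carrier M. f (x \<oplus>\<^bsub>M\<^esub> y) = f x \<oplus>\<^bsub>N\<^esub> f y) \<and>
    (\<forall>a\<in>carrier R. \<forall>x\<in>carrier M. f (a \<odot>\<^bsub>M\<^esub> x) = a \<odot>\<^bsub>N\<^esub> f x)}"

definition mod_iso :: "('a, 'c) ring_scheme \<Rightarrow> ('a, 'm) module \<Rightarrow> ('a, 'n) module \<Rightarrow> bool" where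
  "mod_iso R M N \<longleftrightarrow> (\<exists>f\<in>mod_hom R M N. bij_betw f (carrier M) (carrier N))"

text \<open>A set \<open>S\<close> of functions from \<open>M\<close> to \<open>N\<close> with pointwise addition and scalar action \<open>act\<close>.\<close>

definition fun_module ::
  "('m \<Rightarrow> 'n) set \<Rightarrow> ('b, 'm) module \<Rightarrow> ('c, 'n) module \<Rightarrow> ('a \<Rightarrow> ('m \<Rightarrow> 'n) \<Rightarrow> 'm \<Rightarrow> 'n) \<Rightarrow>
    ('a, 'm \<Rightarrow> 'n) module" where
  "fun_module S M N act =
    \<lparr>carrier = S, monoid.mult = undefined, one = undefined,
     zero = (\<lambda>x\<in>carrier M. \<zero>\<^bsub>N\<^esub>), add = (\<lambda>f g. \<lambda>x\<in>carrier M. f x \<oplus>\<^bsub>N\<^esub> g x), smult = act\<rparr>"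

definition Hom_space ::
  "('k, 'a) module \<Rightarrow> ('a, 'm) module \<Rightarrow> ('a, 'n) module \<Rightarrow> ('k, 'm \<Rightarrow> 'n) module" where
  "Hom_space A M N =
    fun_module (mod_hom A M N) M N (\<lambda>k f. \<lambda>x\<in>carrier M. (k \<odot>\<^bsub>A\<^esub> \<one>\<^bsub>A\<^esub>) \<odot>\<^bsub>N\<^esub> f x)"

definition quotient_module :: "('a, 'm) module \<Rightarrow> 'm set \<Rightarrow> ('a, 'm set) module" where
  "quotient_module M U =
    \<lparr>carrier = a_rcosets\<^bsub>M\<^esub> U, monoid.mult = undefined, one = undefined,
     zero = U, add = set_add M, smult = (\<lambda>a C. \<Union>x\<in>C. U +>\<^bsub>M\<^esub> (a \<odot>\<^bsub>M\<^esub> x))\<rparr>"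

definition dir_sum :: "'i set \<Rightarrow> ('i \<Rightarrow> ('a, 'm) module) \<Rightarrow> ('a, 'i \<Rightarrow> 'm) module" where
  "dir_sum I X =
    \<lparr>carrier = (\<Pi>\<^sub>E i\<in>I. carrier (X i)), monoid.mult = undefined, one = undefined,
     zero = (\<lambda>i\<in>I. \<zero>\<^bsub>X i\<^esub>), add = (\<lambda>f g. \<lambda>i\<in>I. f i \<oplus>\<^bsub>X i\<^esub> g i),
     smult = (\<lambda>a f. \<lambda>i\<in>I. a \<odot>\<^bsub>X i\<^esub> f i)\<rparr>" \<comment> \<open>only used for finite \<open>I\<close>\<close>

definition dir_sum2 :: "('a, 'm) module \<Rightarrow> ('a, 'n) module \<Rightarrow> ('a, 'm \<times> 'n) module" where
  "dir_sum2 M N =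
    \<lparr>carrier = carrier M \<times> carrier N, monoid.mult = undefined, one = undefined,
     zero = (\<zero>\<^bsub>M\<^esub>, \<zero>\<^bsub>N\<^esub>), add = (\<lambda>(x, y) (x', y'). (x \<oplus>\<^bsub>M\<^esub> x', y \<oplus>\<^bsub>N\<^esub> y')),
     smult = (\<lambda>a (x, y). (a \<odot>\<^bsub>M\<^esub> x, a \<odot>\<^bsub>N\<^esub> y))\<rparr>"

definition free_module :: "('k, 'a) module \<Rightarrow> nat \<Rightarrow> ('a, nat \<Rightarrow> 'a) module" where
  "free_module A r = dir_sum {..<r} (\<lambda>_. regular_module A)"

definition internal_dir_sum ::
  "('a, 'c) ring_scheme \<Rightarrow> ('a, 'm) module \<Rightarrow> 'm set \<Rightarrow> 'm set \<Rightarrow> bool" where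
  "internal_dir_sum R M U V \<longleftrightarrow> submodule U R M \<and> submodule V R M \<and>
    U <+>\<^bsub>M\<^esub> V = carrier M \<and> U \<inter> V = {\<zero>\<^bsub>M\<^esub>}"

definition indecomposable :: "('k, 'a) module \<Rightarrow> ('a, 'm) module \<Rightarrow> bool" where
  "indecomposable A M \<longleftrightarrow> left_module A M \<and> \<not> zero_module M \<and>
    (\<forall>U V. internal_dir_sum A M U V \<longrightarrow> U = {\<zero>\<^bsub>M\<^esub>} \<or> V = {\<zero>\<^bsub>M\<^esub>})"

definition simple_module :: "('k, 'a) module \<Rightarrow> ('a, 'm) module \<Rightarrow> bool" where
  "simple_module A M \<longleftrightarrow> left_module A M \<and> \<not> zero_module M \<and>
    (\<forall>U. submodule U A M \<longrightarrow> U = {\<zero>\<^bsub>M\<^esub>} \<or> U = carrier M)"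

text \<open>
  The number of isomorphism classes of simple modules. Every simple module is a quotient of the
  regular module, hence (choosing coset representatives) isomorphic to a module whose elements are
  of the type of the elements of \<open>A\<close>; so no class is missed by restricting to that type.
\<close>

definition num_simples :: "('k, 'a) module \<Rightarrow> nat" where
  "num_simples A =
    card ({S :: ('a, 'a) module. simple_module A S} //
      {(S, S'). simple_module A S \<and> simple_module A S' \<and> mod_iso A S S'})"

section \<open>Projective presentations, Auslander-Reiten translation, Ext\<close>

text \<open>Finitely generated projective modules: direct summands of some \<open>A\<^sup>r\<close>.\<close>

definition fg_projective :: "('k, 'a) module \<Rightarrow> ('a, 'p) module \<Rightarrow> bool" where
  "fg_projective A P \<longleftrightarrow> left_module A P \<and>
    (\<exists>r U V. internal_dir_sum A (free_module A r) U V \<and>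
      mod_iso A P ((free_module A r)\<lparr>carrier := U\<rparr>))"

definition superfluous :: "('k, 'a) module \<Rightarrow> ('a, 'm) module \<Rightarrow> 'm set \<Rightarrow> bool" where
  "superfluous A M U \<longleftrightarrow> submodule U A M \<and>
    (\<forall>V. submodule V A M \<and> U <+>\<^bsub>M\<^esub> V = carrier M \<longrightarrow> V = carrier M)"

definition projective_cover ::
  "('k, 'a) module \<Rightarrow> ('a, 'p) module \<Rightarrow> ('a, 'm) module \<Rightarrow> ('p \<Rightarrow> 'm) \<Rightarrow> bool" where
  "projective_cover A P M f \<longleftrightarrow> fg_projective A P \<and> f \<in> mod_hom A P M \<and>
    f ` carrier P = carrier M \<and> superfluous A P (a_kernel P M f)"

text \<open>
  A minimal projective presentation \<open>P1 \<rightarrow> P0 \<rightarrow> M \<rightarrow> 0\<close> with maps \<open>d1\<close> and \<open>d0\<close>: here \<open>d0\<close> is a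
  projective cover of \<open>M\<close>, and \<open>d1\<close> is one of the kernel of \<open>d0\<close>. Up to isomorphism, finitely
  generated projective modules have carriers inside some \<open>A\<^sup>r\<close>, i.e. of element type \<open>nat \<Rightarrow> 'a\<close>.
\<close>

definition min_proj_presentation ::
  "('k, 'a) module \<Rightarrow> ('a, 'm) module \<Rightarrow> ('a, nat \<Rightarrow> 'a) module \<Rightarrow> ('a, nat \<Rightarrow> 'a) module \<Rightarrow>
    ((nat \<Rightarrow> 'a) \<Rightarrow> (nat \<Rightarrow> 'a)) \<Rightarrow> ((nat \<Rightarrow> 'a) \<Rightarrow> 'm) \<Rightarrow> bool" where
  "min_proj_presentation A M P1 P0 d1 d0 \<longleftrightarrow>
    projective_cover A P0 M d0 \<and>
    projective_cover A P1 (P0\<lparr>carrier := a_kernel P0 M d0\<rparr>) d1"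

text \<open>The right module \<open>Hom\<^sub>A(P, A)\<close>, with \<open>(f \<cdot> a)(x) = f(x) a\<close>.\<close>

definition A_dual :: "('k, 'a) module \<Rightarrow> ('a, 'p) module \<Rightarrow> ('a, 'p \<Rightarrow> 'a) module" where
  "A_dual A P = fun_module (mod_hom A P (regular_module A)) P (regular_module A)
    (\<lambda>a f. \<lambda>x\<in>carrier P. f x \<otimes>\<^bsub>A\<^esub> a)"

text \<open>The transpose: the cokernel of \<open>Hom\<^sub>A(d1, A) : Hom\<^sub>A(P0, A) \<rightarrow> Hom\<^sub>A(P1, A)\<close>.\<close>

definition transpose_module ::
  "('k, 'a) module \<Rightarrow> ('a, 'p) module \<Rightarrow> ('a, 'q) module \<Rightarrow> ('p \<Rightarrow> 'q) \<Rightarrow>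
    ('a, ('p \<Rightarrow> 'a) set) module" where
  "transpose_module A P1 P0 d1 = quotient_module (A_dual A P1)
    ((\<lambda>g. compose (carrier P1) g d1) ` carrier (A_dual A P0))"

text \<open>
  For a left module \<open>N\<close> over an algebra \<open>B\<close>, the \<open>K\<close>-dual \<open>D N = Hom\<^sub>K(N, K)\<close> is a left module over
  the opposite of \<open>B\<close>, with \<open>(b \<cdot> f)(x) = f(b x)\<close>.
\<close>

definition K_dual ::
  "('k, 'r) ring_scheme \<Rightarrow> ('k, 'b) module \<Rightarrow> ('b, 'm) module \<Rightarrow> ('b, 'm \<Rightarrow> 'k) module" where
  "K_dual K B N =
    fun_module (mod_hom K (restrict_scalars B N) (regular_module K)) N (regular_module K)
      (\<lambda>b f. \<lambda>x\<in>carrier N. f (b \<odot>\<^bsub>N\<^esub> x))"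

text \<open>
  \<open>\<tau> M = D Tr M\<close>. As usual this depends on the chosen minimal projective presentation only up to
  isomorphism.
\<close>

definition AR_translate ::
  "('k, 'r) ring_scheme \<Rightarrow> ('k, 'a) module \<Rightarrow> ('a, 'm) module \<Rightarrow>
    ('a, ((nat \<Rightarrow> 'a) \<Rightarrow> 'a) set \<Rightarrow> 'k) module" where
  "AR_translate K A M =
    (let (P1, P0, d1, d0) = (SOME (P1, P0, d1, d0). min_proj_presentation A M P1 P0 d1 d0)
     in K_dual K (opposite A) (transpose_module A P1 P0 d1))"

text \<open>
  \<open>Ext\<^sup>1\<^sub>A(M, N)\<close>, computed from a short exact sequence \<open>0 \<rightarrow> \<Omega> \<rightarrow> F \<rightarrow> M \<rightarrow> 0\<close> with \<open>F = A\<^sup>r\<close> as the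
  cokernel of the restriction map \<open>Hom\<^sub>A(F, N) \<rightarrow> Hom\<^sub>A(\<Omega>, N)\<close>. It depends on the chosen sequence
  only up to isomorphism.
\<close>

definition Ext1 ::
  "('k, 'a) module \<Rightarrow> ('a, 'm) module \<Rightarrow> ('a, 'n) module \<Rightarrow>
    ('k, ((nat \<Rightarrow> 'a) \<Rightarrow> 'n) set) module" where
  "Ext1 A M N =
    (let (r, p) = (SOME (r, p). p \<in> mod_hom A (free_module A r) M \<and>
                     p ` carrier (free_module A r) = carrier M);
         F = free_module A r;
         \<Omega> = a_kernel F M p
     in quotient_module (Hom_space A (F\<lparr>carrier := \<Omega>\<rparr>) N)
          ((\<lambda>g. restrict g \<Omega>) ` mod_hom A F N))"

section \<open>Tau-tilting modules\<close>

definition tau_rigid :: "('k, 'r) ring_scheme \<Rightarrow> ('k, 'a) module \<Rightarrow> ('a, 'm) module \<Rightarrow> bool" where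
  "tau_rigid K A T \<longleftrightarrow> zero_module (Hom_space A T (AR_translate K A T))"

text \<open>
  The summands \<open>Z i\<close> may be taken with the element type of \<open>T\<close>, since they embed into \<open>T\<close>.
\<close>

definition tau_tilting :: "('k, 'r) ring_scheme \<Rightarrow> ('k, 'a) module \<Rightarrow> ('a, 'm) module \<Rightarrow> bool" where
  "tau_tilting K A T \<longleftrightarrow> fd_module K A T \<and> tau_rigid K A T \<and>
    (\<exists>Z :: nat \<Rightarrow> ('a, 'm) module.
      (\<forall>i\<in>{1..num_simples A}. indecomposable A (Z i)) \<and>
      (\<forall>i\<in>{1..num_simples A}. \<forall>j\<in>{1..num_simples A}. i \<noteq> j \<longrightarrow> \<not> mod_iso A (Z i) (Z j)) \<and>
      mod_iso A T (dir_sum {1..num_simples A} Z))"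

end

(*
  Let A be the path algebra of the quiver with two vertices 0, 1 and two arrows forming an oriented
  cycle, modulo all paths of length two; let P i be the projective cover of the simple module S i.
  Both P 0 + S 0 and P 1 + S 1 are tau-tilting. The module P 1 is not a summand of P 0 + S 0, so it
  would have to be matched with P 0 or S 0. But A is self-injective, so P 1 and P 0 are projective and
  injective, and all the relevant Ext groups vanish.

  That Hom(T, tau T) = 0 for T = P i + S i is seen from an arbitrary minimal presentation
  P1 -> P0 -> T: every homomorphism P1 -> P i = A e_i extends along P1 -> P0 by injectivity of P i,
  hence A e_i annihilates Tr T, whereas A e_i T = T.
*)

theory Submission
  imports Defs
begin

section \<open>Modules over arbitrary rings\<close>

text \<open>\<open>AR_translate\<close> and \<open>Ext1\<close> rest on choices made by
  \<open>SOME\<close>: a minimal presentation, an epimorphism from a free module. Trading the chosen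
  one for a convenient one would take uniqueness of projective covers and independence of the
  resolution. Both are avoided by arguing uniformly over all admissible choices; the explicit
  presentations and epimorphisms only witness that a choice exists. Injectivity of
  \<open>P i\<close> extends maps from submodules of P0, whereas P1 -> P0 has a kernel. The
  translate of \<open>S i\<close> is the simple module at the other vertex, and P i + S i has no
  nonzero map to it. This is why the cycle has two vertices: over K[x]/(x^2) the simple module is
  its own translate, hence not rigid. Linear functionals are obtained from Zorn's lemma rather than
  from bases.\<close>

lemma left_moduleI:
  fixes R (structure) and M (structure)
  assumes "ring R"
    and "\<zero>\<^bsub>M\<^esub> \<in> carrier M"
    and "\<And>x y. \<lbrakk>x \<in> carrier M; y \<in> carrier M\<rbrakk> \<Longrightarrow> x \<oplus>\<^bsub>M\<^esub> y \<in> carrier M"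
    and "\<And>x y z. \<lbrakk>x \<in> carrier M; y \<in> carrier M; z \<in> carrier M\<rbrakk> \<Longrightarrow> (x \<oplus>\<^bsub>M\<^esub> y) \<oplus>\<^bsub>M\<^esub> z = x \<oplus>\<^bsub>M\<^esub> (y \<oplus>\<^bsub>M\<^esub> z)"
    and "\<And>x y. \<lbrakk>x \<in> carrier M; y \<in> carrier M\<rbrakk> \<Longrightarrow> x \<oplus>\<^bsub>M\<^esub> y = y \<oplus>\<^bsub>M\<^esub> x"
    and "\<And>x. x \<in> carrier M \<Longrightarrow> \<zero>\<^bsub>M\<^esub> \<oplus>\<^bsub>M\<^esub> x = x"
    and neg: "\<And>x. x \<in> carrier M \<Longrightarrow> (\<ominus> \<one>) \<odot>\<^bsub>M\<^esub> x \<oplus>\<^bsub>M\<^esub> x = \<zero>\<^bsub>M\<^esub>"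
    and sc: "\<And>a x. \<lbrakk>a \<in> carrier R; x \<in> carrier M\<rbrakk> \<Longrightarrow> a \<odot>\<^bsub>M\<^esub> x \<in> carrier M"
    and "\<And>a b x. \<lbrakk>a \<in> carrier R; b \<in> carrier R; x \<in> carrier M\<rbrakk> \<Longrightarrow>
        (a \<oplus>\<^bsub>R\<^esub> b) \<odot>\<^bsub>M\<^esub> x = a \<odot>\<^bsub>M\<^esub> x \<oplus>\<^bsub>M\<^esub> b \<odot>\<^bsub>M\<^esub> x"
    and "\<And>a x y. \<lbrakk>a \<in> carrier R; x \<in> carrier M; y \<in> carrier M\<rbrakk> \<Longrightarrow>
        a \<odot>\<^bsub>M\<^esub> (x \<oplus>\<^bsub>M\<^esub> y) = a \<odot>\<^bsub>M\<^esub> x \<oplus>\<^bsub>M\<^esub> a \<odot>\<^bsub>M\<^esub> y"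
    and "\<And>a b x. \<lbrakk>a \<in> carrier R; b \<in> carrier R; x \<in> carrier M\<rbrakk> \<Longrightarrow>
        (a \<otimes>\<^bsub>R\<^esub> b) \<odot>\<^bsub>M\<^esub> x = a \<odot>\<^bsub>M\<^esub> (b \<odot>\<^bsub>M\<^esub> x)"
    and "\<And>x. x \<in> carrier M \<Longrightarrow> \<one>\<^bsub>R\<^esub> \<odot>\<^bsub>M\<^esub> x = x"
  shows "left_module R M"
proof -
  interpret ring R by fact
  \<comment> \<open>Multiplication by \<open>\<ominus> \<one>\<close> supplies the inverses, so
    their existence is reduced to the identity \<open>neg\<close>.\<close>
  have "\<exists>y\<in>carrier M. y \<oplus>\<^bsub>M\<^esub> x = \<zero>\<^bsub>M\<^esub>" if "x \<in> carrier M" for x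
    using neg[OF that] sc[OF _ that, of "\<ominus> \<one>"] by auto
  then have "abelian_group M"
    using assms(2-6) by (intro abelian_groupI)
  then show ?thesis
    using assms unfolding left_module_def left_module_axioms_def by simp
qed

context left_module
begin

lemmas [simp, intro] = smult_closed
lemmas [simp] = smult_one

lemma smult_l_null [simp]:
  assumes "x \<in> carrier M" shows "\<zero> \<odot>\<^bsub>M\<^esub> x = \<zero>\<^bsub>M\<^esub>"
proof -
  have "\<zero> \<odot>\<^bsub>M\<^esub> x \<oplus>\<^bsub>M\<^esub> \<zero> \<odot>\<^bsub>M\<^esub> x = \<zero> \<odot>\<^bsub>M\<^esub> x"
    using smult_l_distr[of \<zero> \<zero> x] assms by simp
  then show ?thesis using assms by (metis M.add.r_cancel_one' R.zero_closed smult_closed)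
qed

lemma smult_r_null [simp]:
  assumes "a \<in> carrier R" shows "a \<odot>\<^bsub>M\<^esub> \<zero>\<^bsub>M\<^esub> = \<zero>\<^bsub>M\<^esub>"
proof -
  have "a \<odot>\<^bsub>M\<^esub> \<zero>\<^bsub>M\<^esub> \<oplus>\<^bsub>M\<^esub> a \<odot>\<^bsub>M\<^esub> \<zero>\<^bsub>M\<^esub> = a \<odot>\<^bsub>M\<^esub> \<zero>\<^bsub>M\<^esub>"
    using smult_r_distr[of a "\<zero>\<^bsub>M\<^esub>" "\<zero>\<^bsub>M\<^esub>"] assms by simp
  then show ?thesis using assms by (metis M.add.r_cancel_one' M.zero_closed smult_closed)
qed

lemma smult_minus_one:
  assumes "x \<in> carrier M" shows "(\<ominus> \<one>) \<odot>\<^bsub>M\<^esub> x = \<ominus>\<^bsub>M\<^esub> x"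
proof -
  have "(\<ominus> \<one>) \<odot>\<^bsub>M\<^esub> x \<oplus>\<^bsub>M\<^esub> x = (\<ominus> \<one> \<oplus> \<one>) \<odot>\<^bsub>M\<^esub> x"
    using assms by (subst smult_l_distr) auto
  also have "\<dots> = \<zero>\<^bsub>M\<^esub>" using assms by (simp add: R.l_neg)
  finally show ?thesis using assms
    by (metis M.minus_equality R.a_inv_closed R.one_closed smult_closed)
qed

text \<open>Negatives are multiples by \<open>\<ominus> \<one>\<close>, so closure under them is
  contained in closure under scalars.\<close>

lemma submodule_iff:
  "submodule U R M \<longleftrightarrow> U \<subseteq> carrier M \<and> \<zero>\<^bsub>M\<^esub> \<in> U \<and> (\<forall>x\<in>U. \<forall>y\<in>U. x \<oplus>\<^bsub>M\<^esub> y \<in> U) \<and>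
     (\<forall>a\<in>carrier R. \<forall>x\<in>U. a \<odot>\<^bsub>M\<^esub> x \<in> U)" (is "_ \<longleftrightarrow> ?r")
proof
  assume "submodule U R M"
  then interpret submodule U R M .
  show ?r using subset one_closed m_closed smult_closed by auto
next
  assume r: ?r
  have "\<ominus>\<^bsub>M\<^esub> x \<in> U" if "x \<in> U" for x
    using r that smult_minus_one[of x] by (metis R.a_inv_closed R.one_closed subsetD)
  then show "submodule U R M"
    unfolding submodule_def subgroup_def submodule_axioms_def using r by (auto simp: a_inv_def)
qed

lemma submoduleI:
  assumes "U \<subseteq> carrier M" "\<zero>\<^bsub>M\<^esub> \<in> U" "\<And>x y. \<lbrakk>x \<in> U; y \<in> U\<rbrakk> \<Longrightarrow> x \<oplus>\<^bsub>M\<^esub> y \<in> U"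
    "\<And>a x. \<lbrakk>a \<in> carrier R; x \<in> U\<rbrakk> \<Longrightarrow> a \<odot>\<^bsub>M\<^esub> x \<in> U"
  shows "submodule U R M"
  using assms by (auto simp: submodule_iff)

lemma submoduleD:
  assumes "submodule U R M"
  shows "U \<subseteq> carrier M" "\<And>x. x \<in> U \<Longrightarrow> x \<in> carrier M" "\<zero>\<^bsub>M\<^esub> \<in> U"
    "\<And>x y. \<lbrakk>x \<in> U; y \<in> U\<rbrakk> \<Longrightarrow> x \<oplus>\<^bsub>M\<^esub> y \<in> U"
    "\<And>a x. \<lbrakk>a \<in> carrier R; x \<in> U\<rbrakk> \<Longrightarrow> a \<odot>\<^bsub>M\<^esub> x \<in> U"
    "\<And>x. x \<in> U \<Longrightarrow> \<ominus>\<^bsub>M\<^esub> x \<in> U"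
proof -
  show "\<ominus>\<^bsub>M\<^esub> x \<in> U" if "x \<in> U" for x
    using assms that smult_minus_one[of x] unfolding submodule_iff
    by (metis R.a_inv_closed R.one_closed subsetD)
qed (use assms in \<open>auto simp: submodule_iff\<close>)

lemma submodule_carrier: "submodule (carrier M) R M"
  by (rule submoduleI) auto

lemma submodule_left_module:
  assumes "submodule U R M" shows "left_module R (M\<lparr>carrier := U\<rparr>)"
  using submoduleD[OF assms]
  by (intro left_moduleI)
     (auto intro: R.ring_axioms M.a_comm simp: smult_l_distr smult_r_distr smult_assoc smult_minus_one M.l_neg M.a_assoc)

lemma submodule_submodule:
  assumes "submodule U R M"
  shows "submodule V R (M\<lparr>carrier := U\<rparr>) \<longleftrightarrow> submodule V R M \<and> V \<subseteq> U"
  using submodule_left_module[OF assms, THEN left_module.submodule_iff, of V] submodule_iff[of V]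
    submoduleD(1)[OF assms] by auto

end

lemma mem_set_add: "z \<in> U <+>\<^bsub>M\<^esub> V \<longleftrightarrow> (\<exists>u\<in>U. \<exists>v\<in>V. z = u \<oplus>\<^bsub>M\<^esub> v)"
  by (auto simp: set_add_def')

lemma mem_a_r_coset: "z \<in> U +>\<^bsub>M\<^esub> x \<longleftrightarrow> (\<exists>u\<in>U. z = u \<oplus>\<^bsub>M\<^esub> x)"
  by (auto simp: a_r_coset_def')

lemma mem_a_kernel: "x \<in> a_kernel M N f \<longleftrightarrow> x \<in> carrier M \<and> f x = \<zero>\<^bsub>N\<^esub>"
  by (simp add: a_kernel_def kernel_def)

section \<open>Homomorphisms\<close>

lemma mod_homI:
  assumes "\<And>x. x \<in> carrier M \<Longrightarrow> f x \<in> carrier N" "\<And>x. x \<notin> carrier M \<Longrightarrow> f x = undefined"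
    "\<And>x y. \<lbrakk>x \<in> carrier M; y \<in> carrier M\<rbrakk> \<Longrightarrow> f (x \<oplus>\<^bsub>M\<^esub> y) = f x \<oplus>\<^bsub>N\<^esub> f y"
    "\<And>a x. \<lbrakk>a \<in> carrier R; x \<in> carrier M\<rbrakk> \<Longrightarrow> f (a \<odot>\<^bsub>M\<^esub> x) = a \<odot>\<^bsub>N\<^esub> f x"
  shows "f \<in> mod_hom R M N"
  using assms unfolding mod_hom_def by auto

lemma mod_homD:
  assumes "f \<in> mod_hom R M N"
  shows "\<And>x. x \<in> carrier M \<Longrightarrow> f x \<in> carrier N" "f \<in> carrier M \<rightarrow>\<^sub>E carrier N"
    "\<And>x. x \<notin> carrier M \<Longrightarrow> f x = undefined"
    "\<And>x y. \<lbrakk>x \<in> carrier M; y \<in> carrier M\<rbrakk> \<Longrightarrow> f (x \<oplus>\<^bsub>M\<^esub> y) = f x \<oplus>\<^bsub>N\<^esub> f y"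
    "\<And>a x. \<lbrakk>a \<in> carrier R; x \<in> carrier M\<rbrakk> \<Longrightarrow> f (a \<odot>\<^bsub>M\<^esub> x) = a \<odot>\<^bsub>N\<^esub> f x"
  using assms unfolding mod_hom_def by auto

lemma mod_hom_eqI:
  assumes "f \<in> mod_hom R M N" "g \<in> mod_hom R' M N'" "\<And>x. x \<in> carrier M \<Longrightarrow> f x = g x"
  shows "f = g"
proof
  fix x show "f x = g x"
    using assms mod_homD(3)[OF assms(1), of x] mod_homD(3)[OF assms(2), of x]
    by (cases "x \<in> carrier M") auto
qed

lemma mod_hom_zero:
  assumes "f \<in> mod_hom R M N" "left_module R M" "left_module R N"
  shows "f \<zero>\<^bsub>M\<^esub> = \<zero>\<^bsub>N\<^esub>"
proof -
  interpret M: left_module R M by fact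
  interpret N: left_module R N by fact
  note f = mod_homD[OF assms(1)]
  have "f \<zero>\<^bsub>M\<^esub> \<oplus>\<^bsub>N\<^esub> f \<zero>\<^bsub>M\<^esub> = f \<zero>\<^bsub>M\<^esub>" using f(4)[of "\<zero>\<^bsub>M\<^esub>" "\<zero>\<^bsub>M\<^esub>"] by simp
  then show ?thesis by (metis N.M.add.r_cancel_one' M.M.zero_closed f(1))
qed

lemma mod_hom_minus:
  assumes "f \<in> mod_hom R M N" "left_module R M" "left_module R N" "x \<in> carrier M"
  shows "f (\<ominus>\<^bsub>M\<^esub> x) = \<ominus>\<^bsub>N\<^esub> f x"
proof -
  interpret M: left_module R M by fact
  interpret N: left_module R N by fact
  note f = mod_homD[OF assms(1)]
  show ?thesis using f(5)[of "\<ominus>\<^bsub>R\<^esub> \<one>\<^bsub>R\<^esub>" x] f(1)[of x] assms(4)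
    by (simp add: M.smult_minus_one N.smult_minus_one)
qed

lemma mod_hom_compose:
  assumes f: "f \<in> mod_hom R M N" and g: "g \<in> mod_hom R N L" and M: "left_module R M"
  shows "compose (carrier M) g f \<in> mod_hom R M L"
proof -
  interpret M: left_module R M by fact
  show ?thesis using mod_homD[OF f] mod_homD[OF g]
    by (intro mod_homI) (auto simp: compose_def)
qed

lemma a_kernel_submodule:
  assumes "f \<in> mod_hom R M N" "left_module R M" "left_module R N"
  shows "submodule (a_kernel M N f) R M"
proof -
  interpret M: left_module R M by fact
  interpret N: left_module R N by fact
  show ?thesis
    using mod_homD[OF assms(1)] mod_hom_zero[OF assms]
    by (intro M.submoduleI) (auto simp: mem_a_kernel)
qed

lemma image_submodule:
  assumes f: "f \<in> mod_hom R M N" and M: "left_module R M" and N: "left_module R N"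
    and U: "submodule U R M"
  shows "submodule (f ` U) R N"
proof -
  interpret M: left_module R M by fact
  interpret N: left_module R N by fact
  note U = M.submoduleD[OF U] and f' = mod_homD[OF f]
  show ?thesis
  proof (intro N.submoduleI)
    show "\<zero>\<^bsub>N\<^esub> \<in> f ` U" using U(3) mod_hom_zero[OF f M N] by force
    show "f ` U \<subseteq> carrier N" using U f' by auto
    show "x \<oplus>\<^bsub>N\<^esub> y \<in> f ` U" if xy: "x \<in> f ` U" "y \<in> f ` U" for x y
    proof -
      from xy obtain u v where "u \<in> U" "x = f u" "v \<in> U" "y = f v" by blast
      then show ?thesis using U f' by (auto intro!: image_eqI[of _ _ "u \<oplus>\<^bsub>M\<^esub> v"])
    qed
    show "a \<odot>\<^bsub>N\<^esub> x \<in> f ` U" if "a \<in> carrier R" and x: "x \<in> f ` U" for a x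
    proof -
      from x obtain u where "u \<in> U" "x = f u" by blast
      then show ?thesis using that U f' by (auto intro!: image_eqI[of _ _ "a \<odot>\<^bsub>M\<^esub> u"])
    qed
  qed
qed

lemma mod_hom_injI:
  assumes f: "f \<in> mod_hom R M N" and M: "left_module R M" and N: "left_module R N"
    and ker: "\<And>x. \<lbrakk>x \<in> carrier M; f x = \<zero>\<^bsub>N\<^esub>\<rbrakk> \<Longrightarrow> x = \<zero>\<^bsub>M\<^esub>"
  shows "inj_on f (carrier M)"
proof (rule inj_onI)
  interpret M: left_module R M by fact
  interpret N: left_module R N by fact
  fix x y assume xy: "x \<in> carrier M" "y \<in> carrier M" "f x = f y"
  have "f (x \<oplus>\<^bsub>M\<^esub> \<ominus>\<^bsub>M\<^esub> y) = \<zero>\<^bsub>N\<^esub>"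
    using xy mod_homD[OF f] mod_hom_minus[OF f M N] by (simp add: N.M.r_neg)
  then have "x \<oplus>\<^bsub>M\<^esub> \<ominus>\<^bsub>M\<^esub> y = \<zero>\<^bsub>M\<^esub>" using ker xy by simp
  then show "x = y" using xy by (simp add: M.M.add.inv_solve_right')
qed

lemma mod_hom_surjE:
  assumes "f ` carrier M = carrier N" "y \<in> carrier N"
  obtains x where "x \<in> carrier M" "f x = y"
  using assms by (metis imageE)

lemma mod_iso_refl:
  assumes "left_module R M" shows "mod_iso R M M"
proof -
  interpret left_module R M by fact
  show ?thesis unfolding mod_iso_def
    by (rule bexI[of _ "\<lambda>x\<in>carrier M. x"]) (auto simp: bij_betw_def inj_on_def intro!: mod_homI)
qed

lemma mod_iso_sym:
  assumes "mod_iso R M N" "left_module R M"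
  shows "mod_iso R N M"
proof -
  interpret M: left_module R M by fact
  from assms obtain f where f: "f \<in> mod_hom R M N" and b: "bij_betw f (carrier M) (carrier N)"
    unfolding mod_iso_def by blast
  note f' = mod_homD[OF f] and inj = bij_betw_imp_inj_on[OF b] and img = bij_betw_imp_surj_on[OF b]
  define g where "g = (\<lambda>y\<in>carrier N. inv_into (carrier M) f y)"
  have g: "g y \<in> carrier M \<and> f (g y) = y" if "y \<in> carrier N" for y
    using that img by (auto simp: g_def f_inv_into_f inv_into_into)
  have eq: "g (f x) = x" if "x \<in> carrier M" for x
    using that f'(1) inj by (simp add: g_def inv_into_f_f)
  have "g \<in> mod_hom R N M"
  proof (rule mod_homI)
    fix x y assume xy: "x \<in> carrier N" "y \<in> carrier N"
    then have "f (g x \<oplus>\<^bsub>M\<^esub> g y) = x \<oplus>\<^bsub>N\<^esub> y" using g f' by auto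
    then show "g (x \<oplus>\<^bsub>N\<^esub> y) = g x \<oplus>\<^bsub>M\<^esub> g y" using eq g xy by (metis M.M.a_closed)
  next
    fix a x assume ax: "a \<in> carrier R" "x \<in> carrier N"
    then have "f (a \<odot>\<^bsub>M\<^esub> g x) = a \<odot>\<^bsub>N\<^esub> x" using g f' by auto
    then show "g (a \<odot>\<^bsub>N\<^esub> x) = a \<odot>\<^bsub>M\<^esub> g x" using eq g ax by (metis M.smult_closed)
  qed (use g in \<open>auto simp: g_def\<close>)
  moreover have "bij_betw g (carrier N) (carrier M)"
    using g eq f' by (intro bij_betw_byWitness[where f' = f]) auto
  ultimately show ?thesis unfolding mod_iso_def by blast
qed

lemma mod_iso_trans:
  assumes "mod_iso R M N" "mod_iso R N L" "left_module R M"
  shows "mod_iso R M L"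
  using assms mod_hom_compose bij_betw_compose
  unfolding mod_iso_def by (metis bij_betw_compose)

section \<open>Constructions of modules\<close>

lemma regular_module_simps [simp]:
  "carrier (regular_module R) = carrier R" "\<zero>\<^bsub>regular_module R\<^esub> = \<zero>\<^bsub>R\<^esub>"
  "add (regular_module R) = add R" "smult (regular_module R) = monoid.mult R"
  by (simp_all add: regular_module_def)

lemma a_inv_opposite [simp]: "\<ominus>\<^bsub>opposite A\<^esub> x = \<ominus>\<^bsub>A\<^esub> x"
  by (simp add: opposite_def a_inv_def m_inv_def)

lemma a_inv_regular_module [simp]: "\<ominus>\<^bsub>regular_module R\<^esub> x = \<ominus>\<^bsub>R\<^esub> x"
  by (simp add: a_inv_def m_inv_def)

lemma dir_sum_simps [simp]:
  "carrier (dir_sum I X) = (\<Pi>\<^sub>E i\<in>I. carrier (X i))" "\<zero>\<^bsub>dir_sum I X\<^esub> = (\<lambda>i\<in>I. \<zero>\<^bsub>X i\<^esub>)"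
  "f \<oplus>\<^bsub>dir_sum I X\<^esub> g = (\<lambda>i\<in>I. f i \<oplus>\<^bsub>X i\<^esub> g i)" "a \<odot>\<^bsub>dir_sum I X\<^esub> f = (\<lambda>i\<in>I. a \<odot>\<^bsub>X i\<^esub> f i)"
  by (simp_all add: dir_sum_def)

lemma fun_module_simps [simp]:
  "carrier (fun_module S M N act) = S" "\<zero>\<^bsub>fun_module S M N act\<^esub> = (\<lambda>x\<in>carrier M. \<zero>\<^bsub>N\<^esub>)"
  "f \<oplus>\<^bsub>fun_module S M N act\<^esub> g = (\<lambda>x\<in>carrier M. f x \<oplus>\<^bsub>N\<^esub> g x)"
  "a \<odot>\<^bsub>fun_module S M N act\<^esub> f = act a f"
  by (simp_all add: fun_module_def)

lemma quotient_module_simps [simp]: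
  "carrier (quotient_module M U) = a_rcosets\<^bsub>M\<^esub> U" "\<zero>\<^bsub>quotient_module M U\<^esub> = U"
  "C \<oplus>\<^bsub>quotient_module M U\<^esub> D = C <+>\<^bsub>M\<^esub> D"
  "a \<odot>\<^bsub>quotient_module M U\<^esub> C = (\<Union>x\<in>C. U +>\<^bsub>M\<^esub> (a \<odot>\<^bsub>M\<^esub> x))"
  by (simp_all add: quotient_module_def)

lemma restrict_scalars_simps [simp]:
  "carrier (restrict_scalars A M) = carrier M" "\<zero>\<^bsub>restrict_scalars A M\<^esub> = \<zero>\<^bsub>M\<^esub>"
  "add (restrict_scalars A M) = add M"
  "k \<odot>\<^bsub>restrict_scalars A M\<^esub> x = (k \<odot>\<^bsub>A\<^esub> \<one>\<^bsub>A\<^esub>) \<odot>\<^bsub>M\<^esub> x"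
  by (simp_all add: restrict_scalars_def)

lemma opposite_simps [simp]:
  "carrier (opposite A) = carrier A" "\<zero>\<^bsub>opposite A\<^esub> = \<zero>\<^bsub>A\<^esub>" "\<one>\<^bsub>opposite A\<^esub> = \<one>\<^bsub>A\<^esub>"
  "add (opposite A) = add A" "smult (opposite A) = smult A" "x \<otimes>\<^bsub>opposite A\<^esub> y = y \<otimes>\<^bsub>A\<^esub> x"
  by (simp_all add: opposite_def)

text \<open>Turns the dual of a right module, a priori a module over
  \<open>opposite (opposite A)\<close>, into a module over \<open>A\<close> itself, as the translate
  requires.\<close>

lemma opposite_opposite [simp]: "opposite (opposite A) = A"
  by (simp add: opposite_def)

lemma regular_left_module:
  assumes "ring R" shows "left_module R (regular_module R)"
proof -
  interpret ring R by fact
  show ?thesis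
    by (rule left_moduleI)
       (auto simp: l_distr r_distr m_assoc a_assoc l_minus l_neg intro: assms a_comm)
qed

lemma dir_sum_left_module:
  assumes R: "ring R" and X: "\<And>i. i \<in> I \<Longrightarrow> left_module R (X i)"
  shows "left_module R (dir_sum I X)"
proof -
  interpret R: ring R by fact
  have X': "abelian_group (X i)" if "i \<in> I" for i using X[OF that] by (simp add: left_module_def)
  note l = left_module.smult_closed left_module.smult_l_distr left_module.smult_r_distr
    left_module.smult_assoc left_module.smult_one left_module.smult_minus_one
  note g = abelian_groupE[OF X'] abelian_group.l_neg[OF X'] 
  have m: "f i \<in> carrier (X i)" if "f \<in> (\<Pi>\<^sub>E i\<in>I. carrier (X i))" "i \<in> I" for f i using that by auto
  show ?thesis
  proof (rule left_moduleI[OF R], goal_cases)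
    case (3 f g h)
    then show ?case by (auto intro!: restrict_ext g simp: m)
  next
    case (4 f g)
    then show ?case by (auto intro!: restrict_ext g simp: m)
  next
    case (5 f)
    then have "\<zero>\<^bsub>X i\<^esub> \<oplus>\<^bsub>X i\<^esub> f i = f i" if "i \<in> I" for i using that by (intro g) auto
    with 5 show ?case by (auto simp: fun_eq_iff PiE_def extensional_def)
  next
    case f: (6 f)
    then have "(\<ominus>\<^bsub>R\<^esub> \<one>\<^bsub>R\<^esub>) \<odot>\<^bsub>X i\<^esub> f i \<oplus>\<^bsub>X i\<^esub> f i = \<zero>\<^bsub>X i\<^esub>" if "i \<in> I" for i
    proof -
      have "f i \<in> carrier (X i)" using f that by auto
      then show ?thesis using l(6)[OF X[OF that]] g(7)[OF that] by simp
    qed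
    then show ?case by (auto intro!: restrict_ext)
  next
    case (11 f)
    then have "\<one>\<^bsub>R\<^esub> \<odot>\<^bsub>X i\<^esub> f i = f i" if "i \<in> I" for i using that by (intro l X) auto
    with 11 show ?case by (auto simp: fun_eq_iff PiE_def extensional_def)
  qed (auto intro!: restrict_ext simp: g(1-6) l[OF X] m)
qed

lemma free_left_module: "ring A \<Longrightarrow> left_module A (free_module A r)"
  unfolding free_module_def by (intro dir_sum_left_module regular_left_module)

text \<open>Serves both duals: \<open>A_dual\<close>, where scalars multiply the values, and
  \<open>K_dual\<close>, where they act on the arguments. Since the members of \<open>S\<close> are
  extensional, the axioms need only be compared pointwise on \<open>carrier M\<close>.\<close>

lemma fun_module_left_module:
  assumes R: "ring R" and N: "abelian_group N" and S: "S \<subseteq> carrier M \<rightarrow>\<^sub>E carrier N"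
    and z: "(\<lambda>x\<in>carrier M. \<zero>\<^bsub>N\<^esub>) \<in> S"
    and add: "\<And>f g. \<lbrakk>f \<in> S; g \<in> S\<rbrakk> \<Longrightarrow> (\<lambda>x\<in>carrier M. f x \<oplus>\<^bsub>N\<^esub> g x) \<in> S"
    and act: "\<And>a f. \<lbrakk>a \<in> carrier R; f \<in> S\<rbrakk> \<Longrightarrow> act a f \<in> S"
    and l_distr: "\<And>a b f x. \<lbrakk>a \<in> carrier R; b \<in> carrier R; f \<in> S; x \<in> carrier M\<rbrakk> \<Longrightarrow>
       act (a \<oplus>\<^bsub>R\<^esub> b) f x = act a f x \<oplus>\<^bsub>N\<^esub> act b f x"
    and r_distr: "\<And>a f g x. \<lbrakk>a \<in> carrier R; f \<in> S; g \<in> S; x \<in> carrier M\<rbrakk> \<Longrightarrow>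
       act a (\<lambda>x\<in>carrier M. f x \<oplus>\<^bsub>N\<^esub> g x) x = act a f x \<oplus>\<^bsub>N\<^esub> act a g x"
    and assoc: "\<And>a b f x. \<lbrakk>a \<in> carrier R; b \<in> carrier R; f \<in> S; x \<in> carrier M\<rbrakk> \<Longrightarrow>
       act (a \<otimes>\<^bsub>R\<^esub> b) f x = act a (act b f) x"
    and one: "\<And>f x. \<lbrakk>f \<in> S; x \<in> carrier M\<rbrakk> \<Longrightarrow> act \<one>\<^bsub>R\<^esub> f x = f x"
    and neg: "\<And>f x. \<lbrakk>f \<in> S; x \<in> carrier M\<rbrakk> \<Longrightarrow> act (\<ominus>\<^bsub>R\<^esub> \<one>\<^bsub>R\<^esub>) f x = \<ominus>\<^bsub>N\<^esub> f x"
  shows "left_module R (fun_module S M N act)"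
proof -
  interpret R: ring R by fact
  interpret N: abelian_group N by fact
  have mem: "f x \<in> carrier N" if "f \<in> S" "x \<in> carrier M" for f x using S that by auto
  have undef: "f x = undefined" if "f \<in> S" "x \<notin> carrier M" for f x
    using S that by (meson PiE_arb subsetD)
  have eqI: "f = g" if "f \<in> S" "g \<in> S" "\<And>x. x \<in> carrier M \<Longrightarrow> f x = g x" for f g
    using that undef by (metis ext)
  show ?thesis
  proof (rule left_moduleI[OF R], goal_cases)
    case (3 f g h)
    then show ?case by (auto intro!: restrict_ext simp: mem N.a_assoc)
  next
    case (4 f g)
    then show ?case by (auto intro!: restrict_ext simp: mem N.a_comm)
  next
    case (5 f)
    then show ?case using z add[OF z, of f] by (intro eqI) (auto simp: mem cong: restrict_cong)
  next
    case (6 f)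
    then show ?case by (auto intro!: restrict_ext simp: neg mem N.l_neg)
  next
    case (8 a b f)
    then show ?case by (intro eqI) (auto simp: l_distr intro!: add act)
  next
    case (9 a f g)
    then show ?case by (intro eqI) (auto simp: r_distr intro!: add act)
  next
    case (10 a b f)
    then show ?case by (intro eqI) (auto simp: assoc intro!: act)
  next
    case (11 f)
    then show ?case by (intro eqI) (auto simp: one intro!: act)
  qed (auto simp: z add act)
qed

section \<open>Pointwise operations on homomorphisms\<close>

lemma zero_mod_hom:
  assumes "left_module R M" "left_module R N"
  shows "(\<lambda>x\<in>carrier M. \<zero>\<^bsub>N\<^esub>) \<in> mod_hom R M N"
proof -
  interpret M: left_module R M by fact
  interpret N: left_module R N by fact
  show ?thesis by (rule mod_homI) auto
qed

lemma add_mod_hom: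
  assumes "left_module R M" "left_module R N" "f \<in> mod_hom R M N" "g \<in> mod_hom R M N"
  shows "(\<lambda>x\<in>carrier M. f x \<oplus>\<^bsub>N\<^esub> g x) \<in> mod_hom R M N"
proof -
  interpret M: left_module R M by fact
  interpret N: left_module R N by fact
  note f = mod_homD[OF assms(3)] and g = mod_homD[OF assms(4)]
  show ?thesis by (rule mod_homI) (auto simp: f g N.M.a_ac N.smult_r_distr)
qed

lemma neg_mod_hom:
  assumes "left_module R M" "left_module R N" "f \<in> mod_hom R M N"
  shows "(\<lambda>x\<in>carrier M. \<ominus>\<^bsub>N\<^esub> f x) \<in> mod_hom R M N"
proof -
  interpret M: left_module R M by fact
  interpret N: left_module R N by fact
  note f = mod_homD[OF assms(3)]
  have "a \<odot>\<^bsub>N\<^esub> (\<ominus>\<^bsub>N\<^esub> x) = \<ominus>\<^bsub>N\<^esub> (a \<odot>\<^bsub>N\<^esub> x)" if "a \<in> carrier R" "x \<in> carrier N" for a x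
    using that
    by (metis N.M.a_inv_closed N.M.l_neg N.M.minus_equality N.smult_closed N.smult_r_distr N.smult_r_null)
  then show ?thesis by (intro mod_homI) (auto simp: f N.M.minus_add)
qed

section \<open>Opposite rings, the dual Hom(P, A) and quotient modules\<close>

lemma opposite_ring:
  assumes "ring A" shows "ring (opposite A)"
proof -
  interpret ring A by fact
  show ?thesis
  proof (rule ringI)
    show "abelian_group (opposite A)"
      by (rule abelian_groupI) (auto simp: a_ac intro: add.l_inv_ex)
    show "monoid (opposite A)"
      by (rule monoidI) (auto simp: m_assoc)
  qed (auto simp: l_distr r_distr)
qed

text \<open>By associativity, multiplying the values of \<open>f\<close> on the right does not
  disturb left linearity; this is what makes Hom(P, A) a right module.\<close>

lemma A_dual_left_module:
  assumes A: "ring A" and P: "left_module A P"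
  shows "left_module (opposite A) (A_dual A P)"
proof -
  interpret A: ring A by fact
  interpret P: left_module A P by fact
  note R = regular_left_module[OF A]
  have m: "f x \<in> carrier A" if "f \<in> mod_hom A P (regular_module A)" "x \<in> carrier P" for f x
    using mod_homD(1)[OF that] by simp
  have h: "f (x \<oplus>\<^bsub>P\<^esub> y) = f x \<oplus>\<^bsub>A\<^esub> f y"
    if "f \<in> mod_hom A P (regular_module A)" "x \<in> carrier P" "y \<in> carrier P" for f x y
    using mod_homD(4)[OF that] by simp
  have h2: "f (a \<odot>\<^bsub>P\<^esub> x) = a \<otimes>\<^bsub>A\<^esub> f x"
    if "f \<in> mod_hom A P (regular_module A)" "x \<in> carrier P" "a \<in> carrier A" for f x a
    using mod_homD(5)[OF that(1,3,2)] by simp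
  show ?thesis unfolding A_dual_def
  proof (rule fun_module_left_module)
    show "(\<lambda>x\<in>carrier P. \<zero>\<^bsub>regular_module A\<^esub>) \<in> mod_hom A P (regular_module A)"
      by (rule zero_mod_hom[OF P R])
    show "(\<lambda>x\<in>carrier P. f x \<oplus>\<^bsub>regular_module A\<^esub> g x) \<in> mod_hom A P (regular_module A)"
      if "f \<in> mod_hom A P (regular_module A)" "g \<in> mod_hom A P (regular_module A)" for f g
      by (rule add_mod_hom[OF P R that])
    show "(\<lambda>x\<in>carrier P. f x \<otimes>\<^bsub>A\<^esub> a) \<in> mod_hom A P (regular_module A)"
      if "a \<in> carrier (opposite A)" and f: "f \<in> mod_hom A P (regular_module A)" for a f
      using that m[OF f] by (intro mod_homI) (auto simp: h[OF f] h2[OF f] A.l_distr A.m_assoc)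
    show "abelian_group (regular_module A)" using R by (simp add: left_module_def)
    show "mod_hom A P (regular_module A) \<subseteq> carrier P \<rightarrow>\<^sub>E carrier (regular_module A)"
      using mod_homD(2) by blast
    show "(\<lambda>x\<in>carrier P. f x \<otimes>\<^bsub>A\<^esub> \<ominus>\<^bsub>opposite A\<^esub> \<one>\<^bsub>opposite A\<^esub>) x = \<ominus>\<^bsub>regular_module A\<^esub> f x"
      if "f \<in> mod_hom A P (regular_module A)" "x \<in> carrier P" for f x
      using m[OF that] that(2) by (simp add: A.r_minus)
  qed (auto simp: m A.r_distr A.l_distr A.m_assoc opposite_ring A)
qed

text \<open>The action on a coset is defined as a union over all representatives. The cosets in this
  union coincide, because multiplying a member of \<open>U\<close> by \<open>a\<close> stays in
  \<open>U\<close>.\<close>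

lemma quotient_smult:
  assumes M: "left_module R M" and U: "submodule U R M" and a: "a \<in> carrier R" and x: "x \<in> carrier M"
  shows "a \<odot>\<^bsub>quotient_module M U\<^esub> (U +>\<^bsub>M\<^esub> x) = U +>\<^bsub>M\<^esub> (a \<odot>\<^bsub>M\<^esub> x)"
proof -
  interpret left_module R M by fact
  note U' = submoduleD[OF U]
  have "U +>\<^bsub>M\<^esub> (a \<odot>\<^bsub>M\<^esub> (u \<oplus>\<^bsub>M\<^esub> x)) = U +>\<^bsub>M\<^esub> (a \<odot>\<^bsub>M\<^esub> x)" if u: "u \<in> U" for u
  proof (rule M.a_repr_independence[symmetric])
    show "a \<odot>\<^bsub>M\<^esub> (u \<oplus>\<^bsub>M\<^esub> x) \<in> U +>\<^bsub>M\<^esub> (a \<odot>\<^bsub>M\<^esub> x)"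
      using u a x U' unfolding mem_a_r_coset by (auto simp: smult_r_distr)
    show "subgroup U (add_monoid M)" using U by (simp add: submodule_def)
  qed (use a x in auto)
  moreover have "\<zero>\<^bsub>M\<^esub> \<oplus>\<^bsub>M\<^esub> x \<in> U +>\<^bsub>M\<^esub> x" using U' unfolding mem_a_r_coset by auto
  ultimately show ?thesis unfolding quotient_module_simps
    by (intro SUP_eq_const) (blast, clarsimp simp: mem_a_r_coset[of _ M U x])
qed

lemma quotient_left_module:
  assumes M: "left_module R M" and U: "submodule U R M"
  shows "left_module R (quotient_module M U)"
proof -
  interpret left_module R M by fact
  have sub: "abelian_subgroup U M"
    using U M by (intro abelian_subgroupI3 additive_subgroupI) (auto simp: submodule_def left_module_def)
  have C: "\<exists>x\<in>carrier M. C = U +>\<^bsub>M\<^esub> x" if "C \<in> carrier (quotient_module M U)" for C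
    using that by (auto simp: A_RCOSETS_def')
  have mem: "U +>\<^bsub>M\<^esub> x \<in> carrier (quotient_module M U)" if "x \<in> carrier M" for x
    using that by (auto simp: A_RCOSETS_def')
  have add: "(U +>\<^bsub>M\<^esub> x) \<oplus>\<^bsub>quotient_module M U\<^esub> (U +>\<^bsub>M\<^esub> y) = U +>\<^bsub>M\<^esub> (x \<oplus>\<^bsub>M\<^esub> y)"
    if "x \<in> carrier M" "y \<in> carrier M" for x y
    using abelian_subgroup.a_rcos_sum[OF sub that] by simp
  \<comment> \<open>With the zero written as a coset too, each module axiom for the quotient becomes
    the same axiom on representatives.\<close>
  have zero: "\<zero>\<^bsub>quotient_module M U\<^esub> = U +>\<^bsub>M\<^esub> \<zero>\<^bsub>M\<^esub>"
    using submoduleD(1)[OF U] by simp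
  note rules = add zero quotient_smult[OF M U] mem
  show ?thesis
    by (rule left_moduleI[OF R.ring_axioms])
       (auto dest!: C simp: rules smult_l_distr smult_r_distr smult_assoc smult_minus_one M.a_ac
          M.r_neg simp del: quotient_module_simps)
qed

section \<open>Algebras\<close>

locale fd_alg =
  fixes K :: "('k, 'r) ring_scheme" and A :: "('k, 'a) module"
  assumes fd_algebra: "fd_algebra K A"
begin

sublocale K: field K using fd_algebra by (simp add: fd_algebra_def)
sublocale A: ring A using fd_algebra by (simp add: fd_algebra_def)
sublocale KA: module K A using fd_algebra by (simp add: fd_algebra_def)

lemma ring: "ring A" ..
lemma ring_K: "ring K" ..

abbreviation scalar :: "'k \<Rightarrow> 'a" where "scalar k \<equiv> k \<odot>\<^bsub>A\<^esub> \<one>\<^bsub>A\<^esub>"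

lemma scalar:
  assumes "k \<in> carrier K"
  shows "scalar k \<in> carrier A"
    and "\<And>x. x \<in> carrier A \<Longrightarrow> scalar k \<otimes>\<^bsub>A\<^esub> x = k \<odot>\<^bsub>A\<^esub> x"
    and "\<And>x. x \<in> carrier A \<Longrightarrow> x \<otimes>\<^bsub>A\<^esub> scalar k = k \<odot>\<^bsub>A\<^esub> x"
  using assms fd_algebra by (simp_all add: fd_algebra_def)

lemma scalar_mult:
  assumes "k \<in> carrier K" "l \<in> carrier K"
  shows "scalar (k \<otimes>\<^bsub>K\<^esub> l) = scalar k \<otimes>\<^bsub>A\<^esub> scalar l"
  using assms scalar(1,2) by (simp add: KA.smult_assoc1)

lemma restrict_scalars_left_module:
  assumes "left_module A M" shows "left_module K (restrict_scalars A M)"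
proof -
  interpret left_module A M by fact
  have "\<ominus>\<^bsub>A\<^esub> \<one>\<^bsub>A\<^esub> = (\<ominus>\<^bsub>K\<^esub> \<one>\<^bsub>K\<^esub>) \<odot>\<^bsub>A\<^esub> \<one>\<^bsub>A\<^esub>" by (simp add: KA.smult_l_minus)
  then have neg: "((\<ominus>\<^bsub>K\<^esub> \<one>\<^bsub>K\<^esub>) \<odot>\<^bsub>A\<^esub> \<one>\<^bsub>A\<^esub>) \<odot>\<^bsub>M\<^esub> x = \<ominus>\<^bsub>M\<^esub> x" if "x \<in> carrier M" for x
    using smult_minus_one[OF that] by simp
  show ?thesis
    by (rule left_moduleI[OF ring_K])
       (auto simp: scalar_mult smult_assoc smult_l_distr smult_r_distr scalar(1) neg M.l_neg M.a_assoc
          KA.smult_l_distr intro: M.a_comm)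
qed

lemma regular_K: "left_module K (regular_module K)"
  by (rule regular_left_module) (rule ring_K)

lemma opposite_fd_alg: "fd_alg K (opposite A)"
proof
  have "module K (opposite A)"
  proof (rule moduleI)
    show "abelian_group (opposite A)" using opposite_ring[OF ring] by (simp add: ring_def)
  qed (auto simp: KA.smult_l_distr KA.smult_r_distr KA.smult_assoc1 intro: K.is_cring)
  moreover have "finite_dim K (opposite A)"
  proof -
    \<comment> \<open>Subspaces over \<open>K\<close> do not see the ring multiplication, so the
      same finite set spans the opposite algebra.\<close>
    have "submodule W K (opposite A) \<longleftrightarrow> submodule W K A" for W
      by (simp add: submodule_def subgroup_def submodule_axioms_def m_inv_def)
    then show ?thesis using fd_algebra by (simp add: fd_algebra_def finite_dim_def)
  qed
  ultimately show "fd_algebra K (opposite A)"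
    using fd_algebra opposite_ring[OF ring] unfolding fd_algebra_def by simp
qed

lemma K_dual_left_module:
  assumes N: "left_module A N"
  shows "left_module (opposite A) (K_dual K A N)"
proof -
  interpret N: left_module A N by fact
  note L = restrict_scalars_left_module[OF N] and R = regular_K
  let ?H = "mod_hom K (restrict_scalars A N) (regular_module K)"
  have neg: "f (\<ominus>\<^bsub>N\<^esub> x) = \<ominus>\<^bsub>K\<^esub> (f x)" if f: "f \<in> ?H" and "x \<in> carrier N" for f x
  proof -
    have "f x \<in> carrier K" "f (\<ominus>\<^bsub>N\<^esub> x) \<in> carrier K" using mod_homD(1)[OF f] that by auto
    moreover have "f (\<ominus>\<^bsub>N\<^esub> x) \<oplus>\<^bsub>K\<^esub> f x = \<zero>\<^bsub>K\<^esub>"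
      using mod_homD(4)[OF f, of "\<ominus>\<^bsub>N\<^esub> x" x] that mod_hom_zero[OF f L R] by (simp add: N.M.l_neg)
    ultimately show ?thesis by (metis K.minus_equality)
  qed
  have m: "f x \<in> carrier K" if "f \<in> ?H" "x \<in> carrier N" for f x
    using mod_homD(1)[OF that(1), of x] that(2) by simp
  have h: "f (x \<oplus>\<^bsub>N\<^esub> y) = f x \<oplus>\<^bsub>K\<^esub> f y"
    if "f \<in> ?H" "x \<in> carrier N" "y \<in> carrier N" for f x y
    using mod_homD(4)[OF that(1), of x y] that by simp
  have h2: "f (scalar k \<odot>\<^bsub>N\<^esub> x) = k \<otimes>\<^bsub>K\<^esub> f x"
    if "f \<in> ?H" "x \<in> carrier N" "k \<in> carrier K" for f x k
    using mod_homD(5)[OF that(1), of k x] that by simp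
  \<comment> \<open>Scalars are central in \<open>A\<close>, so precomposing a functional with the
    action of \<open>a\<close> keeps it \<open>K\<close>-linear.\<close>
  have comm: "a \<odot>\<^bsub>N\<^esub> (scalar k \<odot>\<^bsub>N\<^esub> x) = scalar k \<odot>\<^bsub>N\<^esub> (a \<odot>\<^bsub>N\<^esub> x)"
    if "a \<in> carrier A" "k \<in> carrier K" "x \<in> carrier N" for a k x
    using that by (simp add: scalar flip: N.smult_assoc)
  show ?thesis unfolding K_dual_def
  proof (rule fun_module_left_module)
    show "(\<lambda>x\<in>carrier N. \<zero>\<^bsub>regular_module K\<^esub>) \<in> ?H"
      using zero_mod_hom[OF L R] by simp
    show "(\<lambda>x\<in>carrier N. f x \<oplus>\<^bsub>regular_module K\<^esub> g x) \<in> ?H" if "f \<in> ?H" "g \<in> ?H" for f g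
      using add_mod_hom[OF L R that] by simp
    show "(\<lambda>x\<in>carrier N. f (a \<odot>\<^bsub>N\<^esub> x)) \<in> ?H" if "a \<in> carrier (opposite A)" and f: "f \<in> ?H" for a f
      using that m[OF f]
      by (intro mod_homI) (auto simp: h[OF f] h2[OF f] N.smult_r_distr comm scalar)
    show "abelian_group (regular_module K)" using R by (simp add: left_module_def)
    show "?H \<subseteq> carrier N \<rightarrow>\<^sub>E carrier (regular_module K)"
      using mod_homD(2)[of _ K "restrict_scalars A N" "regular_module K"] by (simp add: subset_iff)
  qed (auto simp: h h2 N.smult_l_distr N.smult_r_distr N.smult_assoc N.smult_minus_one neg
        opposite_ring[OF ring])
qed

end

section \<open>Linear functionals\<close>

text \<open>Zorn's lemma gives a largest subspace \<open>H\<close> that contains \<open>N\<close>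
  but not \<open>u\<close>. It is a hyperplane complementary to the line through \<open>u\<close>,
  and the functional is the coefficient of \<open>u\<close> in the resulting decomposition. No
  assumption on the dimension enters.\<close>

lemma separating_functional:
  assumes K: "field K" and V: "left_module K V" and N: "submodule N K V"
    and u: "u \<in> carrier V" "u \<notin> N"
  obtains g where "g \<in> mod_hom K V (regular_module K)" "g u = \<one>\<^bsub>K\<^esub>" "\<And>n. n \<in> N \<Longrightarrow> g n = \<zero>\<^bsub>K\<^esub>"
proof -
  interpret K: field K by fact
  interpret V: left_module K V by fact
  define \<A> where "\<A> = {H. submodule H K V \<and> N \<subseteq> H \<and> u \<notin> H}"
  have "\<exists>H\<in>\<A>. \<forall>H'\<in>\<A>. H \<subseteq> H' \<longrightarrow> H' = H"
  proof (rule subset_Zorn_nonempty)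
    show "\<A> \<noteq> {}" using N u by (auto simp: \<A>_def)
    fix \<C> assume C: "\<C> \<noteq> {}" "subset.chain \<A> \<C>"
    then have sub: "submodule H K V" "N \<subseteq> H" "u \<notin> H" if "H \<in> \<C>" for H
      using that by (auto simp: \<A>_def subset_chain_def)
    note S = V.submoduleD[OF sub(1)]
    have "x \<oplus>\<^bsub>V\<^esub> y \<in> \<Union>\<C>" if "x \<in> \<Union>\<C>" "y \<in> \<Union>\<C>" for x y
    proof -
      from that obtain H H' where H: "H \<in> \<C>" "x \<in> H" "H' \<in> \<C>" "y \<in> H'" by blast
      then have "H \<subseteq> H' \<or> H' \<subseteq> H" using C(2) by (auto simp: subset_chain_def)
      then show ?thesis using S(4) H by blast
    qed
    moreover have "\<Union>\<C> \<subseteq> carrier V" using S(1) by (rule Union_least)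
    moreover have "\<zero>\<^bsub>V\<^esub> \<in> \<Union>\<C>" using C(1) S(3) by (meson UnionI all_not_in_conv)
    moreover have "a \<odot>\<^bsub>V\<^esub> x \<in> \<Union>\<C>" if "a \<in> carrier K" "x \<in> \<Union>\<C>" for a x
      using that S(5) by (meson UnionE UnionI)
    ultimately have "submodule (\<Union>\<C>) K V" by (intro V.submoduleI)
    moreover have "N \<subseteq> \<Union>\<C>" using C(1) sub(2) by (meson Union_upper all_not_in_conv subset_trans)
    ultimately show "\<Union>\<C> \<in> \<A>" using sub(3) by (auto simp: \<A>_def)
  qed
  then obtain H where "H \<in> \<A>" and max: "\<And>H'. \<lbrakk>H' \<in> \<A>; H \<subseteq> H'\<rbrakk> \<Longrightarrow> H' = H" by blast
  then have H: "submodule H K V" "N \<subseteq> H" "u \<notin> H" by (auto simp: \<A>_def)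
  note S = V.submoduleD[OF H(1)]
  \<comment> \<open>Adjoining some \<open>v\<close> outside \<open>H\<close> gives a larger
    subspace, which by maximality contains \<open>u\<close>. In the resulting expression for
    \<open>u\<close> the coefficient of \<open>v\<close> is nonzero, as \<open>u\<close> is not in
    \<open>H\<close>, so one can solve for \<open>v\<close>.\<close>
  have ex: "\<exists>k\<in>carrier K. \<exists>h\<in>H. v = h \<oplus>\<^bsub>V\<^esub> k \<odot>\<^bsub>V\<^esub> u" if v: "v \<in> carrier V" for v
  proof (cases "v \<in> H")
    case True
    then show ?thesis using S u by (intro bexI[of _ "\<zero>\<^bsub>K\<^esub>"] bexI[of _ v]) auto
  next
    case False
    define H' where "H' = {h \<oplus>\<^bsub>V\<^esub> c \<odot>\<^bsub>V\<^esub> v |h c. h \<in> H \<and> c \<in> carrier K}"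
    have memI: "h \<oplus>\<^bsub>V\<^esub> c \<odot>\<^bsub>V\<^esub> v \<in> H'" if "h \<in> H" "c \<in> carrier K" for h c
      using that by (auto simp: H'_def)
    have "submodule H' K V"
    proof (rule V.submoduleI)
      show "H' \<subseteq> carrier V" using S v by (auto simp: H'_def)
      show "\<zero>\<^bsub>V\<^esub> \<in> H'" using memI[of "\<zero>\<^bsub>V\<^esub>" "\<zero>\<^bsub>K\<^esub>"] S v by simp
    next
      fix x y assume "x \<in> H'" "y \<in> H'"
      then obtain h c h' c' where *: "h \<in> H" "c \<in> carrier K" "h' \<in> H" "c' \<in> carrier K"
        "x = h \<oplus>\<^bsub>V\<^esub> c \<odot>\<^bsub>V\<^esub> v" "y = h' \<oplus>\<^bsub>V\<^esub> c' \<odot>\<^bsub>V\<^esub> v" by (auto simp: H'_def)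
      then have "x \<oplus>\<^bsub>V\<^esub> y = (h \<oplus>\<^bsub>V\<^esub> h') \<oplus>\<^bsub>V\<^esub> (c \<oplus>\<^bsub>K\<^esub> c') \<odot>\<^bsub>V\<^esub> v"
        using v S(2) by (simp add: V.smult_l_distr V.M.a_ac)
      then show "x \<oplus>\<^bsub>V\<^esub> y \<in> H'" using * memI S by simp
    next
      fix a x assume "a \<in> carrier K" "x \<in> H'"
      then obtain h c where *: "a \<in> carrier K" "h \<in> H" "c \<in> carrier K" "x = h \<oplus>\<^bsub>V\<^esub> c \<odot>\<^bsub>V\<^esub> v"
        by (auto simp: H'_def)
      then have "a \<odot>\<^bsub>V\<^esub> x = a \<odot>\<^bsub>V\<^esub> h \<oplus>\<^bsub>V\<^esub> (a \<otimes>\<^bsub>K\<^esub> c) \<odot>\<^bsub>V\<^esub> v"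
        using v S(2) by (simp add: V.smult_r_distr V.smult_assoc)
      then show "a \<odot>\<^bsub>V\<^esub> x \<in> H'" using * memI S by simp
    qed
    moreover have "H \<subseteq> H'"
    proof
      fix h assume "h \<in> H"
      then show "h \<in> H'" using memI[of h "\<zero>\<^bsub>K\<^esub>"] v S(2) by simp
    qed
    moreover have "v \<in> H'" using memI[of "\<zero>\<^bsub>V\<^esub>" "\<one>\<^bsub>K\<^esub>"] v S by simp
    ultimately have "u \<in> H'" using max[of H'] False H(2) by (auto simp: \<A>_def)
    then obtain h c where hc: "h \<in> H" "c \<in> carrier K" "u = h \<oplus>\<^bsub>V\<^esub> c \<odot>\<^bsub>V\<^esub> v"
      by (auto simp: H'_def)
    have "c \<noteq> \<zero>\<^bsub>K\<^esub>" using hc H(3) S(2) v by auto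
    then have "c \<in> Units K" using hc(2) by (simp add: K.field_Units)
    then have c: "inv\<^bsub>K\<^esub> c \<in> carrier K" "inv\<^bsub>K\<^esub> c \<otimes>\<^bsub>K\<^esub> c = \<one>\<^bsub>K\<^esub>" by simp_all
    have "inv\<^bsub>K\<^esub> c \<odot>\<^bsub>V\<^esub> u = inv\<^bsub>K\<^esub> c \<odot>\<^bsub>V\<^esub> h \<oplus>\<^bsub>V\<^esub> v"
      using c hc v S(2) by (simp add: V.smult_r_distr flip: V.smult_assoc)
    then have "v = \<ominus>\<^bsub>V\<^esub> (inv\<^bsub>K\<^esub> c \<odot>\<^bsub>V\<^esub> h) \<oplus>\<^bsub>V\<^esub> inv\<^bsub>K\<^esub> c \<odot>\<^bsub>V\<^esub> u"
      using c hc v S(2) by (simp add: V.M.r_neg1)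
    moreover have "\<ominus>\<^bsub>V\<^esub> (inv\<^bsub>K\<^esub> c \<odot>\<^bsub>V\<^esub> h) \<in> H" using c(1) hc(1) S by simp
    ultimately show ?thesis using c(1) by (intro bexI)
  qed
  \<comment> \<open>\<open>ex\<close> gives existence of this coefficient, \<open>uniq\<close> below
    its uniqueness: two different coefficients would put a nonzero multiple of \<open>u\<close>,
    hence \<open>u\<close> itself, into \<open>H\<close>.\<close>
  define g where "g = (\<lambda>v\<in>carrier V. THE k. k \<in> carrier K \<and> (\<exists>h\<in>H. v = h \<oplus>\<^bsub>V\<^esub> k \<odot>\<^bsub>V\<^esub> u))"
  have uniq: "k = l"
    if "k \<in> carrier K" "l \<in> carrier K" "h \<in> H" "h' \<in> H" "h \<oplus>\<^bsub>V\<^esub> k \<odot>\<^bsub>V\<^esub> u = h' \<oplus>\<^bsub>V\<^esub> l \<odot>\<^bsub>V\<^esub> u" for k l h h'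
  proof (rule ccontr)
    assume "k \<noteq> l"
    have "(k \<ominus>\<^bsub>K\<^esub> l) \<odot>\<^bsub>V\<^esub> u = k \<odot>\<^bsub>V\<^esub> u \<oplus>\<^bsub>V\<^esub> \<ominus>\<^bsub>V\<^esub> (l \<odot>\<^bsub>V\<^esub> u)"
    proof -
      have "\<ominus>\<^bsub>K\<^esub> l = \<ominus>\<^bsub>K\<^esub> \<one>\<^bsub>K\<^esub> \<otimes>\<^bsub>K\<^esub> l" using that(2) by (simp add: K.l_minus)
      then show ?thesis
        using that u V.smult_minus_one[of "l \<odot>\<^bsub>V\<^esub> u"]
        by (simp add: K.minus_eq V.smult_l_distr V.smult_assoc)
    qed
    also have "\<dots> = \<ominus>\<^bsub>V\<^esub> h \<oplus>\<^bsub>V\<^esub> (h \<oplus>\<^bsub>V\<^esub> k \<odot>\<^bsub>V\<^esub> u) \<oplus>\<^bsub>V\<^esub> \<ominus>\<^bsub>V\<^esub> (l \<odot>\<^bsub>V\<^esub> u)"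
      using that(1-4) u S(2) by (simp add: V.M.r_neg1)
    also have "\<dots> = \<ominus>\<^bsub>V\<^esub> h \<oplus>\<^bsub>V\<^esub> h'"
      unfolding that(5) using that(1-4) u S(2) by (simp add: V.M.a_assoc V.M.r_neg)
    also have "\<dots> \<in> H" using S(4)[OF S(6)[OF that(3)] that(4)] .
    finally have in_H: "(k \<ominus>\<^bsub>K\<^esub> l) \<odot>\<^bsub>V\<^esub> u \<in> H" .
    have "k \<ominus>\<^bsub>K\<^esub> l \<noteq> \<zero>\<^bsub>K\<^esub>" using \<open>k \<noteq> l\<close> that(1,2) by (simp add: K.minus_eq K.add.inv_solve_right')
    then have "k \<ominus>\<^bsub>K\<^esub> l \<in> Units K" using that(1,2) by (simp add: K.field_Units)
    then have c: "inv\<^bsub>K\<^esub> (k \<ominus>\<^bsub>K\<^esub> l) \<in> carrier K" "inv\<^bsub>K\<^esub> (k \<ominus>\<^bsub>K\<^esub> l) \<otimes>\<^bsub>K\<^esub> (k \<ominus>\<^bsub>K\<^esub> l) = \<one>\<^bsub>K\<^esub>"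
      by (rule K.Units_inv_closed, rule K.Units_l_inv)
    have "inv\<^bsub>K\<^esub> (k \<ominus>\<^bsub>K\<^esub> l) \<odot>\<^bsub>V\<^esub> ((k \<ominus>\<^bsub>K\<^esub> l) \<odot>\<^bsub>V\<^esub> u) = u"
      using c that(1,2) u by (simp flip: V.smult_assoc)
    then show False using S(5)[OF c(1) in_H] H(3) by simp
  qed
  have g: "g (h \<oplus>\<^bsub>V\<^esub> k \<odot>\<^bsub>V\<^esub> u) = k" if "h \<in> H" "k \<in> carrier K" for h k
    using that u S(2) uniq unfolding g_def by (auto intro!: the_equality)
  show thesis
  proof
    show "g \<in> mod_hom K V (regular_module K)"
    proof (rule mod_homI)
      show "g x \<in> carrier (regular_module K)" if "x \<in> carrier V" for x
        using ex[OF that] g by auto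
      show "g x = undefined" if "x \<notin> carrier V" for x using that by (simp add: g_def)
      show "g (x \<oplus>\<^bsub>V\<^esub> y) = g x \<oplus>\<^bsub>regular_module K\<^esub> g y" if xy: "x \<in> carrier V" "y \<in> carrier V" for x y
      proof -
        obtain h k h' k' where *: "h \<in> H" "k \<in> carrier K" "h' \<in> H" "k' \<in> carrier K"
          "x = h \<oplus>\<^bsub>V\<^esub> k \<odot>\<^bsub>V\<^esub> u" "y = h' \<oplus>\<^bsub>V\<^esub> k' \<odot>\<^bsub>V\<^esub> u" using ex[OF xy(1)] ex[OF xy(2)] by blast
        then have "x \<oplus>\<^bsub>V\<^esub> y = (h \<oplus>\<^bsub>V\<^esub> h') \<oplus>\<^bsub>V\<^esub> (k \<oplus>\<^bsub>K\<^esub> k') \<odot>\<^bsub>V\<^esub> u"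
          using u S(2) by (simp add: V.smult_l_distr V.M.a_ac)
        then show ?thesis using * g S by simp
      qed
      show "g (a \<odot>\<^bsub>V\<^esub> x) = a \<odot>\<^bsub>regular_module K\<^esub> g x" if a: "a \<in> carrier K" "x \<in> carrier V" for a x
      proof -
        obtain h k where *: "h \<in> H" "k \<in> carrier K" "x = h \<oplus>\<^bsub>V\<^esub> k \<odot>\<^bsub>V\<^esub> u" using ex[OF a(2)] by blast
        then have "a \<odot>\<^bsub>V\<^esub> x = a \<odot>\<^bsub>V\<^esub> h \<oplus>\<^bsub>V\<^esub> (a \<otimes>\<^bsub>K\<^esub> k) \<odot>\<^bsub>V\<^esub> u"
          using u S(2) a by (simp add: V.smult_r_distr V.smult_assoc)
        then show ?thesis using * g S a by simp
      qed
    qed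
    show "g u = \<one>\<^bsub>K\<^esub>" using g[of "\<zero>\<^bsub>V\<^esub>" "\<one>\<^bsub>K\<^esub>"] S u by simp
    show "g n = \<zero>\<^bsub>K\<^esub>" if "n \<in> N" for n
      using g[of n "\<zero>\<^bsub>K\<^esub>"] H(2) S(2) u that by auto
  qed
qed

text \<open>A nonzero \<open>f\<close> is determined by its kernel \<open>N\<close> and one vector
  \<open>u\<close> of value 1, since \<open>x - f(x) u\<close> lies in \<open>N\<close> for every
  \<open>x\<close> in \<open>W\<close>. Hence any functional on \<open>V\<close> that vanishes on
  \<open>N\<close> and is 1 at \<open>u\<close> extends \<open>f\<close>.\<close>

lemma extend_functional:
  assumes K: "field K" and V: "left_module K V" and W: "submodule W K V"
    and f: "f \<in> mod_hom K (V\<lparr>carrier := W\<rparr>) (regular_module K)"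
  obtains g where "g \<in> mod_hom K V (regular_module K)" "\<And>w. w \<in> W \<Longrightarrow> g w = f w"
proof -
  interpret K: field K by fact
  interpret V: left_module K V by fact
  note L = V.submodule_left_module[OF W] and R = regular_left_module[OF K.ring_axioms]
  note S = V.submoduleD[OF W]
  have f': "f w \<in> carrier K" "f (w \<oplus>\<^bsub>V\<^esub> w') = f w \<oplus>\<^bsub>K\<^esub> f w'" "f (k \<odot>\<^bsub>V\<^esub> w) = k \<otimes>\<^bsub>K\<^esub> f w"
    if "w \<in> W" "w' \<in> W" "k \<in> carrier K" for w w' k
    using mod_homD[OF f] that by auto
  show thesis
  proof (cases "\<exists>w\<in>W. f w \<noteq> \<zero>\<^bsub>K\<^esub>")
    case False
    show thesis
      using False S(2) by (intro that[OF zero_mod_hom[OF V R]]) auto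
  next
    case True
    then obtain w where w: "w \<in> W" "f w \<noteq> \<zero>\<^bsub>K\<^esub>" by blast
    define u where "u = inv\<^bsub>K\<^esub> (f w) \<odot>\<^bsub>V\<^esub> w"
    have i: "inv\<^bsub>K\<^esub> (f w) \<in> carrier K" "inv\<^bsub>K\<^esub> (f w) \<otimes>\<^bsub>K\<^esub> f w = \<one>\<^bsub>K\<^esub>"
      using w f'(1)[OF w(1) w(1) K.one_closed] by (auto simp: K.field_Units)
    have u: "u \<in> W" "f u = \<one>\<^bsub>K\<^esub>" using w i S f'(3) by (auto simp: u_def)
    define N where "N = a_kernel (V\<lparr>carrier := W\<rparr>) (regular_module K) f"
    have N: "submodule N K V"
      using a_kernel_submodule[OF f L R] unfolding N_def V.submodule_submodule[OF W] ..
    have memN: "x \<in> N \<longleftrightarrow> x \<in> W \<and> f x = \<zero>\<^bsub>K\<^esub>" for x by (simp add: N_def mem_a_kernel)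
    have "u \<notin> N" using u by (simp add: memN)
    with S(2)[OF u(1)] obtain g where g: "g \<in> mod_hom K V (regular_module K)" "g u = \<one>\<^bsub>K\<^esub>"
      "\<And>n. n \<in> N \<Longrightarrow> g n = \<zero>\<^bsub>K\<^esub>"
      using separating_functional[OF K V N] by metis
    show thesis
    proof (rule that[OF g(1)])
      fix x assume x: "x \<in> W"
      let ?k = "\<ominus>\<^bsub>K\<^esub> f x"
      have fx: "f x \<in> carrier K" using f'(1)[OF x x K.one_closed] .
      have "f (x \<oplus>\<^bsub>V\<^esub> ?k \<odot>\<^bsub>V\<^esub> u) = \<zero>\<^bsub>K\<^esub>"
        using f' x u fx S(5) by (simp add: K.r_neg)
      then have "g (x \<oplus>\<^bsub>V\<^esub> ?k \<odot>\<^bsub>V\<^esub> u) = \<zero>\<^bsub>K\<^esub>"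
        using x u fx S by (intro g(3)) (simp add: memN)
      then have "g x \<oplus>\<^bsub>K\<^esub> ?k = \<zero>\<^bsub>K\<^esub>"
        using mod_homD[OF g(1)] x u fx S(2) g(2) by simp
      moreover have "g x \<in> carrier K" using mod_homD(1)[OF g(1), of x] S(2)[OF x] by simp
      ultimately show "g x = f x" using fx by (simp add: K.add.inv_solve_right')
    qed
  qed
qed

section \<open>Indecomposable modules\<close>

lemma internal_dir_sum_image:
  assumes g: "g \<in> mod_hom R N M" and b: "bij_betw g (carrier N) (carrier M)"
    and N: "left_module R N" and M: "left_module R M"
    and UV: "internal_dir_sum R N U V"
  shows "internal_dir_sum R M (g ` U) (g ` V)"
proof -
  interpret N: left_module R N by fact
  interpret M: left_module R M by fact
  have U: "submodule U R N" and V: "submodule V R N" and sum: "U <+>\<^bsub>N\<^esub> V = carrier N"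
    and int: "U \<inter> V = {\<zero>\<^bsub>N\<^esub>}" using UV by (auto simp: internal_dir_sum_def)
  note SU = N.submoduleD[OF U] and SV = N.submoduleD[OF V] and g' = mod_homD[OF g]
  have "g ` U <+>\<^bsub>M\<^esub> g ` V = g ` (U <+>\<^bsub>N\<^esub> V)"
  proof (intro equalityI subsetI)
    fix z assume "z \<in> g ` U <+>\<^bsub>M\<^esub> g ` V"
    then obtain u v where "u \<in> U" "v \<in> V" "z = g u \<oplus>\<^bsub>M\<^esub> g v" unfolding mem_set_add by blast
    then show "z \<in> g ` (U <+>\<^bsub>N\<^esub> V)"
      using g'(4)[of u v] SU(2) SV(2) by (intro image_eqI[of _ _ "u \<oplus>\<^bsub>N\<^esub> v"]) (auto simp: mem_set_add)
  next
    fix z assume "z \<in> g ` (U <+>\<^bsub>N\<^esub> V)"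
    then obtain u v where "u \<in> U" "v \<in> V" "z = g (u \<oplus>\<^bsub>N\<^esub> v)" by (auto simp: mem_set_add)
    then show "z \<in> g ` U <+>\<^bsub>M\<^esub> g ` V"
      using g'(4)[of u v] SU(2) SV(2) by (auto simp: mem_set_add)
  qed
  also have "\<dots> = carrier M" using sum b by (simp add: bij_betw_def)
  finally have 1: "g ` U <+>\<^bsub>M\<^esub> g ` V = carrier M" .
  have "g ` U \<inter> g ` V = g ` (U \<inter> V)"
    using b SU(1) SV(1) by (intro inj_on_image_Int[symmetric]) (auto simp: bij_betw_def)
  also have "\<dots> = {\<zero>\<^bsub>M\<^esub>}" using int mod_hom_zero[OF g N M] by simp
  finally show ?thesis
    using 1 image_submodule[OF g N M] U V by (simp add: internal_dir_sum_def)
qed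

lemma indecomposable_iso:
  assumes M: "indecomposable A M" and iso: "mod_iso A M N" and N: "left_module A N"
  shows "indecomposable A N"
proof -
  have M': "left_module A M" using M by (simp add: indecomposable_def)
  interpret N: left_module A N by fact
  interpret M: left_module A M by fact
  obtain g where g: "g \<in> mod_hom A N M" and b: "bij_betw g (carrier N) (carrier M)"
    using mod_iso_sym[OF iso M'] by (auto simp: mod_iso_def)
  note z = mod_hom_zero[OF g N M']
  have zero: "U = {\<zero>\<^bsub>N\<^esub>}" if "g ` U = {\<zero>\<^bsub>M\<^esub>}" "U \<subseteq> carrier N" for U
  proof -
    have "x = \<zero>\<^bsub>N\<^esub>" if "x \<in> U" for x
    proof -
      have "g x = g \<zero>\<^bsub>N\<^esub>" using that \<open>g ` U = _\<close> z by auto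
      then show ?thesis
        using inj_onD[OF bij_betw_imp_inj_on[OF b]] that \<open>U \<subseteq> _\<close> by blast
    qed
    then show ?thesis using that(1) by fastforce
  qed
  have "\<not> zero_module N"
    using M b z unfolding indecomposable_def zero_module_def bij_betw_def by force
  moreover have "U = {\<zero>\<^bsub>N\<^esub>} \<or> V = {\<zero>\<^bsub>N\<^esub>}" if UV: "internal_dir_sum A N U V" for U V
  proof -
    have "U \<subseteq> carrier N" "V \<subseteq> carrier N"
      using UV N.submoduleD(1) by (auto simp: internal_dir_sum_def)
    moreover have "g ` U = {\<zero>\<^bsub>M\<^esub>} \<or> g ` V = {\<zero>\<^bsub>M\<^esub>}"
      using internal_dir_sum_image[OF g b N M' UV] M by (simp add: indecomposable_def)
    ultimately show ?thesis using zero by metis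
  qed
  ultimately show ?thesis using N by (simp add: indecomposable_def)
qed

lemma simple_imp_indecomposable:
  assumes "simple_module A S" shows "indecomposable A S"
proof -
  interpret left_module A S using assms by (simp add: simple_module_def)
  \<comment> \<open>If \<open>U\<close> is the whole module, then \<open>V = U \<inter> V\<close> is
    zero.\<close>
  have "U = {\<zero>\<^bsub>S\<^esub>} \<or> V = {\<zero>\<^bsub>S\<^esub>}" if "internal_dir_sum A S U V" for U V
    using that assms submoduleD(1)[of U] unfolding internal_dir_sum_def simple_module_def
    by (metis Int_absorb2 Int_commute submoduleD(1))
  then show ?thesis using assms by (simp add: simple_module_def indecomposable_def)
qed

text \<open>\<open>tau_tilting\<close> asks for summands with the element type of the whole sum,
  whose elements are functions of the index. The sum over \<open>{k}\<close> is a copy of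
  \<open>X k\<close> of that type.\<close>

lemma mod_iso_dir_sum_singleton:
  assumes "left_module R (X k)"
  shows "mod_iso R (X k) (dir_sum {k} X)"
proof -
  interpret left_module R "X k" by fact
  let ?f = "\<lambda>x\<in>carrier (X k). \<lambda>i\<in>{k}. x"
  have "?f \<in> mod_hom R (X k) (dir_sum {k} X)"
    by (rule mod_homI) (auto intro!: restrict_ext)
  moreover have "bij_betw ?f (carrier (X k)) (carrier (dir_sum {k} X))"
    by (rule bij_betw_byWitness[where f' = "\<lambda>f. f k"])
       (auto intro!: ext simp: restrict_def PiE_def extensional_def)
  ultimately show ?thesis unfolding mod_iso_def by blast
qed

lemma mod_iso_dir_sum_singletons:
  assumes X: "\<And>i. i \<in> I \<Longrightarrow> left_module R (X i)"
  shows "mod_iso R (dir_sum I X) (dir_sum I (\<lambda>i. dir_sum {i} X))"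
proof -
  let ?f = "\<lambda>x\<in>carrier (dir_sum I X). \<lambda>i\<in>I. \<lambda>j\<in>{i}. x i"
  have cl: "x \<oplus>\<^bsub>X i\<^esub> y \<in> carrier (X i)" if "i \<in> I" "x \<in> carrier (X i)" "y \<in> carrier (X i)" for i x y
  proof -
    interpret left_module R "X i" using that X by simp
    show ?thesis using that by simp
  qed
  note sc = left_module.smult_closed[OF X]
  have m: "f i \<in> carrier (X i)" if "f \<in> (\<Pi>\<^sub>E i\<in>I. carrier (X i))" "i \<in> I" for f i using that by auto
  have "?f \<in> mod_hom R (dir_sum I X) (dir_sum I (\<lambda>i. dir_sum {i} X))"
    by (rule mod_homI) (auto intro!: restrict_ext simp: cl sc m)
  moreover have "bij_betw ?f (carrier (dir_sum I X)) (carrier (dir_sum I (\<lambda>i. dir_sum {i} X)))"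
  \<comment> \<open>The inverse reads off the diagonal entries; outside the index sets both sides
    are \<open>undefined\<close>.\<close>
  proof (rule bij_betw_byWitness[where f' = "\<lambda>f. \<lambda>i\<in>I. f i i"])
    show "\<forall>f\<in>carrier (dir_sum I X). (\<lambda>i\<in>I. ?f f i i) = f"
      by (auto intro!: ext simp: restrict_def PiE_def extensional_def)
    show "\<forall>f\<in>carrier (dir_sum I (\<lambda>i. dir_sum {i} X)). ?f (\<lambda>i\<in>I. f i i) = f"
    proof
      fix f assume f: "f \<in> carrier (dir_sum I (\<lambda>i. dir_sum {i} X))"
      have "(\<lambda>j\<in>{i}. f i i) = f i" if "i \<in> I" for i
      proof -
        have "f i \<in> (\<Pi>\<^sub>E j\<in>{i}. carrier (X j))" using f that by auto
        then show ?thesis by (auto intro!: ext simp: restrict_def PiE_def extensional_def)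
      qed
      moreover have "(\<lambda>i\<in>I. f i i) \<in> carrier (dir_sum I X)" using f by fastforce
      moreover have "f i = undefined" if "i \<notin> I" for i using f that by (auto simp: PiE_def extensional_def)
      ultimately show "?f (\<lambda>i\<in>I. f i i) = f" by (auto simp: fun_eq_iff restrict_def)
    qed
    show "?f ` carrier (dir_sum I X) \<subseteq> carrier (dir_sum I (\<lambda>i. dir_sum {i} X))"
      by (auto split: if_splits)
    show "(\<lambda>f. \<lambda>i\<in>I. f i i) ` carrier (dir_sum I (\<lambda>i. dir_sum {i} X)) \<subseteq> carrier (dir_sum I X)"
      by fastforce
  qed
  ultimately show ?thesis unfolding mod_iso_def by blast
qed

section \<open>Vanishing of \<open>Ext\<close> and tau-rigidity\<close>

text \<open>\<open>Ext1\<close> picks its epimorphism by \<open>SOME\<close>: \<open>gen\<close>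
  makes that choice a genuine one, and \<open>ext\<close> is demanded of every epimorphism because
  nothing more is known about it. If all homomorphisms on the kernel extend, the restrictions fill
  the whole Hom space and the cokernel vanishes.\<close>

lemma Ext1_zeroI:
  assumes A: "ring A" and M: "left_module A M" and N: "left_module A N"
    and gen: "\<exists>r p. p \<in> mod_hom A (free_module A r) M \<and> p ` carrier (free_module A r) = carrier M"
    and ext: "\<And>r p f. \<lbrakk>p \<in> mod_hom A (free_module A r) M;
        p ` carrier (free_module A r) = carrier M;
        f \<in> mod_hom A (free_module A r\<lparr>carrier := a_kernel (free_module A r) M p\<rparr>) N\<rbrakk> \<Longrightarrow>
        \<exists>g\<in>mod_hom A (free_module A r) N. \<forall>x\<in>a_kernel (free_module A r) M p. g x = f x"
  shows "zero_module (Ext1 A M N)"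
proof -
  obtain r p where rp: "(SOME (r, p). p \<in> mod_hom A (free_module A r) M \<and>
      p ` carrier (free_module A r) = carrier M) = (r, p)" by force
  from gen have "\<exists>z. case z of (r, p) \<Rightarrow> p \<in> mod_hom A (free_module A r) M \<and>
      p ` carrier (free_module A r) = carrier M" by auto
  from someI_ex[OF this] have p: "p \<in> mod_hom A (free_module A r) M"
    "p ` carrier (free_module A r) = carrier M" unfolding rp by auto
  let ?F = "free_module A r"
  define \<Omega> where "\<Omega> = a_kernel ?F M p"
  have F: "left_module A ?F" by (rule free_left_module[OF A])
  have sub: "submodule \<Omega> A ?F" unfolding \<Omega>_def by (rule a_kernel_submodule[OF p(1) F M])
  interpret F: left_module A ?F by (rule F)
  interpret N: left_module A N by (rule N)
  have L: "left_module A (?F\<lparr>carrier := \<Omega>\<rparr>)" by (rule F.submodule_left_module[OF sub])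
  note S = F.submoduleD[OF sub]
  define H where "H = mod_hom A (?F\<lparr>carrier := \<Omega>\<rparr>) N"
  have "(\<lambda>g. restrict g \<Omega>) ` mod_hom A ?F N = H"
  proof (intro equalityI subsetI)
    fix f assume "f \<in> (\<lambda>g. restrict g \<Omega>) ` mod_hom A ?F N"
    then obtain g where g: "g \<in> mod_hom A ?F N" "f = restrict g \<Omega>" by blast
    note g' = mod_homD[OF g(1)]
    show "f \<in> H" unfolding H_def
      by (rule mod_homI) (use S g g' in auto)
  next
    fix f assume f: "f \<in> H"
    then obtain g where g: "g \<in> mod_hom A ?F N" "\<forall>x\<in>\<Omega>. g x = f x"
      using ext[OF p] unfolding H_def \<Omega>_def by blast
    have "f = restrict g \<Omega>"
      using f g(2) mod_homD(3)[of f A "?F\<lparr>carrier := \<Omega>\<rparr>" N] by (auto simp: H_def fun_eq_iff)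
    then show "f \<in> (\<lambda>g. restrict g \<Omega>) ` mod_hom A ?F N" using g(1) by blast
  qed
  then have Ext: "Ext1 A M N = quotient_module (Hom_space A (?F\<lparr>carrier := \<Omega>\<rparr>) N) H"
    unfolding Ext1_def rp by (simp add: \<Omega>_def Let_def)
  have carr: "carrier (Hom_space A (?F\<lparr>carrier := \<Omega>\<rparr>) N) = H"
    by (simp add: Hom_space_def H_def)
  have "H +>\<^bsub>Hom_space A (?F\<lparr>carrier := \<Omega>\<rparr>) N\<^esub> h = H" if h: "h \<in> H" for h
  proof (intro equalityI subsetI)
    fix f assume "f \<in> H +>\<^bsub>Hom_space A (?F\<lparr>carrier := \<Omega>\<rparr>) N\<^esub> h"
    then show "f \<in> H" using add_mod_hom[OF L N] h
      by (auto simp: mem_a_r_coset Hom_space_def H_def)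
  next
    fix f assume f: "f \<in> H"
    \<comment> \<open>\<open>?d\<close> is the difference of \<open>f\<close> and \<open>h\<close>;
      writing \<open>f\<close> as \<open>?d\<close> plus \<open>h\<close> shows that the coset of
      \<open>h\<close> is all of \<open>H\<close>, so the quotient has a single element.\<close>
    let ?d = "\<lambda>x\<in>\<Omega>. f x \<oplus>\<^bsub>N\<^esub> (\<lambda>x\<in>\<Omega>. \<ominus>\<^bsub>N\<^esub> h x) x"
    have "?d \<in> H"
      using add_mod_hom[OF L N, of f "\<lambda>x\<in>\<Omega>. \<ominus>\<^bsub>N\<^esub> h x"] neg_mod_hom[OF L N, of h] f h
      by (simp add: H_def)
    moreover have "f = (\<lambda>x\<in>\<Omega>. ?d x \<oplus>\<^bsub>N\<^esub> h x)"
    proof (rule mod_hom_eqI)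
      show "f \<in> mod_hom A (?F\<lparr>carrier := \<Omega>\<rparr>) N" using f by (simp add: H_def)
      show "(\<lambda>x\<in>\<Omega>. ?d x \<oplus>\<^bsub>N\<^esub> h x) \<in> mod_hom A (?F\<lparr>carrier := \<Omega>\<rparr>) N"
        using add_mod_hom[OF L N, of ?d h] h \<open>?d \<in> H\<close> by (simp add: H_def)
      fix x assume "x \<in> carrier (?F\<lparr>carrier := \<Omega>\<rparr>)"
      moreover from this have "f x \<in> carrier N" "h x \<in> carrier N"
        using mod_homD(1) f h unfolding H_def by fast+
      ultimately show "f x = (\<lambda>x\<in>\<Omega>. ?d x \<oplus>\<^bsub>N\<^esub> h x) x"
        by (simp add: N.M.a_assoc N.M.l_neg)
    qed
    ultimately show "f \<in> H +>\<^bsub>Hom_space A (?F\<lparr>carrier := \<Omega>\<rparr>) N\<^esub> h"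
      unfolding mem_a_r_coset Hom_space_def fun_module_simps by (intro bexI[of _ ?d]) simp
  qed
  moreover have "H \<noteq> {}" using zero_mod_hom[OF L N] by (auto simp: H_def)
  ultimately show ?thesis
    unfolding Ext zero_module_def quotient_module_simps A_RCOSETS_def' carr by auto
qed

context fd_alg
begin

text \<open>
  For \<open>\<phi> : T \<rightarrow> \<tau> T\<close>, \<open>t \<in> T\<close> and \<open>b \<in> B\<close>, the functional \<open>\<phi>(b t)\<close> on \<open>Tr T\<close> sends the class of
  \<open>f\<close> to the value of \<open>\<phi>(t)\<close> at the class of \<open>f b\<close>, which is zero.
\<close>

lemma tau_rigidI:
  assumes T: "left_module A T"
    and ex: "\<exists>P1 P0 d1 d0. min_proj_presentation A T P1 P0 d1 d0"
    and B: "B \<subseteq> carrier A"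
    and gen: "\<And>t. t \<in> carrier T \<Longrightarrow> \<exists>b\<in>B. \<exists>b'\<in>B. \<exists>t1\<in>carrier T. \<exists>t2\<in>carrier T.
          t = b \<odot>\<^bsub>T\<^esub> t1 \<oplus>\<^bsub>T\<^esub> b' \<odot>\<^bsub>T\<^esub> t2"
    and fac: "\<And>P1 P0 d1 d0 f b. \<lbrakk>min_proj_presentation A T P1 P0 d1 d0;
        f \<in> mod_hom A P1 (regular_module A); b \<in> B\<rbrakk> \<Longrightarrow>
        \<exists>g\<in>mod_hom A P0 (regular_module A). \<forall>x\<in>carrier P1. f x \<otimes>\<^bsub>A\<^esub> b = g (d1 x)"
  shows "tau_rigid K A T"
proof -
  obtain P1 P0 d1 d0 where some: "(SOME (P1, P0, d1, d0). min_proj_presentation A T P1 P0 d1 d0)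
      = (P1, P0, d1, d0)" by (metis prod.exhaust)
  from ex have "\<exists>z. case z of (P1, P0, d1, d0) \<Rightarrow> min_proj_presentation A T P1 P0 d1 d0" by auto
  from someI_ex[OF this] have mp: "min_proj_presentation A T P1 P0 d1 d0" unfolding some by simp
  have P0: "left_module A P0" and P1: "left_module A P1" and d0: "d0 \<in> mod_hom A P0 T"
    and d1: "d1 \<in> mod_hom A P1 (P0\<lparr>carrier := a_kernel P0 T d0\<rparr>)"
    using mp by (auto simp: min_proj_presentation_def projective_cover_def fg_projective_def)
  interpret T: left_module A T by (rule T)
  interpret P1: left_module A P1 by (rule P1)
  \<comment> \<open>In the presentation \<open>d1\<close> maps to the kernel of \<open>d0\<close>,
    whose operations are those of \<open>P0\<close>; the transpose uses it as a map into
    \<open>P0\<close>.\<close>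
  have d1': "d1 \<in> mod_hom A P1 P0"
    using mod_homD[OF d1] by (intro mod_homI) (auto simp: mem_a_kernel)
  have opp: "ring (opposite A)" by (rule opposite_ring[OF ring])
  have L1: "left_module (opposite A) (A_dual A P1)" and L0: "left_module (opposite A) (A_dual A P0)"
    using A_dual_left_module[OF ring] P0 P1 by auto
  interpret L1: left_module "opposite A" "A_dual A P1" by (rule L1)
  let ?d = "\<lambda>g. compose (carrier P1) g d1"
  define U where "U = ?d ` carrier (A_dual A P0)"
  note Rg = regular_left_module[OF ring]
  have "submodule U (opposite A) (A_dual A P1)"
  proof -
    let ?e = "restrict ?d (carrier (A_dual A P0))"
    have "?e \<in> mod_hom (opposite A) (A_dual A P0) (A_dual A P1)"
    proof (rule mod_homI)
      fix f assume f: "f \<in> carrier (A_dual A P0)"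
      then show "?e f \<in> carrier (A_dual A P1)"
        using mod_hom_compose[OF d1' _ P1] by (simp add: A_dual_def)
      fix a assume a: "a \<in> carrier (opposite A)"
      have "a \<odot>\<^bsub>A_dual A P0\<^esub> f \<in> carrier (A_dual A P0)"
        using f a L0 by (simp add: left_module.smult_closed)
      then show "?e (a \<odot>\<^bsub>A_dual A P0\<^esub> f) = a \<odot>\<^bsub>A_dual A P1\<^esub> ?e f"
        using f a mod_homD(1)[OF d1'] by (auto simp: A_dual_def compose_def)
    next
      fix f g assume f: "f \<in> carrier (A_dual A P0)" "g \<in> carrier (A_dual A P0)"
      interpret L0: left_module "opposite A" "A_dual A P0" by (rule L0)
      from f have "f \<oplus>\<^bsub>A_dual A P0\<^esub> g \<in> carrier (A_dual A P0)" by simp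
      then show "?e (f \<oplus>\<^bsub>A_dual A P0\<^esub> g) = ?e f \<oplus>\<^bsub>A_dual A P1\<^esub> ?e g"
        using f mod_homD(1)[OF d1'] by (auto simp: A_dual_def compose_def)
    qed simp
    from image_submodule[OF this L0 L1 left_module.submodule_carrier[OF L0]]
    show ?thesis by (simp add: U_def)
  qed
  note U = this
  define Tr where "Tr = transpose_module A P1 P0 d1"
  have Tr_eq: "Tr = quotient_module (A_dual A P1) U"
    by (simp add: Tr_def transpose_module_def U_def)
  have Tr: "left_module (opposite A) Tr" unfolding Tr_eq by (rule quotient_left_module[OF L1 U])
  interpret Tr: left_module "opposite A" Tr by (rule Tr)
  interpret op: fd_alg K "opposite A" by (rule opposite_fd_alg)
  define D where "D = K_dual K (opposite A) Tr"
  have D: "left_module A D"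
    using op.K_dual_left_module[OF Tr] by (simp add: D_def)
  interpret D: left_module A D by (rule D)
  have tau: "AR_translate K A T = D" unfolding AR_translate_def some by (simp add: D_def Tr_def)
  \<comment> \<open>By \<open>fac\<close> the map \<open>x \<mapsto> f x b\<close> factors through
    \<open>d1\<close>, so it lies in \<open>U\<close>; thus \<open>b\<close> annihilates the
    transpose.\<close>
  have kill: "b \<odot>\<^bsub>Tr\<^esub> C = U" if "b \<in> B" "C \<in> carrier Tr" for b C
  proof -
    have bA: "b \<in> carrier A" using that B by blast
    from that obtain f where f: "f \<in> carrier (A_dual A P1)" "C = U +>\<^bsub>A_dual A P1\<^esub> f"
      by (auto simp: Tr_eq A_RCOSETS_def')
    then have f': "f \<in> mod_hom A P1 (regular_module A)" by (simp add: A_dual_def)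
    obtain g where g: "g \<in> mod_hom A P0 (regular_module A)"
      "\<forall>x\<in>carrier P1. f x \<otimes>\<^bsub>A\<^esub> b = g (d1 x)" using fac[OF mp f' \<open>b \<in> B\<close>] by blast
    have "b \<odot>\<^bsub>A_dual A P1\<^esub> f = ?d g"
      using g(2) by (auto simp: A_dual_def compose_def)
    then have "b \<odot>\<^bsub>A_dual A P1\<^esub> f \<in> U" using g(1) by (auto simp: U_def A_dual_def)
    moreover have "b \<odot>\<^bsub>Tr\<^esub> C = U +>\<^bsub>A_dual A P1\<^esub> (b \<odot>\<^bsub>A_dual A P1\<^esub> f)"
      unfolding Tr_eq f(2) by (rule quotient_smult[OF L1 U]) (use bA f in auto)
    moreover have "subgroup U (add_monoid (A_dual A P1))" using U by (simp add: submodule_def)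
    ultimately show ?thesis
      using L1.M.a_coset_join2 L1.submoduleD(2)[OF U] by metis
  qed
  \<comment> \<open>Scalars act on functionals through the argument, and \<open>U\<close> is the
    zero of \<open>Tr\<close>, where every functional vanishes.\<close>
  have zero_D: "b \<odot>\<^bsub>D\<^esub> l = \<zero>\<^bsub>D\<^esub>" if b: "b \<in> B" and l: "l \<in> carrier D" for b l
  proof -
    have l': "l \<in> mod_hom K (restrict_scalars (opposite A) Tr) (regular_module K)"
      using l by (simp add: D_def K_dual_def)
    have "l U = \<zero>\<^bsub>K\<^esub>"
      using mod_hom_zero[OF l' op.restrict_scalars_left_module[OF Tr] regular_K] by (simp add: Tr_eq)
    then show ?thesis using kill[OF b] by (auto simp: D_def K_dual_def)
  qed
  have "mod_hom A T D = {\<lambda>x\<in>carrier T. \<zero>\<^bsub>D\<^esub>}"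
  proof (intro equalityI subsetI)
    fix \<phi> assume \<phi>: "\<phi> \<in> mod_hom A T D"
    note h = mod_homD[OF \<phi>]
    have "\<phi> t = \<zero>\<^bsub>D\<^esub>" if "t \<in> carrier T" for t
    proof -
      obtain b b' t1 t2 where t: "b \<in> B" "b' \<in> B" "t1 \<in> carrier T" "t2 \<in> carrier T"
        "t = b \<odot>\<^bsub>T\<^esub> t1 \<oplus>\<^bsub>T\<^esub> b' \<odot>\<^bsub>T\<^esub> t2" using gen[OF \<open>t \<in> carrier T\<close>] by blast
      moreover have "b \<in> carrier A" "b' \<in> carrier A" using t B by auto
      ultimately show ?thesis using h zero_D by simp
    qed
    then have "\<phi> = (\<lambda>x\<in>carrier T. \<zero>\<^bsub>D\<^esub>)" by (intro mod_hom_eqI[OF \<phi> zero_mod_hom[OF T D]]) auto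
    then show "\<phi> \<in> {\<lambda>x\<in>carrier T. \<zero>\<^bsub>D\<^esub>}" by simp
  qed (use zero_mod_hom[OF T D] in auto)
  then show ?thesis
    by (simp add: tau_rigid_def zero_module_def Hom_space_def tau)
qed

end

section \<open>The path algebra of a two-cycle modulo paths of length two\<close>

text \<open>The position of the coordinate of the arrow starting at vertex \<open>i\<close>, and the other vertex.\<close>

definition ar :: "nat \<Rightarrow> nat" where "ar i = i + 2"

definition co :: "nat \<Rightarrow> nat" where "co i = 1 - i"

lemma co [simp]: "co i < 2" "i < 2 \<Longrightarrow> co (co i) = i" "co i \<noteq> i" "co 0 = 1" "co (Suc 0) = 0"
  unfolding co_def by (simp_all, presburger)

text \<open>
  The vertices are 0 and 1. The coordinates of an element are those of the idempotents
  \<open>e\<^sub>0\<close>, \<open>e\<^sub>1\<close> and of the arrows \<open>a\<^sub>0 = e\<^sub>1 a\<^sub>0 e\<^sub>0\<close>, \<open>a\<^sub>1 = e\<^sub>0 a\<^sub>1 e\<^sub>1\<close>, in this order.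
\<close>

definition cycle_algebra :: "('k, 'r) ring_scheme \<Rightarrow> ('k, nat \<Rightarrow> 'k) module" where
  "cycle_algebra K =
    \<lparr>carrier = {x. (\<forall>n. x n \<in> carrier K) \<and> (\<forall>n\<ge>4. x n = \<zero>\<^bsub>K\<^esub>)},
     monoid.mult = (\<lambda>x y n. if n < 2 then x n \<otimes>\<^bsub>K\<^esub> y n
       else if n < 4 then x (3 - n) \<otimes>\<^bsub>K\<^esub> y n \<oplus>\<^bsub>K\<^esub> x n \<otimes>\<^bsub>K\<^esub> y (n - 2) else \<zero>\<^bsub>K\<^esub>),
     one = (\<lambda>n. if n < 2 then \<one>\<^bsub>K\<^esub> else \<zero>\<^bsub>K\<^esub>),
     zero = (\<lambda>n. \<zero>\<^bsub>K\<^esub>), add = (\<lambda>x y n. x n \<oplus>\<^bsub>K\<^esub> y n), smult = (\<lambda>k x n. k \<otimes>\<^bsub>K\<^esub> x n)\<rparr>"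

lemma less_2_cases: "(i :: nat) < 2 \<Longrightarrow> (i = 0 \<Longrightarrow> Q) \<Longrightarrow> (i = 1 \<Longrightarrow> Q) \<Longrightarrow> Q"
  by linarith

locale cycle = K: field K for K :: "('k, 'r) ring_scheme"
begin

definition A :: "('k, nat \<Rightarrow> 'k) module" where "A = cycle_algebra K"

definition e :: "nat \<Rightarrow> nat \<Rightarrow> 'k" where "e i = (\<lambda>n. if n = i then \<one>\<^bsub>K\<^esub> else \<zero>\<^bsub>K\<^esub>)"
definition a :: "nat \<Rightarrow> nat \<Rightarrow> 'k" where "a i = (\<lambda>n. if n = ar i then \<one>\<^bsub>K\<^esub> else \<zero>\<^bsub>K\<^esub>)"

lemma mem_A: "x \<in> carrier A \<longleftrightarrow> (\<forall>n. x n \<in> carrier K) \<and> (\<forall>n\<ge>4. x n = \<zero>\<^bsub>K\<^esub>)"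
  by (simp add: A_def cycle_algebra_def)

lemma A_ops [simp]: "\<zero>\<^bsub>A\<^esub> n = \<zero>\<^bsub>K\<^esub>" "(x \<oplus>\<^bsub>A\<^esub> y) n = x n \<oplus>\<^bsub>K\<^esub> y n" "(k \<odot>\<^bsub>A\<^esub> x) n = k \<otimes>\<^bsub>K\<^esub> x n"
  by (simp_all add: A_def cycle_algebra_def)

text \<open>A coordinate \<open>n\<close> equal to 2 or 3 belongs to the arrow from vertex
  \<open>n - 2\<close> to vertex \<open>3 - n\<close>: it is multiplied from the left by the
  coordinate of its end and from the right by that of its start. Products of two arrows contribute
  nothing, since paths of length two vanish.\<close>

lemma A_mult: "(x \<otimes>\<^bsub>A\<^esub> y) n = (if n < 2 then x n \<otimes>\<^bsub>K\<^esub> y n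
       else if n < 4 then x (3 - n) \<otimes>\<^bsub>K\<^esub> y n \<oplus>\<^bsub>K\<^esub> x n \<otimes>\<^bsub>K\<^esub> y (n - 2) else \<zero>\<^bsub>K\<^esub>)"
  by (simp add: A_def cycle_algebra_def)

lemma A_one: "\<one>\<^bsub>A\<^esub> n = (if n < 2 then \<one>\<^bsub>K\<^esub> else \<zero>\<^bsub>K\<^esub>)"
  by (simp add: A_def cycle_algebra_def)

text \<open>The multiplication table relative to a vertex \<open>i\<close> and the opposite vertex
  \<open>co i\<close>, so that later arguments treat both vertices at once.\<close>

lemma mult_coord [simp]:
  assumes "i < 2"
  shows "(x \<otimes>\<^bsub>A\<^esub> y) i = x i \<otimes>\<^bsub>K\<^esub> y i"
    and "(x \<otimes>\<^bsub>A\<^esub> y) (co i) = x (co i) \<otimes>\<^bsub>K\<^esub> y (co i)"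
    and "(x \<otimes>\<^bsub>A\<^esub> y) (ar i) = x (co i) \<otimes>\<^bsub>K\<^esub> y (ar i) \<oplus>\<^bsub>K\<^esub> x (ar i) \<otimes>\<^bsub>K\<^esub> y i"
    and "(x \<otimes>\<^bsub>A\<^esub> y) (ar (co i)) = x i \<otimes>\<^bsub>K\<^esub> y (ar (co i)) \<oplus>\<^bsub>K\<^esub> x (ar (co i)) \<otimes>\<^bsub>K\<^esub> y (co i)"
  using assms by (auto elim!: less_2_cases simp: A_mult ar_def co_def)

lemma ea_coord [simp]:
  assumes "i < 2"
  shows "e i i = \<one>\<^bsub>K\<^esub>" "e i (co i) = \<zero>\<^bsub>K\<^esub>" "e i (ar i) = \<zero>\<^bsub>K\<^esub>" "e i (ar (co i)) = \<zero>\<^bsub>K\<^esub>"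
    and "e (co i) i = \<zero>\<^bsub>K\<^esub>" "e (co i) (co i) = \<one>\<^bsub>K\<^esub>" "e (co i) (ar i) = \<zero>\<^bsub>K\<^esub>"
      "e (co i) (ar (co i)) = \<zero>\<^bsub>K\<^esub>"
    and "a i i = \<zero>\<^bsub>K\<^esub>" "a i (co i) = \<zero>\<^bsub>K\<^esub>" "a i (ar i) = \<one>\<^bsub>K\<^esub>" "a i (ar (co i)) = \<zero>\<^bsub>K\<^esub>"
    and "a (co i) i = \<zero>\<^bsub>K\<^esub>" "a (co i) (co i) = \<zero>\<^bsub>K\<^esub>" "a (co i) (ar i) = \<zero>\<^bsub>K\<^esub>"
      "a (co i) (ar (co i)) = \<one>\<^bsub>K\<^esub>"
  using assms by (auto elim!: less_2_cases simp: e_def a_def ar_def co_def)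

lemma ea_closed [simp]: "i < 2 \<Longrightarrow> e i \<in> carrier A" "i < 2 \<Longrightarrow> a i \<in> carrier A"
  by (auto simp: mem_A e_def a_def ar_def)

text \<open>Together with \<open>mult_coord\<close> and \<open>ea_coord\<close> this reduces an
  identity in \<open>A\<close> to four identities in \<open>K\<close>.\<close>

lemma A_eqI:
  assumes "i < 2" "x \<in> carrier A" "y \<in> carrier A" "x i = y i" "x (co i) = y (co i)"
    "x (ar i) = y (ar i)" "x (ar (co i)) = y (ar (co i))"
  shows "x = y"
proof
  fix n :: nat
  have n: "n = 0 \<or> n = 1 \<or> n = 2 \<or> n = 3 \<or> n \<ge> 4" by arith
  show "x n = y n"
    by (rule less_2_cases[OF assms(1)]; use assms n in \<open>auto simp: mem_A ar_def co_def eval_nat_numeral\<close>)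
qed

lemma A_closed [simp]:
  "\<zero>\<^bsub>A\<^esub> \<in> carrier A" "\<one>\<^bsub>A\<^esub> \<in> carrier A"
  "\<lbrakk>x \<in> carrier A; y \<in> carrier A\<rbrakk> \<Longrightarrow> x \<oplus>\<^bsub>A\<^esub> y \<in> carrier A"
  "\<lbrakk>x \<in> carrier A; y \<in> carrier A\<rbrakk> \<Longrightarrow> x \<otimes>\<^bsub>A\<^esub> y \<in> carrier A"
  "\<lbrakk>k \<in> carrier K; x \<in> carrier A\<rbrakk> \<Longrightarrow> k \<odot>\<^bsub>A\<^esub> x \<in> carrier A"
  by (auto simp: mem_A A_mult A_one)

lemma coord [simp]: "x \<in> carrier A \<Longrightarrow> x n \<in> carrier K"
  by (simp add: mem_A)

lemma A_one_coord [simp]: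
  "i < 2 \<Longrightarrow> \<one>\<^bsub>A\<^esub> i = \<one>\<^bsub>K\<^esub>" "\<one>\<^bsub>A\<^esub> (co i) = \<one>\<^bsub>K\<^esub>" "\<one>\<^bsub>A\<^esub> (ar i) = \<zero>\<^bsub>K\<^esub>"
  by (auto simp: A_one ar_def co_def)

lemma abelian_group_A: "abelian_group A"
proof (rule abelian_groupI)
  fix x assume "x \<in> carrier A"
  then have "(\<lambda>n. \<ominus>\<^bsub>K\<^esub> x n) \<in> carrier A" by (simp add: mem_A del: coord)
  moreover have "(\<lambda>n. \<ominus>\<^bsub>K\<^esub> x n) \<oplus>\<^bsub>A\<^esub> x = \<zero>\<^bsub>A\<^esub>" using \<open>x \<in> _\<close> by (simp add: fun_eq_iff K.l_neg)
  ultimately show "\<exists>y\<in>carrier A. y \<oplus>\<^bsub>A\<^esub> x = \<zero>\<^bsub>A\<^esub>" by blast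
qed (auto simp: fun_eq_iff K.a_ac)

lemma ring_A: "ring A"
proof (rule ringI[OF abelian_group_A])
  show "monoid A"
    by (rule monoidI)
       (auto intro!: A_eqI[of 0] simp: K.l_distr K.r_distr K.m_assoc K.a_assoc)
qed (auto intro!: A_eqI[of 0] simp: K.l_distr K.r_distr K.a_ac)

lemma decomp:
  assumes "i < 2" "x \<in> carrier A"
  shows "x = x i \<odot>\<^bsub>A\<^esub> e i \<oplus>\<^bsub>A\<^esub> x (co i) \<odot>\<^bsub>A\<^esub> e (co i) \<oplus>\<^bsub>A\<^esub> x (ar i) \<odot>\<^bsub>A\<^esub> a i \<oplus>\<^bsub>A\<^esub>
     x (ar (co i)) \<odot>\<^bsub>A\<^esub> a (co i)"
  using assms by (intro A_eqI[of i]) auto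

lemma fd_algebra_A: "fd_algebra K A"
proof -
  have "module K A"
    by (rule moduleI[OF K.is_cring abelian_group_A])
       (auto simp: fun_eq_iff K.l_distr K.r_distr K.m_assoc)
  then interpret KA: module K A .
  have "finite_dim K A" unfolding finite_dim_def
  proof (intro exI conjI allI impI)
    show "finite {e 0, e 1, a 0, a 1}" by simp
    show "{e 0, e 1, a 0, a 1} \<subseteq> carrier A" by simp
    fix W assume W: "submodule W K A \<and> {e 0, e 1, a 0, a 1} \<subseteq> W"
    note S = KA.submoduleE[OF conjunct1[OF W]]
    have "x \<in> W" if "x \<in> carrier A" for x
      by (subst decomp[of 0]) (use W that S(4,5) in auto)
    then show "W = carrier A" using S(1) by blast
  qed
  then show ?thesis
    unfolding fd_algebra_def using K.field_axioms ring_A \<open>module K A\<close>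
    by (auto intro!: A_eqI[of 0] simp: K.m_lcomm K.m_assoc K.r_distr)
qed

sublocale fd_alg K A by standard (rule fd_algebra_A)

lemma products:
  assumes "i < 2"
  shows "e i \<otimes>\<^bsub>A\<^esub> e i = e i" "a i \<otimes>\<^bsub>A\<^esub> e i = a i" "e (co i) \<otimes>\<^bsub>A\<^esub> a i = a i" "e i \<otimes>\<^bsub>A\<^esub> a (co i) = a (co i)"
    "a (co i) \<otimes>\<^bsub>A\<^esub> e (co i) = a (co i)" "e i \<otimes>\<^bsub>A\<^esub> a i = \<zero>\<^bsub>A\<^esub>"
    "a i \<otimes>\<^bsub>A\<^esub> a (co i) = \<zero>\<^bsub>A\<^esub>" "a (co i) \<otimes>\<^bsub>A\<^esub> a i = \<zero>\<^bsub>A\<^esub>" "a i \<otimes>\<^bsub>A\<^esub> a i = \<zero>\<^bsub>A\<^esub>"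
    "e i \<otimes>\<^bsub>A\<^esub> e (co i) = \<zero>\<^bsub>A\<^esub>" "e (co i) \<otimes>\<^bsub>A\<^esub> e i = \<zero>\<^bsub>A\<^esub>"
    "e i \<oplus>\<^bsub>A\<^esub> e (co i) = \<one>\<^bsub>A\<^esub>"
  using assms by (auto intro!: A_eqI[of i])

lemma left_mult:
  assumes "i < 2" "x \<in> carrier A"
  shows "a i \<otimes>\<^bsub>A\<^esub> x = x i \<odot>\<^bsub>A\<^esub> a i"
    and "e i \<otimes>\<^bsub>A\<^esub> x = x i \<odot>\<^bsub>A\<^esub> e i \<oplus>\<^bsub>A\<^esub> x (ar (co i)) \<odot>\<^bsub>A\<^esub> a (co i)"
    and "e (co i) \<otimes>\<^bsub>A\<^esub> x = x (co i) \<odot>\<^bsub>A\<^esub> e (co i) \<oplus>\<^bsub>A\<^esub> x (ar i) \<odot>\<^bsub>A\<^esub> a i"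
  using assms by (auto intro!: A_eqI[of i])

text \<open>The left ideal \<open>A e\<^sub>i\<close>.\<close>

definition L :: "nat \<Rightarrow> (nat \<Rightarrow> 'k) set" where
  "L i = {x \<in> carrier A. x (co i) = \<zero>\<^bsub>K\<^esub> \<and> x (ar (co i)) = \<zero>\<^bsub>K\<^esub>}"

definition P :: "nat \<Rightarrow> (nat \<Rightarrow> 'k, nat \<Rightarrow> 'k) module" where
  "P i = regular_module A\<lparr>carrier := L i\<rparr>"

lemma P_simps [simp]:
  "carrier (P i) = L i" "\<zero>\<^bsub>P i\<^esub> = \<zero>\<^bsub>A\<^esub>" "add (P i) = add A" "smult (P i) = monoid.mult A"
  by (simp_all add: P_def)

lemma L_A: "x \<in> L i \<Longrightarrow> x \<in> carrier A"
  by (simp add: L_def)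

lemma left_regular: "left_module A (regular_module A)"
  by (rule regular_left_module[OF ring])

lemma L_submodule: "i < 2 \<Longrightarrow> submodule (L i) A (regular_module A)"
  by (rule left_module.submoduleI[OF left_regular]) (auto simp: L_def)

lemma P_left_module: "i < 2 \<Longrightarrow> left_module A (P i)"
  unfolding P_def by (rule left_module.submodule_left_module[OF left_regular L_submodule])

lemma L_mult: "\<lbrakk>i < 2; x \<in> carrier A; y \<in> L i\<rbrakk> \<Longrightarrow> x \<otimes>\<^bsub>A\<^esub> y \<in> L i"
  by (simp add: L_def)

lemma e_L: "i < 2 \<Longrightarrow> e i \<in> L i" by (simp add: L_def)

text \<open>Together with \<open>e_L\<close> and \<open>L_mult\<close> this identifies the
  coordinate description \<open>L i\<close> with the left ideal generated by
  \<open>e i\<close>.\<close>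

lemma L_mult_e: "\<lbrakk>i < 2; x \<in> L i\<rbrakk> \<Longrightarrow> x \<otimes>\<^bsub>A\<^esub> e i = x"
  by (auto intro!: A_eqI[of i] simp: L_def)

section \<open>Injectivity of the modules \<open>P i\<close>\<close>

lemma submodule_restrict_scalars:
  assumes "left_module A M" "submodule N A M"
  shows "submodule N K (restrict_scalars A M)"
proof -
  interpret M: left_module A M by fact
  interpret R: left_module K "restrict_scalars A M" by (rule restrict_scalars_left_module[OF assms(1)])
  show ?thesis using M.submoduleD[OF assms(2)] scalar(1) by (intro R.submoduleI) auto
qed

lemma smult_scalar:
  assumes "left_module A M" "k \<in> carrier K" "i < 2" "m \<in> carrier M"
  shows "(k \<odot>\<^bsub>A\<^esub> e i) \<odot>\<^bsub>M\<^esub> m = scalar k \<odot>\<^bsub>M\<^esub> (e i \<odot>\<^bsub>M\<^esub> m)"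
    and "(k \<odot>\<^bsub>A\<^esub> a i) \<odot>\<^bsub>M\<^esub> m = scalar k \<odot>\<^bsub>M\<^esub> (a i \<odot>\<^bsub>M\<^esub> m)"
proof -
  interpret left_module A M by fact
  show "(k \<odot>\<^bsub>A\<^esub> e i) \<odot>\<^bsub>M\<^esub> m = scalar k \<odot>\<^bsub>M\<^esub> (e i \<odot>\<^bsub>M\<^esub> m)"
    "(k \<odot>\<^bsub>A\<^esub> a i) \<odot>\<^bsub>M\<^esub> m = scalar k \<odot>\<^bsub>M\<^esub> (a i \<odot>\<^bsub>M\<^esub> m)"
    using assms scalar(1,2) by (simp_all flip: smult_assoc)
qed

text \<open>
  \<open>A e\<^sub>i\<close> is injective: for \<open>j = co i\<close> it is the \<open>K\<close>-dual of \<open>e\<^sub>j A\<close>, so homomorphisms \<open>M \<rightarrow> A e\<^sub>i\<close>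
  correspond to functionals on \<open>e\<^sub>j M\<close>.
\<close>

lemma P_injective:
  assumes i: "i < 2" and M: "left_module A M" and N: "submodule N A M"
    and f: "f \<in> mod_hom A (M\<lparr>carrier := N\<rparr>) (P i)"
  shows "\<exists>g\<in>mod_hom A M (P i). \<forall>x\<in>N. g x = f x"
proof -
  interpret M: left_module A M by fact
  have j: "co i < 2" by simp
  let ?V = "restrict_scalars A M"
  have V: "left_module K ?V" by (rule restrict_scalars_left_module[OF M])
  note S = M.submoduleD[OF N]
  have f': "f x \<in> L i" "f (b \<odot>\<^bsub>M\<^esub> x) = b \<otimes>\<^bsub>A\<^esub> f x" if "x \<in> N" "b \<in> carrier A" for x b
    using mod_homD(1,5)[OF f] that by auto
  have f_add: "f (x \<oplus>\<^bsub>M\<^esub> y) = f x \<oplus>\<^bsub>A\<^esub> f y" if "x \<in> N" "y \<in> N" for x y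
    using mod_homD(4)[OF f] that by auto
  have fA: "f x \<in> carrier A" if "x \<in> N" for x using f'(1)[OF that, of "\<one>\<^bsub>A\<^esub>"] L_A by simp
  \<comment> \<open>The coordinate at \<open>a i\<close>, which spans the socle of
    \<open>P i\<close>, already determines \<open>f\<close>: the other coordinate of
    \<open>f x\<close> is this functional evaluated at \<open>a i\<close> times
    \<open>x\<close>.\<close>
  have "(\<lambda>x\<in>N. f x (ar i)) \<in> mod_hom K (?V\<lparr>carrier := N\<rparr>) (regular_module K)"
  proof (rule mod_homI, goal_cases)
    case (1 x)
    then show ?case using fA[of x] by simp
  next
    case (3 x y)
    then show ?case using S(4)[of x y] f_add[of x y] by simp
  next
    case (4 k x)
    then show ?case using S(5)[of "scalar k" x] f'(2)[of x "scalar k"] fA[of x] scalar(1,2) by simp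
  qed simp
  then obtain l where l: "l \<in> mod_hom K ?V (regular_module K)"
    and lN: "\<And>x. x \<in> N \<Longrightarrow> l x = f x (ar i)"
    by (rule extend_functional[OF K.field_axioms V submodule_restrict_scalars[OF M N]])
       (rule that, assumption, simp)
  have l': "l x \<in> carrier K" "l (x \<oplus>\<^bsub>M\<^esub> y) = l x \<oplus>\<^bsub>K\<^esub> l y"
    if "x \<in> carrier M" "y \<in> carrier M" for x y
    using mod_homD(1,4)[OF l] that by auto
  have ls: "l (scalar k \<odot>\<^bsub>M\<^esub> x) = k \<otimes>\<^bsub>K\<^esub> l x" if "x \<in> carrier M" "k \<in> carrier K" for x k
    using mod_homD(5)[OF l, of k x] that by auto
  have lc: "l (b \<odot>\<^bsub>M\<^esub> x) \<in> carrier K" if "x \<in> carrier M" "b \<in> carrier A" for b x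
    using l'(1)[of "b \<odot>\<^bsub>M\<^esub> x" "b \<odot>\<^bsub>M\<^esub> x"] that by simp
  \<comment> \<open>The formula is forced. If \<open>l\<close> is the \<open>ar i\<close> coordinate
    of a homomorphism \<open>g\<close> to \<open>P i\<close>, then multiplying \<open>g m\<close> by
    \<open>a i\<close> moves its coordinate \<open>i\<close> to position \<open>ar i\<close>, and
    multiplying it by \<open>e (co i)\<close> keeps its coordinate \<open>ar i\<close>.\<close>
  define g where "g = (\<lambda>m\<in>carrier M. l (a i \<odot>\<^bsub>M\<^esub> m) \<odot>\<^bsub>A\<^esub> e i \<oplus>\<^bsub>A\<^esub> l (e (co i) \<odot>\<^bsub>M\<^esub> m) \<odot>\<^bsub>A\<^esub> a i)"
  have g: "g \<in> mod_hom A M (P i)"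
  proof (rule mod_homI)
    show "g x \<in> carrier (P i)" if "x \<in> carrier M" for x
      using that i lc by (simp add: g_def L_def)
    show "g x = undefined" if "x \<notin> carrier M" for x using that by (simp add: g_def)
    show "g (x \<oplus>\<^bsub>M\<^esub> y) = g x \<oplus>\<^bsub>P i\<^esub> g y" if "x \<in> carrier M" "y \<in> carrier M" for x y
      using that i j lc l'(2) by (auto simp: g_def M.smult_r_distr intro!: A_eqI[of i])
    show "g (b \<odot>\<^bsub>M\<^esub> x) = b \<odot>\<^bsub>P i\<^esub> g x" if b: "b \<in> carrier A" and x: "x \<in> carrier M" for b x
    proof -
      have "a i \<odot>\<^bsub>M\<^esub> (b \<odot>\<^bsub>M\<^esub> x) = (b i \<odot>\<^bsub>A\<^esub> a i) \<odot>\<^bsub>M\<^esub> x"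
        using b x i left_mult(1)[OF i b] by (simp flip: M.smult_assoc)
      then have 1: "l (a i \<odot>\<^bsub>M\<^esub> (b \<odot>\<^bsub>M\<^esub> x)) = b i \<otimes>\<^bsub>K\<^esub> l (a i \<odot>\<^bsub>M\<^esub> x)"
        using b x i by (simp add: smult_scalar[OF M] ls)
      have "e (co i) \<odot>\<^bsub>M\<^esub> (b \<odot>\<^bsub>M\<^esub> x)
          = (b (co i) \<odot>\<^bsub>A\<^esub> e (co i)) \<odot>\<^bsub>M\<^esub> x \<oplus>\<^bsub>M\<^esub> (b (ar i) \<odot>\<^bsub>A\<^esub> a i) \<odot>\<^bsub>M\<^esub> x"
        using b x i j left_mult(3)[OF i b] by (simp flip: M.smult_assoc M.smult_l_distr)
      then have 2: "l (e (co i) \<odot>\<^bsub>M\<^esub> (b \<odot>\<^bsub>M\<^esub> x))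
          = b (co i) \<otimes>\<^bsub>K\<^esub> l (e (co i) \<odot>\<^bsub>M\<^esub> x) \<oplus>\<^bsub>K\<^esub> b (ar i) \<otimes>\<^bsub>K\<^esub> l (a i \<odot>\<^bsub>M\<^esub> x)"
        using b x i j by (simp add: smult_scalar[OF M] ls l'(2) scalar(1))
      show ?thesis
        using b x i j lc by (auto simp: g_def 1 2 intro!: A_eqI[of i])
    qed
  qed
  moreover have "g x = f x" if x: "x \<in> N" for x
  proof -
    have "f x \<in> L i" using f'(1)[OF x, of "\<one>\<^bsub>A\<^esub>"] by simp
    moreover have "l (a i \<odot>\<^bsub>M\<^esub> x) = f x i" "l (e (co i) \<odot>\<^bsub>M\<^esub> x) = f x (ar i)"
      using x i j S(5) fA[OF x] by (simp_all add: lN f'(2))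
    ultimately show ?thesis
      using x S(2) i by (auto simp: g_def L_def intro!: A_eqI[of i])
  qed
  ultimately show ?thesis by blast
qed

lemma superfluous_subset_radical:
  assumes M: "left_module A M" and U: "superfluous A M U" and u: "u \<in> U" and i: "i < 2"
  shows "\<exists>m\<in>carrier M. \<exists>m'\<in>carrier M. u = a i \<odot>\<^bsub>M\<^esub> m \<oplus>\<^bsub>M\<^esub> a (co i) \<odot>\<^bsub>M\<^esub> m'"
proof -
  interpret M: left_module A M by fact
  define J where "J = {a 0 \<odot>\<^bsub>M\<^esub> m \<oplus>\<^bsub>M\<^esub> a 1 \<odot>\<^bsub>M\<^esub> m' |m m'. m \<in> carrier M \<and> m' \<in> carrier M}"
  have Us: "submodule U A M" using U by (simp add: superfluous_def)
  note S = M.submoduleD[OF Us]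
  let ?V = "restrict_scalars A M"
  have V: "left_module K ?V" by (rule restrict_scalars_left_module[OF M])
  interpret V: left_module K ?V by (rule V)
  have memJ: "a 0 \<odot>\<^bsub>M\<^esub> m \<oplus>\<^bsub>M\<^esub> a 1 \<odot>\<^bsub>M\<^esub> m' \<in> J" if "m \<in> carrier M" "m' \<in> carrier M" for m m'
    using that by (auto simp: J_def)
  have J_add: "x \<oplus>\<^bsub>M\<^esub> y \<in> J" if "x \<in> J" "y \<in> J" for x y
  proof -
    from that obtain m n m' n' where *: "m \<in> carrier M" "n \<in> carrier M" "m' \<in> carrier M" "n' \<in> carrier M"
      "x = a 0 \<odot>\<^bsub>M\<^esub> m \<oplus>\<^bsub>M\<^esub> a 1 \<odot>\<^bsub>M\<^esub> n" "y = a 0 \<odot>\<^bsub>M\<^esub> m' \<oplus>\<^bsub>M\<^esub> a 1 \<odot>\<^bsub>M\<^esub> n'" by (auto simp: J_def)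
    then have "x \<oplus>\<^bsub>M\<^esub> y = a 0 \<odot>\<^bsub>M\<^esub> (m \<oplus>\<^bsub>M\<^esub> m') \<oplus>\<^bsub>M\<^esub> a 1 \<odot>\<^bsub>M\<^esub> (n \<oplus>\<^bsub>M\<^esub> n')"
      by (simp add: M.smult_r_distr M.M.a_ac)
    then show ?thesis using memJ * by simp
  qed
  have "submodule J K ?V"
  proof (rule V.submoduleI)
    show "J \<subseteq> carrier ?V" by (auto simp: J_def)
    show "\<zero>\<^bsub>?V\<^esub> \<in> J" using memJ[of "\<zero>\<^bsub>M\<^esub>" "\<zero>\<^bsub>M\<^esub>"] by simp
    show "x \<oplus>\<^bsub>?V\<^esub> y \<in> J" if "x \<in> J" "y \<in> J" for x y using that J_add by simp
    show "k \<odot>\<^bsub>?V\<^esub> x \<in> J" if "k \<in> carrier K" "x \<in> J" for k x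
    proof -
      from that obtain m n where *: "m \<in> carrier M" "n \<in> carrier M" "x = a 0 \<odot>\<^bsub>M\<^esub> m \<oplus>\<^bsub>M\<^esub> a 1 \<odot>\<^bsub>M\<^esub> n"
        by (auto simp: J_def)
      have "scalar k \<otimes>\<^bsub>A\<^esub> a b = a b \<otimes>\<^bsub>A\<^esub> scalar k" if "b < 2" for b
        using \<open>k \<in> _\<close> that scalar(2,3) by simp
      then have "scalar k \<odot>\<^bsub>M\<^esub> (a b \<odot>\<^bsub>M\<^esub> m) = a b \<odot>\<^bsub>M\<^esub> (scalar k \<odot>\<^bsub>M\<^esub> m)" if "b < 2" "m \<in> carrier M" for b m
        using \<open>k \<in> _\<close> that scalar(1) by (simp flip: M.smult_assoc)
      then have "scalar k \<odot>\<^bsub>M\<^esub> x = a 0 \<odot>\<^bsub>M\<^esub> (scalar k \<odot>\<^bsub>M\<^esub> m) \<oplus>\<^bsub>M\<^esub> a 1 \<odot>\<^bsub>M\<^esub> (scalar k \<odot>\<^bsub>M\<^esub> n)"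
        using * that scalar(1) by (simp add: M.smult_r_distr)
      then show ?thesis using memJ * that scalar(1) by simp
    qed
  qed
  note J = this
  have aJ: "a b \<odot>\<^bsub>M\<^esub> m \<in> J" if "b < 2" "m \<in> carrier M" for b m
    using that memJ[of m "\<zero>\<^bsub>M\<^esub>"] memJ[of "\<zero>\<^bsub>M\<^esub>" m] by (auto elim!: less_2_cases)
  have eJ: "e b \<odot>\<^bsub>M\<^esub> u \<in> J" if b: "b < 2" for b
  proof (rule ccontr)
    let ?w = "e b \<odot>\<^bsub>M\<^esub> u"
    assume "?w \<notin> J"
    moreover have uM: "u \<in> carrier M" using u S(2) by simp
    moreover have wU: "?w \<in> U" using u b S(5) by simp
    ultimately obtain l where l: "l \<in> mod_hom K ?V (regular_module K)" "l ?w = \<one>\<^bsub>K\<^esub>"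
      "\<And>n. n \<in> J \<Longrightarrow> l n = \<zero>\<^bsub>K\<^esub>"
      using separating_functional[OF K.field_axioms V J, of ?w] b by auto
    have l': "l x \<in> carrier K" if "x \<in> carrier M" for x
      using mod_homD(1)[OF l(1)] that by auto
    have l_add: "l (x \<oplus>\<^bsub>M\<^esub> y) = l x \<oplus>\<^bsub>K\<^esub> l y" if "x \<in> carrier M" "y \<in> carrier M" for x y
      using mod_homD(4)[OF l(1)] that by auto
    have ls: "l (scalar k \<odot>\<^bsub>M\<^esub> x) = k \<otimes>\<^bsub>K\<^esub> l x" if "x \<in> carrier M" "k \<in> carrier K" for x k
      using mod_homD(5)[OF l(1), of k x] that by auto
    \<comment> \<open>Modulo \<open>J\<close>, the product of \<open>e b\<close> and
      \<open>x\<close> is \<open>x b\<close> times \<open>e b\<close>, and \<open>l\<close> vanishes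
      on \<open>J\<close>. So \<open>A\<close> acts through the character
      \<open>x \<mapsto> x b\<close>, which makes \<open>N\<close> below an
      \<open>A\<close>-submodule and not merely a subspace.\<close>
    have el: "l (e b \<odot>\<^bsub>M\<^esub> (x \<odot>\<^bsub>M\<^esub> m)) = x b \<otimes>\<^bsub>K\<^esub> l (e b \<odot>\<^bsub>M\<^esub> m)"
      if x: "x \<in> carrier A" and m: "m \<in> carrier M" for x m
    proof -
      have "e b \<odot>\<^bsub>M\<^esub> (x \<odot>\<^bsub>M\<^esub> m)
          = (x b \<odot>\<^bsub>A\<^esub> e b) \<odot>\<^bsub>M\<^esub> m \<oplus>\<^bsub>M\<^esub> (x (ar (co b)) \<odot>\<^bsub>A\<^esub> a (co b)) \<odot>\<^bsub>M\<^esub> m"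
        using x m b left_mult(2)[OF b x] by (simp flip: M.smult_assoc M.smult_l_distr)
      then show ?thesis
        using x m b aJ by (simp add: smult_scalar[OF M] ls l_add scalar(1) l(3) l')
    qed
    define N where "N = {m \<in> carrier M. l (e b \<odot>\<^bsub>M\<^esub> m) = \<zero>\<^bsub>K\<^esub>}"
    have "submodule N A M"
    proof (rule M.submoduleI)
      show "\<zero>\<^bsub>M\<^esub> \<in> N" using b mod_hom_zero[OF l(1) V regular_K] by (simp add: N_def)
    qed (auto simp: b N_def M.smult_r_distr l_add el)
    moreover have "U <+>\<^bsub>M\<^esub> N = carrier M"
    proof (intro equalityI subsetI)
      fix m assume m: "m \<in> carrier M"
      \<comment> \<open>As \<open>l\<close> takes the value 1 at \<open>?w\<close>, subtracting
        \<open>?c\<close> times \<open>?w\<close> moves \<open>m\<close> into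
        \<open>N\<close>.\<close>
      let ?c = "l (e b \<odot>\<^bsub>M\<^esub> m)"
      let ?v = "scalar ?c \<odot>\<^bsub>M\<^esub> ?w"
      have c: "?c \<in> carrier K" "scalar ?c \<in> carrier A" using m b l' scalar(1) by auto
      have v: "?v \<in> U" using wU S(5) c by simp
      have "\<ominus>\<^bsub>M\<^esub> ?v \<oplus>\<^bsub>M\<^esub> m \<in> N"
      proof -
        have "\<ominus>\<^bsub>M\<^esub> ?v = scalar (\<ominus>\<^bsub>K\<^esub> ?c) \<odot>\<^bsub>M\<^esub> ?w"
        proof -
          have "scalar (\<ominus>\<^bsub>K\<^esub> ?c) = \<ominus>\<^bsub>A\<^esub> \<one>\<^bsub>A\<^esub> \<otimes>\<^bsub>A\<^esub> scalar ?c"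
            using c by (simp add: KA.smult_l_minus A.l_minus)
          then show ?thesis using c b uM M.smult_minus_one[of ?v] by (simp add: M.smult_assoc)
        qed
        moreover have "e b \<odot>\<^bsub>M\<^esub> ?w = ?w" using b uM products(1)[OF b] by (simp flip: M.smult_assoc)
        moreover have "scalar (\<ominus>\<^bsub>K\<^esub> ?c) b = \<ominus>\<^bsub>K\<^esub> ?c" using c b by simp
        ultimately show ?thesis
          using m b c uM l(2) scalar(1)[of "\<ominus>\<^bsub>K\<^esub> ?c"]
          by (simp add: N_def M.smult_r_distr l_add el K.l_neg)
      qed
      moreover have "m = ?v \<oplus>\<^bsub>M\<^esub> (\<ominus>\<^bsub>M\<^esub> ?v \<oplus>\<^bsub>M\<^esub> m)"
        using m v S(2) by (simp add: M.M.r_neg1 M.M.r_neg2)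
      ultimately show "m \<in> U <+>\<^bsub>M\<^esub> N" using v unfolding mem_set_add by blast
    qed (use S(2) in \<open>auto simp: mem_set_add N_def\<close>)
    ultimately have "N = carrier M" using U by (simp add: superfluous_def)
    then have "l (e b \<odot>\<^bsub>M\<^esub> ?w) = \<zero>\<^bsub>K\<^esub>" using wU S(2) by (auto simp: N_def)
    then show False using l(2) b uM products(1)[OF b] by (simp flip: M.smult_assoc)
  qed
  have "u = e 0 \<odot>\<^bsub>M\<^esub> u \<oplus>\<^bsub>M\<^esub> e 1 \<odot>\<^bsub>M\<^esub> u"
    using products(12)[of 0] u S(2) by (simp flip: M.smult_l_distr)
  then have "u \<in> J" using J_add[OF eJ[of 0] eJ[of 1]] by simp
  then obtain m m' where m: "m \<in> carrier M" "m' \<in> carrier M"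
    and u_eq: "u = a 0 \<odot>\<^bsub>M\<^esub> m \<oplus>\<^bsub>M\<^esub> a 1 \<odot>\<^bsub>M\<^esub> m'"
    by (auto simp: J_def)
  have u_eq': "u = a 1 \<odot>\<^bsub>M\<^esub> m' \<oplus>\<^bsub>M\<^esub> a 0 \<odot>\<^bsub>M\<^esub> m"
    unfolding u_eq by (rule M.M.a_comm) (use m in simp_all)
  show ?thesis
  proof (rule less_2_cases[OF i])
    assume "i = 0"
    then show ?thesis using m by (intro bexI[of _ m] bexI[of _ m']) (simp_all add: u_eq)
  next
    assume "i = 1"
    then show ?thesis using m by (intro bexI[of _ m'] bexI[of _ m]) (simp_all add: u_eq')
  qed
qed

text \<open>Nakayama's lemma in its simplest case: \<open>U\<close> lies in \<open>a i\<close> times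
  \<open>M\<close>, and \<open>a i\<close> has square zero, so \<open>a i\<close> kills
  \<open>U\<close>. If \<open>U\<close> and \<open>V\<close> span \<open>M\<close>, then
  \<open>U\<close> lies in \<open>a i\<close> times \<open>M\<close>, which is \<open>a i\<close>
  times \<open>V\<close>, hence in \<open>V\<close>.\<close>

lemma superfluousI:
  assumes M: "left_module A M" and U: "submodule U A M" and i: "i < 2"
    and rad: "\<And>u. u \<in> U \<Longrightarrow> \<exists>m\<in>carrier M. u = a i \<odot>\<^bsub>M\<^esub> m"
  shows "superfluous A M U"
  unfolding superfluous_def
proof (intro conjI allI impI U)
  interpret M: left_module A M by fact
  note SU = M.submoduleD[OF U]
  fix V assume V: "submodule V A M \<and> U <+>\<^bsub>M\<^esub> V = carrier M"
  note SV = M.submoduleD[OF conjunct1[OF V]]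
  have split: "\<exists>u\<in>U. \<exists>v\<in>V. m = u \<oplus>\<^bsub>M\<^esub> v" if "m \<in> carrier M" for m
    using that V by (simp flip: mem_set_add)
  have aU: "a i \<odot>\<^bsub>M\<^esub> u = \<zero>\<^bsub>M\<^esub>" if "u \<in> U" for u
  proof -
    obtain m where m: "m \<in> carrier M" "u = a i \<odot>\<^bsub>M\<^esub> m" using rad[OF \<open>u \<in> U\<close>] by blast
    then show ?thesis using i products(9)[OF i] by (simp flip: M.smult_assoc)
  qed
  have "m \<in> V" if m: "m \<in> carrier M" for m
  proof -
    obtain u v where uv: "u \<in> U" "v \<in> V" "m = u \<oplus>\<^bsub>M\<^esub> v" using split[OF m] by blast
    obtain n where n: "n \<in> carrier M" "u = a i \<odot>\<^bsub>M\<^esub> n" using rad[OF uv(1)] by blast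
    obtain u' v' where uv': "u' \<in> U" "v' \<in> V" "n = u' \<oplus>\<^bsub>M\<^esub> v'" using split[OF n(1)] by blast
    have "u = a i \<odot>\<^bsub>M\<^esub> v'" using n uv' i aU SU(2) SV(2) by (simp add: M.smult_r_distr)
    then show ?thesis using uv uv' SV(4,5) i by simp
  qed
  then show "V = carrier M" using SV(1) by blast
qed

text \<open>
  The hypothesis on \<open>M\<close> says that the top of \<open>M\<close> is concentrated at the vertex \<open>i\<close>; then the kernel of
  a projective cover of \<open>M\<close> is concentrated at the other vertex \<open>j\<close>, so a homomorphism \<open>P1 \<rightarrow> A e\<^sub>i\<close>
  kills the radical of \<open>P1\<close> and hence extends along \<open>d1\<close> by injectivity of \<open>A e\<^sub>i\<close>.
\<close>

lemma factor_through_presentation: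
  assumes i: "i < 2" and M: "left_module A M"
    and top: "\<And>t. t \<in> carrier M \<Longrightarrow> \<exists>s\<in>carrier M. e (co i) \<odot>\<^bsub>M\<^esub> t = a i \<odot>\<^bsub>M\<^esub> s"
    and pres: "min_proj_presentation A M P1 P0 d1 d0"
    and f: "f \<in> mod_hom A P1 (P i)"
  shows "\<exists>g\<in>mod_hom A P0 (P i). \<forall>x\<in>carrier P1. f x = g (d1 x)"
proof -
  let ?\<Omega> = "a_kernel P0 M d0"
  have j: "co i < 2" by simp
  have P0: "left_module A P0" and P1: "left_module A P1" and d0: "d0 \<in> mod_hom A P0 M"
    and d0_surj: "d0 ` carrier P0 = carrier M"
    and d1: "d1 \<in> mod_hom A P1 (P0\<lparr>carrier := ?\<Omega>\<rparr>)"
    and d1_surj: "d1 ` carrier P1 = ?\<Omega>"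
    and sup0: "superfluous A P0 ?\<Omega>"
    and sup1: "superfluous A P1 (a_kernel P1 (P0\<lparr>carrier := ?\<Omega>\<rparr>) d1)"
    using pres by (auto simp: min_proj_presentation_def projective_cover_def fg_projective_def)
  interpret M: left_module A M by (rule M)
  interpret P0: left_module A P0 by (rule P0)
  interpret P1: left_module A P1 by (rule P1)
  interpret Pi: left_module A "P i" by (rule P_left_module[OF i])
  have sub: "submodule ?\<Omega> A P0" by (rule a_kernel_submodule[OF d0 P0 M])
  have \<Omega>: "left_module A (P0\<lparr>carrier := ?\<Omega>\<rparr>)" by (rule P0.submodule_left_module[OF sub])
  note S = P0.submoduleD[OF sub] and h0 = mod_homD[OF d0] and hf = mod_homD[OF f]
  have h1: "d1 x \<in> ?\<Omega>" "d1 (x \<oplus>\<^bsub>P1\<^esub> y) = d1 x \<oplus>\<^bsub>P0\<^esub> d1 y" if "x \<in> carrier P1" "y \<in> carrier P1" for x y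
    using mod_homD(1,4)[OF d1] that by auto
  have h1s: "d1 (b \<odot>\<^bsub>P1\<^esub> x) = b \<odot>\<^bsub>P0\<^esub> d1 x" if "x \<in> carrier P1" "b \<in> carrier A" for b x
    using mod_homD(5)[OF d1] that by auto
  have rad0: "\<exists>m\<in>carrier P0. \<exists>m'\<in>carrier P0. u = a i \<odot>\<^bsub>P0\<^esub> m \<oplus>\<^bsub>P0\<^esub> a (co i) \<odot>\<^bsub>P0\<^esub> m'" if "u \<in> ?\<Omega>" for u
    by (rule superfluous_subset_radical[OF P0 sup0 that i])
  have rad1: "\<exists>m\<in>carrier P1. \<exists>m'\<in>carrier P1. u = a i \<odot>\<^bsub>P1\<^esub> m \<oplus>\<^bsub>P1\<^esub> a (co i) \<odot>\<^bsub>P1\<^esub> m'"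
    if "u \<in> carrier P1" "d1 u = \<zero>\<^bsub>P0\<^esub>" for u
    by (rule superfluous_subset_radical[OF P1 sup1 _ i]) (use that in \<open>simp add: mem_a_kernel\<close>)
  \<comment> \<open>Since \<open>w\<close> is in the radical, only \<open>a (co i)\<close> times
    \<open>m'\<close> survives, and it depends only on the part of \<open>m'\<close> at vertex
    \<open>co i\<close>. By \<open>top\<close> that part differs from a multiple of
    \<open>a i\<close> by an element \<open>?v\<close> of the kernel, which is radical as well; and
    \<open>a (co i)\<close> kills the radical.\<close>
  have e\<Omega>: "e i \<odot>\<^bsub>P0\<^esub> w = \<zero>\<^bsub>P0\<^esub>" if w: "w \<in> ?\<Omega>" for w
  proof -
    obtain m m' where m: "m \<in> carrier P0" "m' \<in> carrier P0" "w = a i \<odot>\<^bsub>P0\<^esub> m \<oplus>\<^bsub>P0\<^esub> a (co i) \<odot>\<^bsub>P0\<^esub> m'"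
      using rad0[OF w] by blast
    then have 1: "e i \<odot>\<^bsub>P0\<^esub> w = a (co i) \<odot>\<^bsub>P0\<^esub> m'"
      using i j products(4,6)[OF i] by (simp add: P0.smult_r_distr flip: P0.smult_assoc)
    obtain s where s: "s \<in> carrier M" "e (co i) \<odot>\<^bsub>M\<^esub> d0 m' = a i \<odot>\<^bsub>M\<^esub> s"
      using top h0(1) m by blast
    obtain p where p: "p \<in> carrier P0" "d0 p = s" by (rule mod_hom_surjE[OF d0_surj s(1)])
    let ?v = "e (co i) \<odot>\<^bsub>P0\<^esub> m' \<oplus>\<^bsub>P0\<^esub> \<ominus>\<^bsub>P0\<^esub> (a i \<odot>\<^bsub>P0\<^esub> p)"
    have "d0 ?v = \<zero>\<^bsub>M\<^esub>"
      using i j m p s h0 mod_hom_minus[OF d0 P0 M] by (simp add: M.M.r_neg)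
    then have "?v \<in> ?\<Omega>" using m p i j by (simp add: mem_a_kernel)
    then obtain n n' where n: "n \<in> carrier P0" "n' \<in> carrier P0"
      "?v = a i \<odot>\<^bsub>P0\<^esub> n \<oplus>\<^bsub>P0\<^esub> a (co i) \<odot>\<^bsub>P0\<^esub> n'" using rad0 by blast
    have "e (co i) \<odot>\<^bsub>P0\<^esub> m' = ?v \<oplus>\<^bsub>P0\<^esub> a i \<odot>\<^bsub>P0\<^esub> p"
      using m p i j by (simp add: P0.M.a_assoc P0.M.l_neg)
    also have "\<dots> = a i \<odot>\<^bsub>P0\<^esub> n \<oplus>\<^bsub>P0\<^esub> a (co i) \<odot>\<^bsub>P0\<^esub> n' \<oplus>\<^bsub>P0\<^esub> a i \<odot>\<^bsub>P0\<^esub> p" by (simp only: n(3))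
    finally have "a (co i) \<odot>\<^bsub>P0\<^esub> (e (co i) \<odot>\<^bsub>P0\<^esub> m')
        = a (co i) \<odot>\<^bsub>P0\<^esub> (a i \<odot>\<^bsub>P0\<^esub> n \<oplus>\<^bsub>P0\<^esub> a (co i) \<odot>\<^bsub>P0\<^esub> n' \<oplus>\<^bsub>P0\<^esub> a i \<odot>\<^bsub>P0\<^esub> p)" by simp
    then have "a (co i) \<odot>\<^bsub>P0\<^esub> m' = \<zero>\<^bsub>P0\<^esub>"
      using m n(1,2) p i j products(5,8)[OF i] products(9)[OF j]
      by (simp add: P0.smult_r_distr flip: P0.smult_assoc)
    then show ?thesis using 1 by simp
  qed
  \<comment> \<open>By minimality \<open>x\<close> is radical. Moreover \<open>d1\<close> sends
    \<open>e i\<close> times \<open>p\<close> to zero by \<open>e\<Omega>\<close>, so that element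
    is radical too and \<open>a i\<close> kills it. What remains of \<open>x\<close> is a multiple
    of \<open>a (co i)\<close>, which annihilates \<open>L i\<close>.\<close>
  have kill: "f x = \<zero>\<^bsub>A\<^esub>" if x: "x \<in> carrier P1" "d1 x = \<zero>\<^bsub>P0\<^esub>" for x
  proof -
    obtain p p' where p: "p \<in> carrier P1" "p' \<in> carrier P1" "x = a i \<odot>\<^bsub>P1\<^esub> p \<oplus>\<^bsub>P1\<^esub> a (co i) \<odot>\<^bsub>P1\<^esub> p'"
      using rad1[OF x] by blast
    have "d1 (e i \<odot>\<^bsub>P1\<^esub> p) = \<zero>\<^bsub>P0\<^esub>" using e\<Omega> h1s h1(1)[OF p(1) p(1)] p i by simp
    then obtain q q' where q: "q \<in> carrier P1" "q' \<in> carrier P1"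
      "e i \<odot>\<^bsub>P1\<^esub> p = a i \<odot>\<^bsub>P1\<^esub> q \<oplus>\<^bsub>P1\<^esub> a (co i) \<odot>\<^bsub>P1\<^esub> q'" using rad1 p i by (metis P1.smult_closed ea_closed(1))
    have "a i \<odot>\<^bsub>P1\<^esub> p = a i \<odot>\<^bsub>P1\<^esub> (e i \<odot>\<^bsub>P1\<^esub> p)"
      using p i products(2)[OF i] by (simp flip: P1.smult_assoc)
    also have "\<dots> = \<zero>\<^bsub>P1\<^esub>" unfolding q(3)
      using q(1,2) i j products(7,9)[OF i] by (simp add: P1.smult_r_distr flip: P1.smult_assoc)
    finally have "x = a (co i) \<odot>\<^bsub>P1\<^esub> p'" using p i j by simp
    then have "f x = a (co i) \<otimes>\<^bsub>A\<^esub> f p'" using hf(5) p j by simp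
    moreover have "f p' \<in> L i" using hf(1) p by auto
    ultimately show ?thesis using i by (auto intro!: A_eqI[of i] simp: L_def)
  qed
  have f_eq: "f x = f y" if "x \<in> carrier P1" "y \<in> carrier P1" "d1 x = d1 y" for x y
  proof -
    have "d1 (x \<oplus>\<^bsub>P1\<^esub> \<ominus>\<^bsub>P1\<^esub> y) = \<zero>\<^bsub>P0\<^esub>"
    proof -
      have "d1 (x \<oplus>\<^bsub>P1\<^esub> \<ominus>\<^bsub>P1\<^esub> y) = d1 (y \<oplus>\<^bsub>P1\<^esub> \<ominus>\<^bsub>P1\<^esub> y)" using that by (simp add: h1(2))
      then show ?thesis using that mod_hom_zero[OF d1 P1 \<Omega>] by (simp add: P1.M.r_neg)
    qed
    then have "f (x \<oplus>\<^bsub>P1\<^esub> \<ominus>\<^bsub>P1\<^esub> y) = \<zero>\<^bsub>A\<^esub>" using kill that by simp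
    then have "f x \<oplus>\<^bsub>P i\<^esub> \<ominus>\<^bsub>P i\<^esub> f y = \<zero>\<^bsub>P i\<^esub>"
      using that hf(4) mod_hom_minus[OF f P1 Pi.left_module_axioms] by simp
    then show ?thesis using hf(1) that by (simp add: Pi.M.add.inv_solve_right' del: P_simps)
  qed
  \<comment> \<open>\<open>f\<close> descends to the image of \<open>d1\<close>, which is the whole
    kernel of \<open>d0\<close>; \<open>f_eq\<close> makes the choice of preimage immaterial. Only
    now does injectivity of \<open>P i\<close> apply.\<close>
  define f' where "f' = (\<lambda>w\<in>?\<Omega>. f (SOME x. x \<in> carrier P1 \<and> d1 x = w))"
  have f'_d1: "f' (d1 x) = f x" if x: "x \<in> carrier P1" for x
  proof -
    let ?y = "SOME y. y \<in> carrier P1 \<and> d1 y = d1 x"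
    have "?y \<in> carrier P1 \<and> d1 ?y = d1 x"
      by (rule someI[of _ x]) (use x in simp)
    then show ?thesis using f_eq[of ?y x] x h1(1)[OF x x] by (simp add: f'_def)
  qed
  have surj: "\<exists>p\<in>carrier P1. d1 p = w" if "w \<in> ?\<Omega>" for w
    using that d1_surj by (metis imageE)
  have "f' \<in> mod_hom A (P0\<lparr>carrier := ?\<Omega>\<rparr>) (P i)"
  proof (rule mod_homI)
    fix x assume "x \<in> carrier (P0\<lparr>carrier := ?\<Omega>\<rparr>)"
    then obtain p where p: "p \<in> carrier P1" "d1 p = x" using surj[of x] by auto
    show "f' x \<in> carrier (P i)" using f'_d1[OF p(1)] p hf(1) by auto
    fix b assume "b \<in> carrier A"
    then show "f' (b \<odot>\<^bsub>P0\<lparr>carrier := ?\<Omega>\<rparr>\<^esub> x) = b \<odot>\<^bsub>P i\<^esub> f' x"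
      using p h1s[of p b] hf(5)[of b p] f'_d1[of p] f'_d1[of "b \<odot>\<^bsub>P1\<^esub> p"] by simp
  next
    fix x y assume "x \<in> carrier (P0\<lparr>carrier := ?\<Omega>\<rparr>)" "y \<in> carrier (P0\<lparr>carrier := ?\<Omega>\<rparr>)"
    then obtain p q where p: "p \<in> carrier P1" "d1 p = x" "q \<in> carrier P1" "d1 q = y"
      using surj[of x] surj[of y] by auto
    then show "f' (x \<oplus>\<^bsub>P0\<lparr>carrier := ?\<Omega>\<rparr>\<^esub> y) = f' x \<oplus>\<^bsub>P i\<^esub> f' y"
      using h1(2)[of p q] hf(4)[of p q] f'_d1[of p] f'_d1[of q] f'_d1[of "p \<oplus>\<^bsub>P1\<^esub> q"] by simp
  qed (simp add: f'_def)
  from P_injective[OF i P0 sub this] obtain g where "g \<in> mod_hom A P0 (P i)" "\<forall>x\<in>?\<Omega>. g x = f' x" by blast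
  then show ?thesis using f'_d1 h1(1) by (intro bexI[of _ g]) auto
qed

section \<open>The simple modules\<close>

text \<open>The elements have the type of those of \<open>P i\<close>, since both occur in one
  family of summands. On functions supported at \<open>i\<close> the coordinatewise product is the
  action through the character \<open>x \<mapsto> x i\<close>.\<close>

definition S :: "nat \<Rightarrow> (nat \<Rightarrow> 'k, nat \<Rightarrow> 'k) module" where
  "S i = \<lparr>carrier = {x \<in> carrier A. \<forall>n. n \<noteq> i \<longrightarrow> x n = \<zero>\<^bsub>K\<^esub>}, monoid.mult = undefined, one = undefined,
     zero = \<zero>\<^bsub>A\<^esub>, add = add A, smult = (\<lambda>x s n. x n \<otimes>\<^bsub>K\<^esub> s n)\<rparr>"

lemma mem_S: "x \<in> carrier (S i) \<longleftrightarrow> x \<in> carrier A \<and> (\<forall>n. n \<noteq> i \<longrightarrow> x n = \<zero>\<^bsub>K\<^esub>)"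
  by (simp add: S_def)

lemma S_simps [simp]:
  "\<zero>\<^bsub>S i\<^esub> = \<zero>\<^bsub>A\<^esub>" "add (S i) = add A" "(x \<odot>\<^bsub>S i\<^esub> s) n = x n \<otimes>\<^bsub>K\<^esub> s n"
  by (simp_all add: S_def)

lemma S_eqI:
  assumes "x \<in> carrier (S i)" "y \<in> carrier (S i)" "x i = y i" shows "x = y"
proof
  fix n show "x n = y n" using assms by (cases "n = i") (simp_all add: mem_S)
qed

lemma S_A: "x \<in> carrier (S i) \<Longrightarrow> x \<in> carrier A"
  by (simp add: mem_S)

lemma S_closed:
  assumes "i < 2"
  shows "\<lbrakk>x \<in> carrier A; s \<in> carrier (S i)\<rbrakk> \<Longrightarrow> x \<odot>\<^bsub>S i\<^esub> s \<in> carrier (S i)"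
    and "\<lbrakk>s \<in> carrier (S i); t \<in> carrier (S i)\<rbrakk> \<Longrightarrow> s \<oplus>\<^bsub>A\<^esub> t \<in> carrier (S i)"
    and "\<zero>\<^bsub>A\<^esub> \<in> carrier (S i)" "e i \<in> carrier (S i)"
    and "k \<in> carrier K \<Longrightarrow> k \<odot>\<^bsub>A\<^esub> e i \<in> carrier (S i)"
proof -
  show "x \<odot>\<^bsub>S i\<^esub> s \<in> carrier (S i)" if x: "x \<in> carrier A" and s: "s \<in> carrier (S i)"
  proof -
    have "(x \<odot>\<^bsub>S i\<^esub> s) n \<in> carrier K" for n using x S_A[OF s] by simp
    moreover have "s n = \<zero>\<^bsub>K\<^esub>" if "n \<noteq> i" for n using s that by (simp add: mem_S)
    then have "(x \<odot>\<^bsub>S i\<^esub> s) n = \<zero>\<^bsub>K\<^esub>" if "n \<noteq> i" for n using x that by simp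
    ultimately show ?thesis unfolding mem_S mem_A using assms by auto
  qed
  show "s \<oplus>\<^bsub>A\<^esub> t \<in> carrier (S i)" if "s \<in> carrier (S i)" "t \<in> carrier (S i)"
    using that by (simp add: mem_S)
  show "\<zero>\<^bsub>A\<^esub> \<in> carrier (S i)" by (simp add: mem_S)
  show "e i \<in> carrier (S i)" using assms by (simp add: mem_S) (simp add: e_def)
  then show "k \<odot>\<^bsub>A\<^esub> e i \<in> carrier (S i)" if "k \<in> carrier K" using that by (simp add: mem_S)
qed

lemma S_left_module:
  assumes "i < 2" shows "left_module A (S i)"
proof (rule left_moduleI[OF ring], goal_cases)
  case (6 x)
  have "\<ominus>\<^bsub>A\<^esub> \<one>\<^bsub>A\<^esub> = (\<ominus>\<^bsub>K\<^esub> \<one>\<^bsub>K\<^esub>) \<odot>\<^bsub>A\<^esub> \<one>\<^bsub>A\<^esub>" by (simp add: KA.smult_l_minus)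
  then show ?case using 6 assms S_A[OF 6]
    by (intro S_eqI[of _ i]) (auto intro!: S_closed simp: K.l_minus K.l_neg)
next
  case (8 a b x)
  then show ?case using assms S_A[of x i]
    by (intro S_eqI[of _ i]) (auto intro!: S_closed simp: K.l_distr)
next
  case (9 a x y)
  then show ?case using assms S_A[of x i] S_A[of y i]
    by (intro S_eqI[of _ i]) (auto intro!: S_closed simp: K.r_distr)
next
  case (10 a b x)
  then show ?case using assms S_A[of x i]
    by (intro S_eqI[of _ i]) (auto intro!: S_closed simp: K.m_assoc)
next
  case (11 x)
  then show ?case using assms S_A[of x i]
    by (intro S_eqI[of _ i]) (auto intro!: S_closed)
qed (use assms in \<open>auto intro!: S_closed simp: A.a_ac S_A\<close>)

lemma ea_nonzero: "i < 2 \<Longrightarrow> e i \<noteq> \<zero>\<^bsub>A\<^esub>" "i < 2 \<Longrightarrow> a i \<noteq> \<zero>\<^bsub>A\<^esub>"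
proof -
  show "e i \<noteq> \<zero>\<^bsub>A\<^esub>" if "i < 2"
  proof
    assume "e i = \<zero>\<^bsub>A\<^esub>"
    then have "e i i = \<zero>\<^bsub>A\<^esub> i" by simp
    then show False using that by simp
  qed
  show "a i \<noteq> \<zero>\<^bsub>A\<^esub>" if "i < 2"
  proof
    assume "a i = \<zero>\<^bsub>A\<^esub>"
    then have "a i (ar i) = \<zero>\<^bsub>A\<^esub> (ar i)" by simp
    then show False using that by simp
  qed
qed

lemma S_simple:
  assumes i: "i < 2" shows "simple_module A (S i)"
  unfolding simple_module_def
proof (intro conjI allI impI)
  interpret left_module A "S i" by (rule S_left_module[OF i])
  show "left_module A (S i)" by (rule S_left_module[OF i])
  show "\<not> zero_module (S i)"
    using S_closed(4)[OF i] ea_nonzero(1)[OF i] by (auto simp: zero_module_def)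
  fix U assume "submodule U A (S i)"
  note U = submoduleD[OF this]
  show "U = {\<zero>\<^bsub>S i\<^esub>} \<or> U = carrier (S i)"
  proof (rule disjCI)
    assume "U \<noteq> carrier (S i)"
    have "u = \<zero>\<^bsub>A\<^esub>" if u: "u \<in> U" for u
    proof (rule ccontr)
      assume "u \<noteq> \<zero>\<^bsub>A\<^esub>"
      then have "u i \<noteq> \<zero>\<^bsub>K\<^esub>" using S_eqI[OF U(2)[OF u], of "\<zero>\<^bsub>A\<^esub>"] S_closed(3)[OF i] by auto
      then have ui: "u i \<in> Units K" using S_A[OF U(2)[OF u]] by (simp add: K.field_Units)
      have "v \<in> U" if v: "v \<in> carrier (S i)" for v
      proof -
        have c: "v i \<otimes>\<^bsub>K\<^esub> inv\<^bsub>K\<^esub> u i \<in> carrier K"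
          using K.Units_inv_closed[OF ui] S_A[OF v] by simp
        have vi: "v i \<in> carrier K" and ui': "u i \<in> carrier K" using S_A[OF v] ui by (simp_all add: K.Units_closed)
        \<comment> \<open>The module is one-dimensional: the quotient of the coordinates at
          \<open>i\<close> is the scalar that carries \<open>u\<close> to \<open>v\<close>.\<close>
        let ?w = "scalar (v i \<otimes>\<^bsub>K\<^esub> inv\<^bsub>K\<^esub> u i) \<odot>\<^bsub>S i\<^esub> u"
        have w: "?w \<in> U" using U(5)[OF _ u] c by simp
        have "?w i = v i \<otimes>\<^bsub>K\<^esub> (inv\<^bsub>K\<^esub> u i \<otimes>\<^bsub>K\<^esub> u i)"
          using i c K.m_assoc[OF vi K.Units_inv_closed[OF ui] ui'] by (simp add: vi K.Units_inv_closed[OF ui])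
        also have "\<dots> = v i" using vi K.Units_l_inv[OF ui] by simp
        finally have "v = ?w" by (intro S_eqI[OF v U(2)[OF w]]) simp
        with w show ?thesis by simp
      qed
      then show False using \<open>U \<noteq> carrier (S i)\<close> U(1) by blast
    qed
    then have "U \<subseteq> {\<zero>\<^bsub>S i\<^esub>}" by (simp add: subset_iff)
    then show "U = {\<zero>\<^bsub>S i\<^esub>}" using U(3) by (intro equalityI) simp_all
  qed
qed

text \<open>The socle of \<open>P i\<close> is simple, spanned by \<open>a i\<close>. Every nonzero
  submodule contains it, so two nonzero submodules never intersect in zero.\<close>

lemma P_indecomposable:
  assumes i: "i < 2" shows "indecomposable A (P i)"
  unfolding indecomposable_def
proof (intro conjI allI impI)
  interpret left_module A "P i" by (rule P_left_module[OF i])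
  show "left_module A (P i)" by (rule P_left_module[OF i])
  have a_L: "a i \<in> L i" using i by (simp add: L_def)
  show "\<not> zero_module (P i)" using ea_nonzero(2)[OF i] a_L by (auto simp: zero_module_def)
  have soc: "a i \<in> U" if sub: "submodule U A (P i)" and nz: "U \<noteq> {\<zero>\<^bsub>P i\<^esub>}" for U
  proof -
    note U = submoduleD[OF sub]
    obtain u where u: "u \<in> U" "u \<noteq> \<zero>\<^bsub>A\<^esub>" using U(3) nz by auto
    have uL: "u \<in> L i" and uA: "u \<in> carrier A" using U(2)[OF u(1)] L_A by auto
    have *: "a i \<in> U" if "v \<in> U" "v = c \<odot>\<^bsub>A\<^esub> a i" "c \<in> carrier K" "c \<noteq> \<zero>\<^bsub>K\<^esub>" for v c
    proof -
      have c: "c \<in> Units K" using that by (simp add: K.field_Units)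
      have "scalar (inv\<^bsub>K\<^esub> c) \<otimes>\<^bsub>A\<^esub> v \<in> U" using U(5)[OF _ that(1)] c scalar(1) by simp
      moreover have "scalar (inv\<^bsub>K\<^esub> c) \<otimes>\<^bsub>A\<^esub> v = a i"
        using c that(2,3) i scalar(2) by (simp flip: KA.smult_assoc1)
      ultimately show ?thesis by simp
    qed
    show ?thesis
    \<comment> \<open>If the coordinate of \<open>u\<close> at \<open>e i\<close> is nonzero,
      multiplying by \<open>a i\<close> moves it to the socle; otherwise \<open>u\<close> is a
      multiple of \<open>a i\<close> already.\<close>
    proof (cases "u i = \<zero>\<^bsub>K\<^esub>")
      case False
      have "a i \<otimes>\<^bsub>A\<^esub> u \<in> U" using U(5)[OF _ u(1)] i by simp
      then show ?thesis using *[OF _ left_mult(1)[OF i uA]] False uA by simp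
    next
      case True
      have "u = u (ar i) \<odot>\<^bsub>A\<^esub> a i"
        using True uL uA i by (intro A_eqI[of i]) (auto simp: L_def)
      moreover have "u (ar i) \<noteq> \<zero>\<^bsub>K\<^esub>"
      proof
        assume "u (ar i) = \<zero>\<^bsub>K\<^esub>"
        then have "u = \<zero>\<^bsub>A\<^esub>" using True uL uA i by (intro A_eqI[of i]) (auto simp: L_def)
        then show False using u(2) by simp
      qed
      ultimately show ?thesis using *[OF u(1)] uA by simp
    qed
  qed
  fix U V assume UV: "internal_dir_sum A (P i) U V"
  show "U = {\<zero>\<^bsub>P i\<^esub>} \<or> V = {\<zero>\<^bsub>P i\<^esub>}"
  proof (rule ccontr)
    assume "\<not> ?thesis"
    moreover have "submodule U A (P i)" "submodule V A (P i)" using UV by (simp_all add: internal_dir_sum_def)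
    ultimately have "a i \<in> U" "a i \<in> V" using soc by simp_all
    moreover have "U \<inter> V = {\<zero>\<^bsub>A\<^esub>}" using UV by (simp add: internal_dir_sum_def)
    ultimately show False using ea_nonzero(2)[OF i] by blast
  qed
qed

section \<open>The modules \<open>P i \<oplus> S i\<close>\<close>

definition summand :: "nat \<Rightarrow> nat \<Rightarrow> (nat \<Rightarrow> 'k, nat \<Rightarrow> 'k) module" where
  "summand i k = (if k = 1 then P i else S i)"

definition T :: "nat \<Rightarrow> (nat \<Rightarrow> 'k, nat \<Rightarrow> nat \<Rightarrow> 'k) module" where
  "T i = dir_sum {1..2} (summand i)"

definition pair :: "(nat \<Rightarrow> 'k) \<Rightarrow> (nat \<Rightarrow> 'k) \<Rightarrow> nat \<Rightarrow> nat \<Rightarrow> 'k" where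
  "pair x s = (\<lambda>k\<in>{1..2}. if k = 1 then x else s)"

lemma summand_left_module: "i < 2 \<Longrightarrow> left_module A (summand i k)"
  by (simp add: summand_def P_left_module S_left_module)

lemma summand_indecomposable: "i < 2 \<Longrightarrow> indecomposable A (summand i k)"
  by (simp add: summand_def P_indecomposable S_simple simple_imp_indecomposable)

lemma T_left_module: "i < 2 \<Longrightarrow> left_module A (T i)"
  unfolding T_def by (intro dir_sum_left_module ring summand_left_module)

lemma pair_T [simp]: "pair x s \<in> carrier (T i) \<longleftrightarrow> x \<in> L i \<and> s \<in> carrier (S i)"
proof -
  have "{1..2::nat} = {1, 2}" by auto
  then show ?thesis unfolding T_def dir_sum_simps pair_def restrict_PiE_iff by (simp add: summand_def)
qed

lemma T_cases:
  assumes "t \<in> carrier (T i)"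
  obtains x s where "x \<in> L i" "s \<in> carrier (S i)" "t = pair x s"
proof
  have t: "t k \<in> carrier (summand i k)" if "k \<in> {1..2}" for k
    using assms that unfolding T_def dir_sum_simps by (rule PiE_mem)
  show "t 1 \<in> L i" using t[of 1] by (simp add: summand_def)
  show "t 2 \<in> carrier (S i)" using t[of 2] by (simp add: summand_def)
  show "t = pair (t 1) (t 2)"
  proof
    fix k :: nat
    have "k = 1 \<or> k = 2 \<or> k \<notin> {1..2}" by auto
    then show "t k = pair (t 1) (t 2) k"
      using PiE_arb[OF assms[unfolded T_def dir_sum_simps], of k] by (auto simp: pair_def)
  qed
qed

lemma pair_ops [simp]:
  "pair x s \<oplus>\<^bsub>T i\<^esub> pair y t = pair (x \<oplus>\<^bsub>A\<^esub> y) (s \<oplus>\<^bsub>A\<^esub> t)"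
  "b \<odot>\<^bsub>T i\<^esub> pair x s = pair (b \<otimes>\<^bsub>A\<^esub> x) (b \<odot>\<^bsub>S i\<^esub> s)"
  "\<zero>\<^bsub>T i\<^esub> = pair \<zero>\<^bsub>A\<^esub> \<zero>\<^bsub>A\<^esub>"
  by (auto simp: T_def pair_def summand_def intro!: restrict_ext)

lemma pair_eq_iff [simp]: "pair x s = pair y t \<longleftrightarrow> x = y \<and> s = t"
proof
  assume eq: "pair x s = pair y t"
  have "pair x s 1 = pair y t 1" "pair x s 2 = pair y t 2" by (simp_all only: eq)
  then show "x = y \<and> s = t" by (simp add: pair_def)
qed simp

lemma smult_S:
  assumes "i < 2"
  shows "b \<in> carrier A \<Longrightarrow> b \<odot>\<^bsub>S i\<^esub> \<zero>\<^bsub>A\<^esub> = \<zero>\<^bsub>A\<^esub>"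
    and "b \<in> carrier A \<Longrightarrow> b \<odot>\<^bsub>S i\<^esub> e i = b i \<odot>\<^bsub>A\<^esub> e i"
    and "s \<in> carrier (S i) \<Longrightarrow> s \<odot>\<^bsub>S i\<^esub> e i = s"
    and "s \<in> carrier (S i) \<Longrightarrow> e (co i) \<odot>\<^bsub>S i\<^esub> s = \<zero>\<^bsub>A\<^esub>"
    and "\<lbrakk>k < 2; s \<in> carrier (S i)\<rbrakk> \<Longrightarrow> a k \<odot>\<^bsub>S i\<^esub> s = \<zero>\<^bsub>A\<^esub>"
    and "\<lbrakk>c \<in> carrier K; s \<in> carrier (S i)\<rbrakk> \<Longrightarrow> scalar c \<odot>\<^bsub>S i\<^esub> s = c \<odot>\<^bsub>A\<^esub> s"
proof -
  show "b \<odot>\<^bsub>S i\<^esub> \<zero>\<^bsub>A\<^esub> = \<zero>\<^bsub>A\<^esub>" if "b \<in> carrier A" using that by (simp add: fun_eq_iff)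
  show "b \<odot>\<^bsub>S i\<^esub> e i = b i \<odot>\<^bsub>A\<^esub> e i" if "b \<in> carrier A" using that by (auto simp: fun_eq_iff e_def)
  show "s \<odot>\<^bsub>S i\<^esub> e i = s" if "s \<in> carrier (S i)"
    using assms that S_A[OF that] by (intro S_eqI[of _ i]) (auto intro!: S_closed)
  show "e (co i) \<odot>\<^bsub>S i\<^esub> s = \<zero>\<^bsub>A\<^esub>" if "s \<in> carrier (S i)"
    using assms that S_A[OF that] by (intro S_eqI[of _ i]) (auto intro!: S_closed)
  show "a k \<odot>\<^bsub>S i\<^esub> s = \<zero>\<^bsub>A\<^esub>" if "k < 2" "s \<in> carrier (S i)"
  proof (rule S_eqI[of _ i])
    have "a k i = \<zero>\<^bsub>K\<^esub>" using assms(1) by (simp add: a_def ar_def)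
    then show "(a k \<odot>\<^bsub>S i\<^esub> s) i = \<zero>\<^bsub>A\<^esub> i" using S_A[OF that(2)] by simp
  qed (use assms that in \<open>auto intro!: S_closed\<close>)
  show "scalar c \<odot>\<^bsub>S i\<^esub> s = c \<odot>\<^bsub>A\<^esub> s" if "c \<in> carrier K" "s \<in> carrier (S i)"
  proof (rule S_eqI[of _ i])
    show "c \<odot>\<^bsub>A\<^esub> s \<in> carrier (S i)" using that by (simp add: mem_S)
    show "scalar c \<odot>\<^bsub>S i\<^esub> s \<in> carrier (S i)" by (rule S_closed(1)) (use assms that in simp_all)
    show "(scalar c \<odot>\<^bsub>S i\<^esub> s) i = (c \<odot>\<^bsub>A\<^esub> s) i" using assms that by simp
  qed
qed

lemma L_decomp:
  assumes "i < 2" "x \<in> L i" shows "x = x i \<odot>\<^bsub>A\<^esub> e i \<oplus>\<^bsub>A\<^esub> x (ar i) \<odot>\<^bsub>A\<^esub> a i"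
  using assms by (intro A_eqI[of i]) (auto simp: L_def)

lemma S_decomp:
  assumes "i < 2" "s \<in> carrier (S i)" shows "s = s i \<odot>\<^bsub>A\<^esub> e i"
  using assms S_A[OF assms(2)] by (intro S_eqI[of _ i]) (auto intro!: S_closed)

lemma a_L: "i < 2 \<Longrightarrow> a i \<in> L i" by (simp add: L_def)

lemma L_zero: "\<zero>\<^bsub>A\<^esub> \<in> L i" by (simp add: L_def)

lemma L_smult: "\<lbrakk>k \<in> carrier K; x \<in> L i\<rbrakk> \<Longrightarrow> k \<odot>\<^bsub>A\<^esub> x \<in> L i" by (simp add: L_def)

section \<open>Finite dimensionality of the modules involved\<close>

lemma P_fd_module:
  assumes i: "i < 2" shows "fd_module K A (P i)"
  unfolding fd_module_def finite_dim_def
proof (intro conjI exI allI impI)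
  interpret V: left_module K "restrict_scalars A (P i)"
    by (rule restrict_scalars_left_module[OF P_left_module[OF i]])
  show "left_module A (P i)" by (rule P_left_module[OF i])
  show "finite {e i, a i}" by simp
  show "{e i, a i} \<subseteq> carrier (restrict_scalars A (P i))" using i e_L a_L by simp
  fix W assume W: "submodule W K (restrict_scalars A (P i)) \<and> {e i, a i} \<subseteq> W"
  note U = V.submoduleD[OF conjunct1[OF W]]
  have "x \<in> W" if x: "x \<in> L i" for x
  proof -
    have xA: "x \<in> carrier A" using x L_A by simp
    have "x i \<odot>\<^bsub>A\<^esub> e i \<in> W" "x (ar i) \<odot>\<^bsub>A\<^esub> a i \<in> W"
      using U(5)[of "x i" "e i"] U(5)[of "x (ar i)" "a i"] W i xA scalar(2) by simp_all
    then have "x i \<odot>\<^bsub>A\<^esub> e i \<oplus>\<^bsub>A\<^esub> x (ar i) \<odot>\<^bsub>A\<^esub> a i \<in> W" using U(4) by fastforce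
    then show ?thesis using L_decomp[OF i x] by simp
  qed
  then show "W = carrier (restrict_scalars A (P i))" using U(1) by auto
qed

lemma S_fd_module:
  assumes i: "i < 2" shows "fd_module K A (S i)"
  unfolding fd_module_def finite_dim_def
proof (intro conjI exI allI impI)
  interpret V: left_module K "restrict_scalars A (S i)"
    by (rule restrict_scalars_left_module[OF S_left_module[OF i]])
  show "left_module A (S i)" by (rule S_left_module[OF i])
  show "finite {e i}" by simp
  show "{e i} \<subseteq> carrier (restrict_scalars A (S i))" using i S_closed(4) by simp
  fix W assume W: "submodule W K (restrict_scalars A (S i)) \<and> {e i} \<subseteq> W"
  note U = V.submoduleD[OF conjunct1[OF W]]
  have "s \<in> W" if s: "s \<in> carrier (S i)" for s
  proof -
    have "s i \<odot>\<^bsub>A\<^esub> e i \<in> W"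
      using U(5)[of "s i" "e i"] W i S_A[OF s] smult_S(6)[OF i _ S_closed(4)[OF i]] by simp
    then show ?thesis using S_decomp[OF i s] by simp
  qed
  then show "W = carrier (restrict_scalars A (S i))" using U(1) by auto
qed

lemma T_fd_module:
  assumes i: "i < 2" shows "fd_module K A (T i)"
  unfolding fd_module_def finite_dim_def
proof (intro conjI exI allI impI)
  let ?z = "\<zero>\<^bsub>A\<^esub>"
  interpret V: left_module K "restrict_scalars A (T i)"
    by (rule restrict_scalars_left_module[OF T_left_module[OF i]])
  show "left_module A (T i)" by (rule T_left_module[OF i])
  let ?G = "{pair (e i) ?z, pair (a i) ?z, pair ?z (e i)}"
  show "finite ?G" by simp
  show "?G \<subseteq> carrier (restrict_scalars A (T i))"
    using i e_L a_L L_zero S_closed(3,4)[OF i] by simp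
  fix W assume W: "submodule W K (restrict_scalars A (T i)) \<and> ?G \<subseteq> W"
  note U = V.submoduleD[OF conjunct1[OF W]]
  have "t \<in> W" if t: "t \<in> carrier (T i)" for t
  proof -
    obtain x s where x: "x \<in> L i" and s: "s \<in> carrier (S i)" and t_eq: "t = pair x s"
      using T_cases[OF t] .
    have xA: "x \<in> carrier A" using x L_A by simp
    have sA: "s \<in> carrier A" using s S_A by simp
    have "pair (x i \<odot>\<^bsub>A\<^esub> e i) ?z \<in> W" "pair (x (ar i) \<odot>\<^bsub>A\<^esub> a i) ?z \<in> W"
      using U(5)[of "x i" "pair (e i) ?z"] U(5)[of "x (ar i)" "pair (a i) ?z"] W i xA scalar(1,2)
        smult_S(1)[OF i] by simp_all
    moreover have "pair ?z (s i \<odot>\<^bsub>A\<^esub> e i) \<in> W"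
      using U(5)[of "s i" "pair ?z (e i)"] W i sA scalar(1)[of "s i"] smult_S(6)[OF i _ S_closed(4)[OF i]] by simp
    ultimately have "pair (x i \<odot>\<^bsub>A\<^esub> e i) ?z \<oplus>\<^bsub>T i\<^esub> pair (x (ar i) \<odot>\<^bsub>A\<^esub> a i) ?z \<oplus>\<^bsub>T i\<^esub> pair ?z (s i \<odot>\<^bsub>A\<^esub> e i) \<in> W"
      using U(4) by (simp del: pair_ops)
    moreover have "pair (x i \<odot>\<^bsub>A\<^esub> e i) ?z \<oplus>\<^bsub>T i\<^esub> pair (x (ar i) \<odot>\<^bsub>A\<^esub> a i) ?z \<oplus>\<^bsub>T i\<^esub> pair ?z (s i \<odot>\<^bsub>A\<^esub> e i) = t"
      using i xA sA t_eq L_decomp[OF i x, symmetric] S_decomp[OF i s, symmetric] by simp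
    ultimately show ?thesis by simp
  qed
  then show "W = carrier (restrict_scalars A (T i))" using U(1) by auto
qed

section \<open>The projective presentation of \<open>P i \<oplus> S i\<close>\<close>

text \<open>The power of \<open>P i\<close> with \<open>r\<close> factors, realised inside the free
  module because presentations are required to have that element type.\<close>

definition PF :: "nat \<Rightarrow> nat \<Rightarrow> (nat \<Rightarrow> 'k, nat \<Rightarrow> nat \<Rightarrow> 'k) module" where
  "PF r i = free_module A r\<lparr>carrier := (\<Pi>\<^sub>E k\<in>{..<r}. L i)\<rparr>"

lemma free_simps [simp]:
  "carrier (free_module A r) = (\<Pi>\<^sub>E k\<in>{..<r}. carrier A)"
  "\<zero>\<^bsub>free_module A r\<^esub> = (\<lambda>k\<in>{..<r}. \<zero>\<^bsub>A\<^esub>)"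
  "f \<oplus>\<^bsub>free_module A r\<^esub> g = (\<lambda>k\<in>{..<r}. f k \<oplus>\<^bsub>A\<^esub> g k)"
  "b \<odot>\<^bsub>free_module A r\<^esub> f = (\<lambda>k\<in>{..<r}. b \<otimes>\<^bsub>A\<^esub> f k)"
  by (simp_all add: free_module_def)

lemma PF_simps [simp]:
  "carrier (PF r i) = (\<Pi>\<^sub>E k\<in>{..<r}. L i)" "\<zero>\<^bsub>PF r i\<^esub> = (\<lambda>k\<in>{..<r}. \<zero>\<^bsub>A\<^esub>)"
  "f \<oplus>\<^bsub>PF r i\<^esub> g = (\<lambda>k\<in>{..<r}. f k \<oplus>\<^bsub>A\<^esub> g k)" "b \<odot>\<^bsub>PF r i\<^esub> f = (\<lambda>k\<in>{..<r}. b \<otimes>\<^bsub>A\<^esub> f k)"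
  by (simp_all add: PF_def)

lemma L_add: "\<lbrakk>x \<in> L i; y \<in> L i\<rbrakk> \<Longrightarrow> x \<oplus>\<^bsub>A\<^esub> y \<in> L i" by (simp add: L_def)

lemma PF_submodule:
  assumes "i < 2" shows "submodule (\<Pi>\<^sub>E k\<in>{..<r}. L i) A (free_module A r)"
proof (rule left_module.submoduleI[OF free_left_module[OF ring]])
  show "(\<Pi>\<^sub>E k\<in>{..<r}. L i) \<subseteq> carrier (free_module A r)" using L_A by (auto simp: PiE_iff)
qed (use assms in \<open>auto simp: L_zero L_add L_mult PiE_iff\<close>)

lemma PF_left_module: "i < 2 \<Longrightarrow> left_module A (PF r i)"
  unfolding PF_def
  by (rule left_module.submodule_left_module[OF free_left_module[OF ring] PF_submodule])

text \<open>The complement in the free module is the corresponding power of \<open>L (co i)\<close>: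
  each entry splits by right multiplication with the two idempotents, whose sum is one.\<close>

lemma PF_fg_projective:
  assumes i: "i < 2" shows "fg_projective A (PF r i)"
proof -
  let ?F = "free_module A r"
  let ?U = "\<Pi>\<^sub>E k\<in>{..<r}. L i" and ?V = "\<Pi>\<^sub>E k\<in>{..<r}. L (co i)"
  interpret F: left_module A ?F by (rule free_left_module[OF ring])
  have "internal_dir_sum A ?F ?U ?V" unfolding internal_dir_sum_def
  proof (intro conjI)
    show "submodule ?U A ?F" "submodule ?V A ?F" using i by (simp_all add: PF_submodule)
    show "?U <+>\<^bsub>?F\<^esub> ?V = carrier ?F"
    proof (intro equalityI subsetI)
      fix f assume "f \<in> ?U <+>\<^bsub>?F\<^esub> ?V"
      then obtain u v where "u \<in> ?U" "v \<in> ?V" "f = u \<oplus>\<^bsub>?F\<^esub> v" by (auto simp: mem_set_add)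
      moreover from this(1,2) have "u \<in> carrier ?F" "v \<in> carrier ?F"
        using F.submoduleD(2)[OF PF_submodule[OF i]] F.submoduleD(2)[OF PF_submodule[OF co(1)]] by blast+
      ultimately show "f \<in> carrier ?F" by (simp only: F.M.a_closed)
    next
      fix f assume f: "f \<in> carrier ?F"
      have fk: "f k \<in> carrier A" if "k < r" for k using f that by (auto simp: PiE_iff)
      let ?u = "\<lambda>k\<in>{..<r}. f k \<otimes>\<^bsub>A\<^esub> e i" and ?v = "\<lambda>k\<in>{..<r}. f k \<otimes>\<^bsub>A\<^esub> e (co i)"
      have "?u \<in> ?U" "?v \<in> ?V"
        using fk e_L[OF i] e_L[OF co(1)] L_mult[OF i] L_mult[OF co(1)] by (auto simp: PiE_iff)
      moreover have "f = ?u \<oplus>\<^bsub>?F\<^esub> ?v"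
      proof
        fix k
        show "f k = (?u \<oplus>\<^bsub>?F\<^esub> ?v) k"
        proof (cases "k < r")
          case True
          then show ?thesis
            using fk[OF True] i products(12)[OF i] by (simp flip: A.r_distr)
        next
          case False
          then show ?thesis using f by (simp add: PiE_iff extensional_def)
        qed
      qed
      ultimately show "f \<in> ?U <+>\<^bsub>?F\<^esub> ?V" unfolding mem_set_add by blast
    qed
    show "?U \<inter> ?V = {\<zero>\<^bsub>?F\<^esub>}"
    proof (intro equalityI subsetI)
      fix f assume f: "f \<in> ?U \<inter> ?V"
      have "f k = \<zero>\<^bsub>A\<^esub>" if "k < r" for k
      proof -
        have "f k \<in> L i" "f k \<in> L (co i)" using f that by (auto simp: PiE_iff)
        then show ?thesis using i by (intro A_eqI[of i]) (auto simp: L_def)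
      qed
      then show "f \<in> {\<zero>\<^bsub>?F\<^esub>}" using f by (auto simp: PiE_iff extensional_def fun_eq_iff)
    qed (auto simp: L_zero PiE_iff)
  qed
  moreover have "mod_iso A (PF r i) (?F\<lparr>carrier := ?U\<rparr>)"
    using mod_iso_refl[OF PF_left_module[OF i]] by (simp add: PF_def)
  ultimately show ?thesis
    unfolding fg_projective_def using PF_left_module[OF i] by blast
qed

text \<open>Entries in \<open>L i\<close> without an \<open>e i\<close> coordinate are multiples of
  \<open>a i\<close>, so the hypothesis says that \<open>U\<close> lies in the radical.\<close>

lemma PF_superfluous:
  assumes i: "i < 2" and U: "submodule U A (PF r i)" and 0: "\<And>f k. \<lbrakk>f \<in> U; k < r\<rbrakk> \<Longrightarrow> f k i = \<zero>\<^bsub>K\<^esub>"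
  shows "superfluous A (PF r i) U"
proof (rule superfluousI[OF PF_left_module[OF i] U i])
  fix f assume f: "f \<in> U"
  then have fF: "f \<in> carrier (PF r i)"
    using left_module.submoduleD(2)[OF PF_left_module[OF i] U] by blast
  have fk: "f k \<in> L i" "f k \<in> carrier A" if "k < r" for k using fF that L_A by (auto simp: PiE_iff)
  show "\<exists>m\<in>carrier (PF r i). f = a i \<odot>\<^bsub>PF r i\<^esub> m"
  proof (intro bexI)
    let ?m = "\<lambda>k\<in>{..<r}. f k (ar i) \<odot>\<^bsub>A\<^esub> e i"
    show "?m \<in> carrier (PF r i)" using fk e_L[OF i] L_smult by (auto simp: PiE_iff)
    show "f = a i \<odot>\<^bsub>PF r i\<^esub> ?m"
    proof
      fix k
      show "f k = (a i \<odot>\<^bsub>PF r i\<^esub> ?m) k"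
      proof (cases "k < r")
        case True
        have "f k = a i \<otimes>\<^bsub>A\<^esub> (f k (ar i) \<odot>\<^bsub>A\<^esub> e i)"
          using i fk[OF True] 0[OF f True] by (intro A_eqI[of i]) (auto simp: L_def)
        then show ?thesis using True by simp
      next
        case False
        then show ?thesis using fF by (simp add: PiE_iff extensional_def)
      qed
    qed
  qed
qed

text \<open>The identity of the first copy of \<open>P i\<close> together with the projection of the
  second one to its top \<open>S i\<close>. The kernel is the socle of the second copy.\<close>

definition cover :: "nat \<Rightarrow> (nat \<Rightarrow> nat \<Rightarrow> 'k) \<Rightarrow> nat \<Rightarrow> nat \<Rightarrow> 'k" where
  "cover i = (\<lambda>f\<in>carrier (PF 2 i). pair (f 0) (f 1 i \<odot>\<^bsub>A\<^esub> e i))"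

text \<open>Right multiplication by \<open>a i\<close> maps \<open>A e_j\<close>, for
  \<open>j = co i\<close>, onto the line spanned by \<open>a i\<close>, the socle of
  \<open>P i\<close>. So the kernel of \<open>cover i\<close> is the simple module at the other
  vertex and has \<open>P (co i)\<close> as its cover.\<close>

definition syzygy_cover :: "nat \<Rightarrow> (nat \<Rightarrow> nat \<Rightarrow> 'k) \<Rightarrow> nat \<Rightarrow> nat \<Rightarrow> 'k" where
  "syzygy_cover i = (\<lambda>f\<in>carrier (PF 1 (co i)). \<lambda>k\<in>{..<2}. if k = 1 then f 0 \<otimes>\<^bsub>A\<^esub> a i else \<zero>\<^bsub>A\<^esub>)"

lemma PF_mem: "\<lbrakk>f \<in> carrier (PF r i); k < r\<rbrakk> \<Longrightarrow> f k \<in> L i"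
  by (auto simp: PiE_iff)

lemma cover_hom:
  assumes i: "i < 2" shows "cover i \<in> mod_hom A (PF 2 i) (T i)"
proof (rule mod_homI)
  interpret F: left_module A "PF 2 i" by (rule PF_left_module[OF i])
  fix f assume f: "f \<in> carrier (PF 2 i)"
  have f01: "f 0 \<in> L i" "f 1 \<in> L i" "f 1 \<in> carrier A" using PF_mem[OF f] L_A[where i = i] by auto
  show "cover i f \<in> carrier (T i)" using f f01 i S_closed(5)[OF i] by (simp add: cover_def del: PF_simps)
  {
    fix b assume b: "b \<in> carrier A"
    have "b \<odot>\<^bsub>PF 2 i\<^esub> f \<in> carrier (PF 2 i)" using b f by (rule F.smult_closed)
    moreover have "(b i \<otimes>\<^bsub>K\<^esub> f 1 i) \<odot>\<^bsub>A\<^esub> e i = b \<odot>\<^bsub>S i\<^esub> (f 1 i \<odot>\<^bsub>A\<^esub> e i)"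
      using b f01(3) i by (intro S_eqI[of _ i]) (auto intro!: S_closed)
    ultimately show "cover i (b \<odot>\<^bsub>PF 2 i\<^esub> f) = b \<odot>\<^bsub>T i\<^esub> cover i f"
      using f i by (simp add: cover_def del: PF_simps(1))
  next
    fix g assume g: "g \<in> carrier (PF 2 i)"
    have "g 1 \<in> carrier A" using PF_mem[OF g] L_A[where i = i] by auto
    moreover have "f \<oplus>\<^bsub>PF 2 i\<^esub> g \<in> carrier (PF 2 i)" using f g by (rule F.M.a_closed)
    ultimately show "cover i (f \<oplus>\<^bsub>PF 2 i\<^esub> g) = cover i f \<oplus>\<^bsub>T i\<^esub> cover i g"
      using f g f01 i by (simp add: cover_def KA.smult_l_distr del: PF_simps(1))
  }
qed (simp add: cover_def)

lemma cover_kernel: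
  assumes i: "i < 2"
  shows "f \<in> a_kernel (PF 2 i) (T i) (cover i) \<longleftrightarrow> f \<in> carrier (PF 2 i) \<and> f 0 = \<zero>\<^bsub>A\<^esub> \<and> f 1 i = \<zero>\<^bsub>K\<^esub>"
proof -
  have "c \<odot>\<^bsub>A\<^esub> e i = \<zero>\<^bsub>A\<^esub> \<longleftrightarrow> c = \<zero>\<^bsub>K\<^esub>" if "c \<in> carrier K" for c
  proof
    assume "c \<odot>\<^bsub>A\<^esub> e i = \<zero>\<^bsub>A\<^esub>"
    then have "(c \<odot>\<^bsub>A\<^esub> e i) i = \<zero>\<^bsub>A\<^esub> i" by simp
    then show "c = \<zero>\<^bsub>K\<^esub>" using i that by simp
  qed (use i in simp)
  moreover have "f 1 i \<in> carrier K" if "f \<in> carrier (PF 2 i)" using PF_mem[OF that, of 1] L_A by simp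
  ultimately show ?thesis by (auto simp: mem_a_kernel cover_def simp del: PF_simps(1))
qed

lemma syzygy_cover_hom:
  assumes i: "i < 2"
  shows "syzygy_cover i \<in> mod_hom A (PF 1 (co i))
    (PF 2 i\<lparr>carrier := a_kernel (PF 2 i) (T i) (cover i)\<rparr>)"
proof (rule mod_homI)
  interpret F: left_module A "PF 1 (co i)" by (rule PF_left_module[OF co(1)])
  fix f assume f: "f \<in> carrier (PF 1 (co i))"
  have f0: "f 0 \<in> carrier A" using PF_mem[OF f] L_A[where i = "co i"] by auto
  have "f 0 \<otimes>\<^bsub>A\<^esub> a i \<in> L i" using f0 i a_L L_mult by simp
  then show "syzygy_cover i f \<in> carrier (PF 2 i\<lparr>carrier := a_kernel (PF 2 i) (T i) (cover i)\<rparr>)"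
    using f f0 i by (auto simp: cover_kernel syzygy_cover_def L_zero simp del: PF_simps(1)) (auto simp: L_zero)
  {
    fix b assume b: "b \<in> carrier A"
    have "b \<odot>\<^bsub>PF 1 (co i)\<^esub> f \<in> carrier (PF 1 (co i))" using b f by (rule F.smult_closed)
    then show "syzygy_cover i (b \<odot>\<^bsub>PF 1 (co i)\<^esub> f)
        = b \<odot>\<^bsub>PF 2 i\<lparr>carrier := a_kernel (PF 2 i) (T i) (cover i)\<rparr>\<^esub> syzygy_cover i f"
      using f b f0 i by (auto simp: syzygy_cover_def A.m_assoc intro!: restrict_ext simp del: PF_simps(1))
  next
    fix g assume g: "g \<in> carrier (PF 1 (co i))"
    have "g 0 \<in> carrier A" using PF_mem[OF g] L_A by auto
    moreover have "f \<oplus>\<^bsub>PF 1 (co i)\<^esub> g \<in> carrier (PF 1 (co i))" using f g by (rule F.M.a_closed)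
    ultimately show "syzygy_cover i (f \<oplus>\<^bsub>PF 1 (co i)\<^esub> g)
        = syzygy_cover i f \<oplus>\<^bsub>PF 2 i\<lparr>carrier := a_kernel (PF 2 i) (T i) (cover i)\<rparr>\<^esub> syzygy_cover i g"
      using f g f0 i by (auto simp: syzygy_cover_def A.l_distr intro!: restrict_ext simp del: PF_simps(1))
  }
qed (simp add: syzygy_cover_def)

text \<open>Shows that the choice made by \<open>SOME\<close> in \<open>AR_translate\<close> is a
  genuine minimal presentation; rigidity is then derived for whichever one is chosen.\<close>

lemma presentation:
  assumes i: "i < 2"
  shows "min_proj_presentation A (T i) (PF 1 (co i)) (PF 2 i) (syzygy_cover i) (cover i)"
  unfolding min_proj_presentation_def projective_cover_def
proof (intro conjI)
  let ?\<Omega> = "a_kernel (PF 2 i) (T i) (cover i)"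
  let ?P\<Omega> = "PF 2 i\<lparr>carrier := ?\<Omega>\<rparr>"
  note T = T_left_module[OF i] and F2 = PF_left_module[OF i, of 2] and F1 = PF_left_module[OF co(1), of 1 i]
  have sub: "submodule ?\<Omega> A (PF 2 i)" by (rule a_kernel_submodule[OF cover_hom[OF i] F2 T])
  have \<Omega>: "left_module A ?P\<Omega>" by (rule left_module.submodule_left_module[OF F2 sub])
  show "fg_projective A (PF 2 i)" "fg_projective A (PF 1 (co i))" using i by (simp_all add: PF_fg_projective)
  show "cover i \<in> mod_hom A (PF 2 i) (T i)" by (rule cover_hom[OF i])
  show "syzygy_cover i \<in> mod_hom A (PF 1 (co i)) ?P\<Omega>" by (rule syzygy_cover_hom[OF i])
  show "cover i ` carrier (PF 2 i) = carrier (T i)"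
  proof (intro equalityI subsetI)
    fix t assume "t \<in> carrier (T i)"
    then obtain x s where x: "x \<in> L i" and s: "s \<in> carrier (S i)" and t_eq: "t = pair x s"
      by (rule T_cases)
    let ?f = "\<lambda>k\<in>{..<2}. if k = 0 then x else s i \<odot>\<^bsub>A\<^esub> e i"
    have f: "?f \<in> carrier (PF 2 i)" using x s S_A e_L[OF i] L_smult by (auto simp: PiE_iff)
    have "cover i ?f = t"
      using f i S_A[OF s] by (simp add: cover_def t_eq flip: S_decomp[OF i s] del: PF_simps(1))
    then show "t \<in> cover i ` carrier (PF 2 i)" using f by blast
  qed (use mod_homD(1)[OF cover_hom[OF i]] in blast)
  show "syzygy_cover i ` carrier (PF 1 (co i)) = carrier ?P\<Omega>"
  proof (intro equalityI subsetI)
    fix f assume "f \<in> carrier ?P\<Omega>"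
    then have f: "f \<in> carrier (PF 2 i)" "f 0 = \<zero>\<^bsub>A\<^esub>" "f 1 i = \<zero>\<^bsub>K\<^esub>" by (simp_all add: cover_kernel[OF i] del: PF_simps(1))
    have f1: "f 1 \<in> L i" "f 1 \<in> carrier A" using PF_mem[OF f(1)] L_A[where i = i] by auto
    \<comment> \<open>Without an \<open>e i\<close> coordinate, \<open>f 1\<close> is its coordinate
      at \<open>ar i\<close> times \<open>a i\<close>, and \<open>a i\<close> is
      \<open>e (co i)\<close> multiplied by \<open>a i\<close>.\<close>
    let ?g = "\<lambda>k\<in>{..<1::nat}. f 1 (ar i) \<odot>\<^bsub>A\<^esub> e (co i)"
    have g: "?g \<in> carrier (PF 1 (co i))" using f1 e_L[OF co(1)] L_smult by (auto simp: PiE_iff)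
    have "(f 1 (ar i) \<odot>\<^bsub>A\<^esub> e (co i)) \<otimes>\<^bsub>A\<^esub> a i = f 1"
      using i f1 f(3) by (intro A_eqI[of i]) (auto simp: L_def)
    then have "syzygy_cover i ?g k = f k" for k
      using g f(1,2) by (cases "k = 0 \<or> k = 1") (auto simp: syzygy_cover_def PiE_iff extensional_def)
    then have "syzygy_cover i ?g = f" by auto
    then show "f \<in> syzygy_cover i ` carrier (PF 1 (co i))" using g by (intro image_eqI[OF sym])
  qed (use mod_homD(1)[OF syzygy_cover_hom[OF i]] in blast)
  show "superfluous A (PF 2 i) ?\<Omega>"
  proof (rule PF_superfluous[OF i sub])
    fix f and k :: nat assume "f \<in> ?\<Omega>" "k < 2"
    then show "f k i = \<zero>\<^bsub>K\<^esub>" using i by (auto elim!: less_2_cases[of k] simp: cover_kernel simp del: PF_simps(1))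
  qed
  show "superfluous A (PF 1 (co i)) (a_kernel (PF 1 (co i)) ?P\<Omega> (syzygy_cover i))"
  proof (rule PF_superfluous[OF co(1) a_kernel_submodule[OF syzygy_cover_hom[OF i] F1 \<Omega>]])
    fix f and k :: nat assume f: "f \<in> a_kernel (PF 1 (co i)) ?P\<Omega> (syzygy_cover i)" "k < 1"
    then have fF: "f \<in> carrier (PF 1 (co i))" and z: "syzygy_cover i f = \<zero>\<^bsub>PF 2 i\<^esub>" by (simp_all add: mem_a_kernel del: PF_simps)
    have f0: "f 0 \<in> L (co i)" "f 0 \<in> carrier A" using PF_mem[OF fF] L_A by auto
    \<comment> \<open>The coordinate at \<open>ar i\<close> of \<open>f 0\<close> times
      \<open>a i\<close> is exactly \<open>f 0 (co i)\<close>, the coordinate that has to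
      vanish.\<close>
    have "syzygy_cover i f 1 = \<zero>\<^bsub>PF 2 i\<^esub> 1" by (simp only: z)
    then have "f 0 \<otimes>\<^bsub>A\<^esub> a i = \<zero>\<^bsub>A\<^esub>" using fF by (simp add: syzygy_cover_def del: PF_simps(1))
    then have "(f 0 \<otimes>\<^bsub>A\<^esub> a i) (ar i) = \<zero>\<^bsub>A\<^esub> (ar i)" by simp
    then show "f k (co i) = \<zero>\<^bsub>K\<^esub>" using f(2) f0 i by simp
  qed
qed

text \<open>\<open>tau_rigidI\<close> is applied with \<open>B = L i\<close>. This set is large
  enough to generate \<open>T i\<close>, whose top sits at vertex \<open>i\<close>, and
  multiplication by its members moves every map from P1 to \<open>A\<close> into the injective
  module \<open>P i\<close>.\<close>

lemma T_tau_rigid: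
  assumes i: "i < 2" shows "tau_rigid K A (T i)"
proof (rule tau_rigidI[OF T_left_module[OF i]])
  interpret T: left_module A "T i" by (rule T_left_module[OF i])
  show "\<exists>P1 P0 d1 d0. min_proj_presentation A (T i) P1 P0 d1 d0" using presentation[OF i] by blast
  show "L i \<subseteq> carrier A" using L_A by blast
  show "\<exists>b\<in>L i. \<exists>b'\<in>L i. \<exists>t1\<in>carrier (T i). \<exists>t2\<in>carrier (T i).
      t = b \<odot>\<^bsub>T i\<^esub> t1 \<oplus>\<^bsub>T i\<^esub> b' \<odot>\<^bsub>T i\<^esub> t2" if t: "t \<in> carrier (T i)" for t
  proof -
    obtain x s where x: "x \<in> L i" and s: "s \<in> carrier (S i)" and t_eq: "t = pair x s"
      using T_cases[OF t] .
    \<comment> \<open>As a function, a member of \<open>S i\<close> is a multiple of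
      \<open>e i\<close>, so it can be reused as an algebra element; acting on the generator
      \<open>e i\<close> of \<open>S i\<close>, it gives itself back.\<close>
    have sL: "s \<in> L i" using s i co(3)[of i] by (simp add: L_def mem_S ar_def)
    show ?thesis
    proof (intro bexI)
      show "t = x \<odot>\<^bsub>T i\<^esub> pair (e i) \<zero>\<^bsub>A\<^esub> \<oplus>\<^bsub>T i\<^esub> s \<odot>\<^bsub>T i\<^esub> pair \<zero>\<^bsub>A\<^esub> (e i)"
        using x s sL i L_A S_A by (simp add: t_eq L_mult_e smult_S(1,3))
    qed (use x sL i e_L L_zero S_closed(3,4)[OF i] in simp_all)
  qed
  fix P1 P0 d1 d0 f b
  assume pres: "min_proj_presentation A (T i) P1 P0 d1 d0"
    and f: "f \<in> mod_hom A P1 (regular_module A)" and b: "b \<in> L i"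
  have "left_module A P1"
    using pres by (simp add: min_proj_presentation_def projective_cover_def fg_projective_def)
  then interpret P1: left_module A P1 .
  have fm: "f x \<in> carrier A" if "x \<in> carrier P1" for x using mod_homD(1)[OF f that] by simp
  \<comment> \<open>The values lie in \<open>P i\<close> because \<open>L i\<close> is a left
    ideal.\<close>
  have fb: "(\<lambda>x\<in>carrier P1. f x \<otimes>\<^bsub>A\<^esub> b) \<in> mod_hom A P1 (P i)"
    using mod_homD(4,5)[OF f] fm b L_A L_mult[OF i]
    by (intro mod_homI) (auto simp: A.l_distr A.m_assoc)
  obtain g where g: "g \<in> mod_hom A P0 (P i)" "\<forall>x\<in>carrier P1. f x \<otimes>\<^bsub>A\<^esub> b = g (d1 x)"
  proof -
    \<comment> \<open>The part of \<open>T i\<close> at the other vertex is the socle of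
      \<open>P i\<close>, a multiple of \<open>a i\<close>; the simple summand has no part
      there.\<close>
    have "\<exists>s\<in>carrier (T i). e (co i) \<odot>\<^bsub>T i\<^esub> t = a i \<odot>\<^bsub>T i\<^esub> s" if t: "t \<in> carrier (T i)" for t
    proof -
      obtain x s where x: "x \<in> L i" and s: "s \<in> carrier (S i)" and t_eq: "t = pair x s"
        using T_cases[OF t] .
      have "e (co i) \<otimes>\<^bsub>A\<^esub> x = a i \<otimes>\<^bsub>A\<^esub> (x (ar i) \<odot>\<^bsub>A\<^esub> e i)"
        using x L_A[OF x] i by (intro A_eqI[of i]) (auto simp: L_def)
      then have "e (co i) \<odot>\<^bsub>T i\<^esub> t = a i \<odot>\<^bsub>T i\<^esub> pair (x (ar i) \<odot>\<^bsub>A\<^esub> e i) \<zero>\<^bsub>A\<^esub>"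
        using s i by (simp add: t_eq smult_S)
      moreover have "pair (x (ar i) \<odot>\<^bsub>A\<^esub> e i) \<zero>\<^bsub>A\<^esub> \<in> carrier (T i)"
        using L_smult[OF _ e_L[OF i], of "x (ar i)"] L_A[OF x] S_closed(3)[OF i] by simp
      ultimately show ?thesis by blast
    qed
    with factor_through_presentation[OF i T_left_module[OF i] _ pres fb] that
    show thesis by auto
  qed
  have "g \<in> mod_hom A P0 (regular_module A)"
    using mod_homD[OF g(1)] L_A[where i = i] by (intro mod_homI) auto
  then show "\<exists>g\<in>mod_hom A P0 (regular_module A). \<forall>x\<in>carrier P1. f x \<otimes>\<^bsub>A\<^esub> b = g (d1 x)"
    using g(2) by blast
qed

section \<open>Isomorphism classes\<close>

text \<open>Each non-isomorphism below comes from an element that annihilates one module but not the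
  other: an arrow distinguishes \<open>P i\<close> from the simple modules and from
  \<open>P (co i)\<close>, an idempotent distinguishes the two simple modules.\<close>

lemma mod_iso_annihilator:
  assumes iso: "mod_iso A M N" and M: "left_module A M" and N: "left_module A N" and b: "b \<in> carrier A"
    and ann: "\<And>n. n \<in> carrier N \<Longrightarrow> b \<odot>\<^bsub>N\<^esub> n = \<zero>\<^bsub>N\<^esub>" and m: "m \<in> carrier M"
  shows "b \<odot>\<^bsub>M\<^esub> m = \<zero>\<^bsub>M\<^esub>"
proof -
  interpret M: left_module A M by (rule M)
  obtain f where f: "f \<in> mod_hom A M N" and bij: "bij_betw f (carrier M) (carrier N)"
    using iso by (auto simp: mod_iso_def)
  have "f (b \<odot>\<^bsub>M\<^esub> m) = f \<zero>\<^bsub>M\<^esub>"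
    using mod_homD(5)[OF f b m] ann[OF mod_homD(1)[OF f m]] mod_hom_zero[OF f M N] by simp
  then show ?thesis using inj_onD[OF bij_betw_imp_inj_on[OF bij]] b m by simp
qed

lemma P_not_iso_S:
  assumes i: "i < 2" and k: "k < 2" shows "\<not> mod_iso A (P i) (S k)"
proof
  assume iso: "mod_iso A (P i) (S k)"
  have "a i \<odot>\<^bsub>P i\<^esub> e i = \<zero>\<^bsub>P i\<^esub>"
    by (rule mod_iso_annihilator[OF iso P_left_module[OF i] S_left_module[OF k]])
       (simp_all add: i smult_S(5)[OF k i] e_L)
  then show False using i products(2)[OF i] ea_nonzero(2)[OF i] by simp
qed

lemma P_not_iso_P:
  assumes i: "i < 2" shows "\<not> mod_iso A (P i) (P (co i))"
proof
  assume iso: "mod_iso A (P i) (P (co i))"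
  have "a i \<otimes>\<^bsub>A\<^esub> x = \<zero>\<^bsub>A\<^esub>" if "x \<in> L (co i)" for x
    using i that by (intro A_eqI[of i]) (auto simp: L_def)
  then have "a i \<odot>\<^bsub>P i\<^esub> e i = \<zero>\<^bsub>P i\<^esub>"
    by (intro mod_iso_annihilator[OF iso P_left_module[OF i] P_left_module[OF co(1)]]) (simp_all add: i e_L)
  then show False using i products(2)[OF i] ea_nonzero(2)[OF i] by simp
qed

lemma S_not_iso_S:
  assumes i: "i < 2" shows "\<not> mod_iso A (S i) (S (co i))"
proof
  assume iso: "mod_iso A (S i) (S (co i))"
  have "e i \<odot>\<^bsub>S (co i)\<^esub> x = \<zero>\<^bsub>A\<^esub>" if "x \<in> carrier (S (co i))" for x
    using smult_S(4)[OF co(1) that] i by simp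
  then have "e i \<odot>\<^bsub>S i\<^esub> e i = \<zero>\<^bsub>S i\<^esub>"
    by (intro mod_iso_annihilator[OF iso S_left_module[OF i] S_left_module[OF co(1)]]) (simp_all add: i S_closed(4))
  then show False using i smult_S(3)[OF i S_closed(4)[OF i]] ea_nonzero(1)[OF i] by simp
qed

text \<open>It suffices to find a nonzero \<open>u\<close> at one vertex that is killed by the arrow
  starting there: then the line through \<open>u\<close> is a submodule isomorphic to some
  \<open>S i\<close>, and by simplicity it is all of \<open>M\<close>.\<close>

lemma simple_classification:
  fixes M :: "(nat \<Rightarrow> 'k, 'm) module"
  assumes M: "simple_module A M"
  shows "\<exists>i<2. mod_iso A (S i) M"
proof -
  have M': "left_module A M" using M by (simp add: simple_module_def)
  interpret M: left_module A M by (rule M')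
  obtain m where m: "m \<in> carrier M" "m \<noteq> \<zero>\<^bsub>M\<^esub>"
    using M M.M.zero_closed unfolding simple_module_def zero_module_def by blast
  have "m = e 0 \<odot>\<^bsub>M\<^esub> m \<oplus>\<^bsub>M\<^esub> e 1 \<odot>\<^bsub>M\<^esub> m"
    using products(12)[of 0] m by (simp flip: M.smult_l_distr)
  then have "e 0 \<odot>\<^bsub>M\<^esub> m \<noteq> \<zero>\<^bsub>M\<^esub> \<or> e 1 \<odot>\<^bsub>M\<^esub> m \<noteq> \<zero>\<^bsub>M\<^esub>" using m by auto
  moreover have "(0 :: nat) < 2" "(1 :: nat) < 2" by simp_all
  ultimately obtain i where i: "i < 2" "e i \<odot>\<^bsub>M\<^esub> m \<noteq> \<zero>\<^bsub>M\<^esub>" by metis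
  \<comment> \<open>If the arrow \<open>a i\<close> does not kill \<open>m\<close>, its image sits
    at the vertex \<open>co i\<close> and is killed by the next arrow, because paths of length two
    are zero.\<close>
  have ex: "\<exists>i u. i < 2 \<and> u \<in> carrier M \<and> u \<noteq> \<zero>\<^bsub>M\<^esub> \<and> e i \<odot>\<^bsub>M\<^esub> u = u \<and> a i \<odot>\<^bsub>M\<^esub> u = \<zero>\<^bsub>M\<^esub>"
  proof (cases "a i \<odot>\<^bsub>M\<^esub> m = \<zero>\<^bsub>M\<^esub>")
    case True
    then show ?thesis
      using i m products(1,2)[OF i(1)]
      by (intro exI[of _ i] exI[of _ "e i \<odot>\<^bsub>M\<^esub> m"]) (simp flip: M.smult_assoc)
  next
    case False
    then show ?thesis
      using i m products(3,8)[OF i(1)]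
      by (intro exI[of _ "co i"] exI[of _ "a i \<odot>\<^bsub>M\<^esub> m"]) (simp flip: M.smult_assoc)
  qed
  then obtain i u where i: "i < 2" and u: "u \<in> carrier M" "u \<noteq> \<zero>\<^bsub>M\<^esub>" "e i \<odot>\<^bsub>M\<^esub> u = u" "a i \<odot>\<^bsub>M\<^esub> u = \<zero>\<^bsub>M\<^esub>"
    by blast
  \<comment> \<open>The other idempotent and both arrows kill \<open>u\<close>, so \<open>A\<close>
    acts on it through the character \<open>x \<mapsto> x i\<close>, as it does on
    \<open>S i\<close>.\<close>
  have act: "x \<odot>\<^bsub>M\<^esub> u = scalar (x i) \<odot>\<^bsub>M\<^esub> u" if x: "x \<in> carrier A" for x
  proof -
    have 1: "e (co i) \<odot>\<^bsub>M\<^esub> u = \<zero>\<^bsub>M\<^esub>"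
    proof -
      have "e (co i) \<odot>\<^bsub>M\<^esub> (e i \<odot>\<^bsub>M\<^esub> u) = \<zero>\<^bsub>M\<^esub>"
        using i u(1) products(11)[OF i] by (simp flip: M.smult_assoc)
      then show ?thesis using u(3) by simp
    qed
    have 2: "a (co i) \<odot>\<^bsub>M\<^esub> u = \<zero>\<^bsub>M\<^esub>"
    proof -
      have "a (co i) \<otimes>\<^bsub>A\<^esub> e i = \<zero>\<^bsub>A\<^esub>" using i by (intro A_eqI[of i]) auto
      then have "a (co i) \<odot>\<^bsub>M\<^esub> (e i \<odot>\<^bsub>M\<^esub> u) = \<zero>\<^bsub>M\<^esub>"
        using i u(1) by (simp flip: M.smult_assoc)
      then show ?thesis using u(3) by simp
    qed
    have "x \<odot>\<^bsub>M\<^esub> u = (x i \<odot>\<^bsub>A\<^esub> e i \<oplus>\<^bsub>A\<^esub> x (co i) \<odot>\<^bsub>A\<^esub> e (co i) \<oplus>\<^bsub>A\<^esub> x (ar i) \<odot>\<^bsub>A\<^esub> a i \<oplus>\<^bsub>A\<^esub>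
        x (ar (co i)) \<odot>\<^bsub>A\<^esub> a (co i)) \<odot>\<^bsub>M\<^esub> u"
      using decomp[OF i x] by simp
    also have "\<dots> = scalar (x i) \<odot>\<^bsub>M\<^esub> u"
      using x i u 1 2 scalar(1) by (simp add: M.smult_l_distr smult_scalar[OF M'])
    finally show ?thesis .
  qed
  interpret S: left_module A "S i" by (rule S_left_module[OF i])
  let ?f = "\<lambda>s\<in>carrier (S i). s \<odot>\<^bsub>M\<^esub> u"
  have f: "?f \<in> mod_hom A (S i) M"
  proof (rule mod_homI)
    fix b s assume b: "b \<in> carrier A" and s: "s \<in> carrier (S i)"
    have bs: "b \<odot>\<^bsub>S i\<^esub> s \<in> carrier (S i)" using b s i by (simp add: S_closed(1))
    have "(b \<odot>\<^bsub>S i\<^esub> s) \<odot>\<^bsub>M\<^esub> u = scalar ((b \<otimes>\<^bsub>A\<^esub> s) i) \<odot>\<^bsub>M\<^esub> u"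
      using act[OF S_A[OF bs]] i by simp
    also have "\<dots> = b \<odot>\<^bsub>M\<^esub> (s \<odot>\<^bsub>M\<^esub> u)"
      using act[of "b \<otimes>\<^bsub>A\<^esub> s"] b S_A[OF s] u(1) by (simp add: M.smult_assoc)
    finally show "?f (b \<odot>\<^bsub>S i\<^esub> s) = b \<odot>\<^bsub>M\<^esub> ?f s" using s bs by simp
  qed (use u(1) i in \<open>auto simp: S_A S_closed M.smult_l_distr\<close>)
  have "inj_on ?f (carrier (S i))"
  proof (rule mod_hom_injI[OF f S.left_module_axioms M'])
    fix s assume s: "s \<in> carrier (S i)" "?f s = \<zero>\<^bsub>M\<^esub>"
    have si: "s i \<in> carrier K" using S_A[OF s(1)] by simp
    have z: "scalar (s i) \<odot>\<^bsub>M\<^esub> u = \<zero>\<^bsub>M\<^esub>" using s act[OF S_A[OF s(1)]] by simp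
    have "s i = \<zero>\<^bsub>K\<^esub>"
    proof (rule ccontr)
      assume "s i \<noteq> \<zero>\<^bsub>K\<^esub>"
      then have unit: "s i \<in> Units K" using si by (simp add: K.field_Units)
      let ?c = "inv\<^bsub>K\<^esub> s i"
      have c: "?c \<in> carrier K" by (rule K.Units_inv_closed[OF unit])
      have "scalar ?c \<odot>\<^bsub>M\<^esub> (scalar (s i) \<odot>\<^bsub>M\<^esub> u) = scalar (?c \<otimes>\<^bsub>K\<^esub> s i) \<odot>\<^bsub>M\<^esub> u"
        using c si scalar(1) u(1) by (simp add: scalar_mult M.smult_assoc)
      also have "\<dots> = u" using K.Units_l_inv[OF unit] u(1) by simp
      finally show False using z u(2) scalar(1)[OF c] by simp
    qed
    then show "s = \<zero>\<^bsub>S i\<^esub>"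
      using S_eqI[OF s(1), of "\<zero>\<^bsub>A\<^esub>"] S_closed(3)[OF i] by simp
  qed
  moreover have "?f ` carrier (S i) = carrier M"
  proof -
    have "submodule (?f ` carrier (S i)) A M"
      by (rule image_submodule[OF f S.left_module_axioms M' S.submodule_carrier])
    moreover have "u \<in> ?f ` carrier (S i)"
      using S_closed(4)[OF i] u(3) by (intro image_eqI[of _ _ "e i"]) simp_all
    ultimately show ?thesis using M u(2) unfolding simple_module_def by blast
  qed
  ultimately show ?thesis using f i unfolding mod_iso_def bij_betw_def by blast
qed

lemma num_simples_A: "num_simples A = 2"
proof -
  let ?C = "{S :: (nat \<Rightarrow> 'k, nat \<Rightarrow> 'k) module. simple_module A S}"
  let ?r = "{(S, S'). simple_module A S \<and> simple_module A S' \<and> mod_iso A (S :: (nat \<Rightarrow> 'k, nat \<Rightarrow> 'k) module) (S' :: (nat \<Rightarrow> 'k, nat \<Rightarrow> 'k) module)}"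
  have left: "left_module A M" if "simple_module A M" for M :: "(nat \<Rightarrow> 'k, nat \<Rightarrow> 'k) module"
    using that by (simp add: simple_module_def)
  have S01: "simple_module A (S 0)" "simple_module A (S 1)" by (simp_all add: S_simple)
  have rel: "?r `` {M} = ?r `` {N}"
    if "simple_module A M" "simple_module A N" "mod_iso A M N" for M N
  proof -
    have "mod_iso A N M" using mod_iso_sym[OF that(3) left[OF that(1)]] .
    then have "mod_iso A M Q \<longleftrightarrow> mod_iso A N Q" for Q :: "(nat \<Rightarrow> 'k, nat \<Rightarrow> 'k) module"
      using mod_iso_trans[OF _ _ left[OF that(1)], of N Q] mod_iso_trans[OF _ _ left[OF that(2)], of M Q] that(3)
      by metis
    then show ?thesis using that by auto
  qed
  have "?C // ?r = {?r `` {S 0}, ?r `` {S 1}}"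
  proof (intro equalityI subsetI)
    fix Q assume "Q \<in> ?C // ?r"
    then obtain M where M: "simple_module A M" "Q = ?r `` {M}" by (auto simp: quotient_def)
    obtain i where "i < 2" "mod_iso A (S i) M" using simple_classification[OF M(1)] by blast
    then have "?r `` {S i} = Q" using rel[of "S i" M] M S_simple by simp
    moreover have "i = 0 \<or> i = 1" using \<open>i < 2\<close> by auto
    ultimately show "Q \<in> {?r `` {S 0}, ?r `` {S 1}}" by blast
  qed (use S01 in \<open>auto simp: quotient_def\<close>)
  moreover have "?r `` {S 0} \<noteq> ?r `` {S 1}"
  proof
    assume eq: "?r `` {S 0} = ?r `` {S 1}"
    have "S 1 \<in> ?r `` {S 1}" using S01 mod_iso_refl[OF left[OF S01(2)]] by simp
    then have "mod_iso A (S 0) (S 1)" unfolding eq[symmetric] by simp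
    then show False using S_not_iso_S[of 0] by simp
  qed
  ultimately show ?thesis by (simp add: num_simples_def)
qed

lemma T_tau_tilting:
  assumes i: "i < 2" shows "tau_tilting K A (T i)"
  unfolding tau_tilting_def num_simples_A
proof (intro conjI exI ballI impI)
  show "fd_module K A (T i)" by (rule T_fd_module[OF i])
  show "tau_rigid K A (T i)" by (rule T_tau_rigid[OF i])
  \<comment> \<open>One-term sums instead of the summands themselves, to match the element type of
    \<open>T i\<close>.\<close>
  let ?Z = "\<lambda>k. dir_sum {k} (summand i)"
  note iso = mod_iso_dir_sum_singleton[of A "summand i", OF summand_left_module[OF i]]
  have Z: "left_module A (?Z k)" for k
    by (intro dir_sum_left_module ring summand_left_module i)
  show "indecomposable A (?Z k)" for k
    by (rule indecomposable_iso[OF summand_indecomposable[OF i] iso Z])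
  show "\<not> mod_iso A (?Z k) (?Z l)" if "k \<in> {1..2}" "l \<in> {1..2}" "k \<noteq> l" for k l
  proof
    assume *: "mod_iso A (?Z k) (?Z l)"
    have "mod_iso A (summand i k) (summand i l)"
      using mod_iso_trans[OF mod_iso_trans[OF iso * summand_left_module[OF i]]
          mod_iso_sym[OF iso summand_left_module[OF i]] summand_left_module[OF i]] .
    moreover from this have "mod_iso A (summand i l) (summand i k)"
      by (rule mod_iso_sym[OF _ summand_left_module[OF i]])
    moreover have "k = 1 \<and> l = 2 \<or> k = 2 \<and> l = 1" using that by auto
    ultimately show False using P_not_iso_S[OF i i] by (auto simp: summand_def)
  qed
  show "mod_iso A (T i) (dir_sum {1..2} ?Z)"
    unfolding T_def by (rule mod_iso_dir_sum_singletons) (rule summand_left_module[OF i])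
qed

section \<open>Extensions\<close>

text \<open>Both \<open>P i\<close> and \<open>S i\<close> are cyclic with generator
  \<open>e i\<close>, so rank one suffices; the index \<open>0\<close> in \<open>?p\<close> is the
  single coordinate of \<open>free_module A 1\<close>.\<close>

lemma summand_generated:
  assumes i: "i < 2"
  shows "\<exists>r p. p \<in> mod_hom A (free_module A r) (summand i k) \<and>
    p ` carrier (free_module A r) = carrier (summand i k)"
proof -
  interpret F: left_module A "free_module A 1" by (rule free_left_module[OF ring])
  interpret M: left_module A "summand i k" by (rule summand_left_module[OF i])
  let ?M = "summand i k"
  let ?p = "\<lambda>f\<in>carrier (free_module A 1). f 0 \<odot>\<^bsub>?M\<^esub> e i"
  have ei: "e i \<in> carrier ?M" using e_L[OF i] S_closed(4)[OF i] by (simp add: summand_def)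
  have f0: "f 0 \<in> carrier A" if "f \<in> carrier (free_module A 1)" for f
    using that by (auto simp: PiE_iff)
  have p: "?p \<in> mod_hom A (free_module A 1) ?M"
  proof (rule mod_homI)
    fix f g assume f: "f \<in> carrier (free_module A 1)" and g: "g \<in> carrier (free_module A 1)"
    then have "f \<oplus>\<^bsub>free_module A 1\<^esub> g \<in> carrier (free_module A 1)" by (rule F.M.a_closed)
    then show "?p (f \<oplus>\<^bsub>free_module A 1\<^esub> g) = ?p f \<oplus>\<^bsub>?M\<^esub> ?p g"
      using f g f0 ei by (simp add: M.smult_l_distr del: free_simps(1))
  next
    fix b f assume b: "b \<in> carrier A" and f: "f \<in> carrier (free_module A 1)"
    then have "b \<odot>\<^bsub>free_module A 1\<^esub> f \<in> carrier (free_module A 1)" by (rule F.smult_closed)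
    then show "?p (b \<odot>\<^bsub>free_module A 1\<^esub> f) = b \<odot>\<^bsub>?M\<^esub> ?p f"
      using b f f0 ei by (simp add: M.smult_assoc del: free_simps(1))
  qed (use f0 ei in simp_all)
  moreover have "?p ` carrier (free_module A 1) = carrier ?M"
  proof (intro equalityI subsetI)
    fix x assume x: "x \<in> carrier ?M"
    have xA: "x \<in> carrier A" and "x \<odot>\<^bsub>?M\<^esub> e i = x"
      using x i L_A S_A L_mult_e smult_S(3)[OF i] by (auto simp: summand_def split: if_splits)
    moreover have "(\<lambda>k\<in>{..<1}. x) \<in> carrier (free_module A 1)" using xA by simp
    ultimately show "x \<in> ?p ` carrier (free_module A 1)"
      by (intro image_eqI[of _ _ "\<lambda>k\<in>{..<1}. x"]) (simp_all del: free_simps(1))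
  qed (use mod_homD(1)[OF p] in blast)
  ultimately show ?thesis by blast
qed

text \<open>Injectivity of \<open>P j\<close> extends homomorphisms from the kernel of any
  epimorphism onto the first argument.\<close>

lemma Ext1_P:
  assumes i: "i < 2" and j: "j < 2"
  shows "zero_module (Ext1 A (summand i k) (P j))"
proof (rule Ext1_zeroI[OF ring summand_left_module[OF i] P_left_module[OF j] summand_generated[OF i]])
  fix r p f
  assume "p \<in> mod_hom A (free_module A r) (summand i k)"
    and f: "f \<in> mod_hom A (free_module A r\<lparr>carrier := a_kernel (free_module A r) (summand i k) p\<rparr>) (P j)"
  then have "submodule (a_kernel (free_module A r) (summand i k) p) A (free_module A r)"
    by (intro a_kernel_submodule free_left_module[OF ring] summand_left_module[OF i])
  from P_injective[OF j free_left_module[OF ring] this f]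
  show "\<exists>g\<in>mod_hom A (free_module A r) (P j). \<forall>x\<in>a_kernel (free_module A r) (summand i k) p. g x = f x" .
qed

text \<open>Any epimorphism \<open>p\<close> onto \<open>P i\<close> splits. Elements of
  \<open>P i\<close> are elements of \<open>A\<close>, so a lift \<open>w\<close> of the generator
  \<open>e i\<close> gives the section sending an element to its product with \<open>w\<close>.
  Subtracting the section of \<open>p x\<close> from \<open>x\<close> projects the free module onto
  the kernel, and composing \<open>f\<close> with this projection extends \<open>f\<close>.\<close>

lemma Ext1_from_P:
  assumes i: "i < 2" and N: "left_module A N"
  shows "zero_module (Ext1 A (P i) N)"
proof (rule Ext1_zeroI[OF ring P_left_module[OF i] N])
  show "\<exists>r p. p \<in> mod_hom A (free_module A r) (P i) \<and> p ` carrier (free_module A r) = carrier (P i)"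
    using summand_generated[OF i, of 1] by (simp add: summand_def)
  fix r p f
  let ?F = "free_module A r" and ?\<Omega> = "a_kernel (free_module A r) (P i) p"
  assume p: "p \<in> mod_hom A ?F (P i)" and surj: "p ` carrier ?F = carrier (P i)"
    and f: "f \<in> mod_hom A (?F\<lparr>carrier := ?\<Omega>\<rparr>) N"
  interpret F: left_module A ?F by (rule free_left_module[OF ring])
  interpret N: left_module A N by (rule N)
  interpret P: left_module A "P i" by (rule P_left_module[OF i])
  note hp = mod_homD[OF p]
  have pL: "p x \<in> L i" "p x \<in> carrier A" if "x \<in> carrier ?F" for x
    using hp(1)[OF that] L_A by auto
  obtain w where w: "w \<in> carrier ?F" "p w = e i"
    using mod_hom_surjE[OF surj, of "e i"] e_L[OF i] by auto
  define q where "q x = x \<oplus>\<^bsub>?F\<^esub> \<ominus>\<^bsub>?F\<^esub> (p x \<odot>\<^bsub>?F\<^esub> w)" for x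
  have qF: "q x \<in> carrier ?F" if "x \<in> carrier ?F" for x
    unfolding q_def using that w(1) pL(2)
    by (intro F.M.a_closed F.M.a_inv_closed F.smult_closed)
  have pq: "p (p x \<odot>\<^bsub>?F\<^esub> w) = p x" if "x \<in> carrier ?F" for x
    using hp(5)[OF pL(2)[OF that] w(1)] w(2) L_mult_e[OF i pL(1)[OF that]] by simp
  have q\<Omega>: "q x \<in> ?\<Omega>" if x: "x \<in> carrier ?F" for x
  proof -
    have cl: "p x \<odot>\<^bsub>?F\<^esub> w \<in> carrier ?F" using pL(2)[OF x] w(1) by (rule F.smult_closed)
    have "p (q x) = p x \<oplus>\<^bsub>P i\<^esub> \<ominus>\<^bsub>P i\<^esub> p x"
      using hp(4)[OF x F.M.a_inv_closed[OF cl]] mod_hom_minus[OF p F.left_module_axioms P.left_module_axioms cl]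
        pq[OF x] by (simp add: q_def)
    also have "\<dots> = \<zero>\<^bsub>P i\<^esub>" using hp(1)[OF x] by (rule P.M.r_neg)
    finally show ?thesis using qF[OF x] by (simp add: mem_a_kernel)
  qed
  have q_add: "q (x \<oplus>\<^bsub>?F\<^esub> y) = q x \<oplus>\<^bsub>?F\<^esub> q y" if "x \<in> carrier ?F" "y \<in> carrier ?F" for x y
    using that hp(4)[OF that] pL(2) w(1)
    by (simp add: q_def F.smult_l_distr F.M.minus_add F.M.a_ac del: free_simps)
  have q_smult: "q (b \<odot>\<^bsub>?F\<^esub> x) = b \<odot>\<^bsub>?F\<^esub> q x" if b: "b \<in> carrier A" and x: "x \<in> carrier ?F" for b x
  proof -
    let ?y = "p x \<odot>\<^bsub>?F\<^esub> w"
    have y: "?y \<in> carrier ?F" using pL(2)[OF x] w(1) by (rule F.smult_closed)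
    have "b \<odot>\<^bsub>?F\<^esub> (\<ominus>\<^bsub>?F\<^esub> ?y) = \<ominus>\<^bsub>?F\<^esub> (b \<odot>\<^bsub>?F\<^esub> ?y)"
    proof -
      have "b \<odot>\<^bsub>?F\<^esub> (\<ominus>\<^bsub>?F\<^esub> ?y) \<oplus>\<^bsub>?F\<^esub> b \<odot>\<^bsub>?F\<^esub> ?y = \<zero>\<^bsub>?F\<^esub>"
        using b y by (simp add: F.M.l_neg del: free_simps flip: F.smult_r_distr)
      then show ?thesis
        using F.M.minus_equality[of "b \<odot>\<^bsub>?F\<^esub> (\<ominus>\<^bsub>?F\<^esub> ?y)" "b \<odot>\<^bsub>?F\<^esub> ?y"] b y by (simp del: free_simps)
    qed
    then show ?thesis
      using b x y hp(5)[OF b x] pL(2)[OF x] w(1)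
      by (simp add: q_def F.smult_assoc F.smult_r_distr del: free_simps)
  qed
  note hf = mod_homD[OF f]
  have "(\<lambda>x\<in>carrier ?F. f (q x)) \<in> mod_hom A ?F N"
  proof (rule mod_homI)
    fix x y assume x: "x \<in> carrier ?F"
    show "(\<lambda>x\<in>carrier ?F. f (q x)) x \<in> carrier N"
      using hf(1)[of "q x"] q\<Omega>[OF x] x by (simp del: free_simps)
    fix b assume "b \<in> carrier A"
    then show "(\<lambda>x\<in>carrier ?F. f (q x)) (b \<odot>\<^bsub>?F\<^esub> x) = b \<odot>\<^bsub>N\<^esub> (\<lambda>x\<in>carrier ?F. f (q x)) x"
      using hf(5)[of b "q x"] q\<Omega>[OF x] x q_smult[of b x] by (simp del: free_simps)
  next
    fix x y assume xy: "x \<in> carrier ?F" "y \<in> carrier ?F"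
    then show "(\<lambda>x\<in>carrier ?F. f (q x)) (x \<oplus>\<^bsub>?F\<^esub> y) =
        (\<lambda>x\<in>carrier ?F. f (q x)) x \<oplus>\<^bsub>N\<^esub> (\<lambda>x\<in>carrier ?F. f (q x)) y"
      using hf(4)[of "q x" "q y"] q\<Omega> q_add[OF xy] by (simp del: free_simps)
  qed simp
  moreover have "(\<lambda>x\<in>carrier ?F. f (q x)) x = f x" if "x \<in> ?\<Omega>" for x
  proof -
    have x: "x \<in> carrier ?F" "p x = \<zero>\<^bsub>A\<^esub>" using that by (simp_all add: mem_a_kernel del: free_simps)
    have "q x = x" using x w(1) by (simp add: q_def del: free_simps)
    then show ?thesis using x by (simp del: free_simps)
  qed
  ultimately show "\<exists>g\<in>mod_hom A ?F N. \<forall>x\<in>?\<Omega>. g x = f x" by blast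
qed

text \<open>Index 1 of \<open>summand 1\<close> is \<open>P 1\<close>, which is not isomorphic to
  either summand at vertex 0. Whatever the value of \<open>s 1\<close>, one Ext group vanishes
  because \<open>P 1\<close> is projective and the other because it is injective.\<close>

lemma no_exchange_permutation:
  assumes "s permutes {1..2}"
    and Ext: "\<forall>i\<in>{1..2}. (\<forall>j\<in>{1..2}. \<not> mod_iso A (summand 1 i) (summand 0 j)) \<longrightarrow>
      \<not> zero_module (dir_sum2 (Ext1 A (summand 1 i) (summand 0 (s i))) (Ext1 A (summand 0 (s i)) (summand 1 i)))"
  shows False
proof -
  have "\<forall>j\<in>{1..2}. \<not> mod_iso A (summand 1 1) (summand 0 j)"
    using P_not_iso_P[of 1] P_not_iso_S[of 1 0] by (simp add: summand_def co_def)
  then have "\<not> zero_module (dir_sum2 (Ext1 A (summand 1 1) (summand 0 (s 1))) (Ext1 A (summand 0 (s 1)) (summand 1 1)))"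
    using Ext by simp
  moreover have "zero_module (Ext1 A (summand 1 1) (summand 0 (s 1)))"
    using Ext1_from_P[OF _ summand_left_module, of 1 0 "s 1"] by (simp add: summand_def[of _ "Suc 0"])
  moreover have "zero_module (Ext1 A (summand 0 (s 1)) (summand 1 1))"
    using Ext1_P[of 0 1 "s 1"] by (simp add: summand_def[of _ "Suc 0"])
  ultimately show False by (simp add: zero_module_def dir_sum2_def)
qed

end

theorem mainTheorem2:
  fixes K :: "('k, 'r) ring_scheme"
  assumes "field K"
  shows "\<exists>(A :: ('k, nat \<Rightarrow> 'k) module) (n :: nat)
           (X :: nat \<Rightarrow> (nat \<Rightarrow> 'k, nat \<Rightarrow> 'k) module) (Y :: nat \<Rightarrow> (nat \<Rightarrow> 'k, nat \<Rightarrow> 'k) module).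
    fd_algebra K A \<and> n = num_simples A \<and>
    (\<forall>i\<in>{1..n}. fd_module K A (X i) \<and> indecomposable A (X i)) \<and>
    (\<forall>i\<in>{1..n}. fd_module K A (Y i) \<and> indecomposable A (Y i)) \<and>
    tau_tilting K A (dir_sum {1..n} X) \<and>
    tau_tilting K A (dir_sum {1..n} Y) \<and>
    \<not> (\<exists>s. s permutes {1..n} \<and>
        (\<forall>i\<in>{1..n}. \<forall>j\<in>{1..n}. mod_iso A (X i) (Y j) \<longrightarrow> s i = j) \<and>
        (\<forall>i\<in>{1..n}. (\<forall>j\<in>{1..n}. \<not> mod_iso A (X i) (Y j)) \<longrightarrow>
          \<not> zero_module (dir_sum2 (Ext1 A (X i) (Y (s i))) (Ext1 A (Y (s i)) (X i)))))"
proof -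
  interpret cycle K using assms by (rule cycle.intro)
  have fd: "fd_module K A (summand i k)" if "i < 2" for i k
    using that by (simp add: summand_def P_fd_module S_fd_module)
  show ?thesis
  proof (rule exI[of _ A], rule exI[of _ "2 :: nat"], rule exI[of _ "summand 1"], rule exI[of _ "summand 0"],
      intro conjI)
    show "fd_algebra K A" by (rule fd_algebra_A)
    show "2 = num_simples A" by (rule num_simples_A[symmetric])
    show "tau_tilting K A (dir_sum {1..2} (summand 1))" "tau_tilting K A (dir_sum {1..2} (summand 0))"
      using T_tau_tilting[of 1] T_tau_tilting[of 0] by (simp_all add: T_def)
    show "\<not> (\<exists>s. s permutes {1..2} \<and>
        (\<forall>i\<in>{1..2}. \<forall>j\<in>{1..2}. mod_iso A (summand 1 i) (summand 0 j) \<longrightarrow> s i = j) \<and>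
        (\<forall>i\<in>{1..2}. (\<forall>j\<in>{1..2}. \<not> mod_iso A (summand 1 i) (summand 0 j)) \<longrightarrow>
          \<not> zero_module (dir_sum2 (Ext1 A (summand 1 i) (summand 0 (s i)))
              (Ext1 A (summand 0 (s i)) (summand 1 i)))))"
      using no_exchange_permutation by blast
  qed (simp_all add: fd summand_indecomposable)
qed

end
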